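(* Let $\mathbf{M}=(M;\dots)$ be a one-sorted structure, let $C\subseteq M$ be $0$-definable with $|C|\ge 2$, and let $A$ be a commutative semiring. Suppose $C$ is stably embedded in $\mathbf{M}$ and $\mu$ is an $A$-valued Fubini measure on $\operatorname{Def}(C)$. Then $\mu$ extends uniquely to an $A$-valued Fubini measure on $\operatorname{Def}(C)^{\mathrm{f}}$.
   Context: "Definable" means definable in $\mathbf{M}$ with parameters. $\operatorname{Def}(\mathbf{M})$ is the category whose objects are the definable sets $X\subseteq M^m$ (with $m$ part of the data of the object) and whose morphisms $X\to Y$ are the definable maps $X\to Y$. A commutative semiring is a set $A$ with addition and multiplication making it a commutative monoid under each (neutral elements $0$ and $1$), with multiplication distributive over addition and $0\cdot a=0$ for all $a$. Let $\mathcal{C}$ be a full subcategory of $\operatorname{Def}(\mathbf{M})$ such that for all objects $X,Y$: (a) if $X,Y\subseteq M^m$ then $X\cup Y$ is an object; (b) every definable subset of $X$ is an object; (c) $X\times Y$ is an object. An $A$-valued Fubini measure on $\mathcal{C}$ is a map $\mu$ from the objects of $\mathcal{C}$ to $A$ such that: $\mu(\emptyset)=0$ and $\mu(X)=1$ for every singleton $X$; $\mu(X\cup Y)=\mu(X)+\mu(Y)$ for disjoint objects $X,Y\subseteq M^m$; and every definable map $f:X\to Y$ between objects satisfies (F1) $\{\mu(f^{-1}(y)):y\in Y\}$ is finite, (F2) for each $a\in A$ the set $\{y\in Y:\mu(f^{-1}(y))=a\}$ is definable, (F3) if $\mu(f^{-1}(y))=a$ for all $y\in Y$, then $\mu(X)=a\mu(Y)$.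 $\operatorname{Def}(C)$ is the full subcategory of $\operatorname{Def}(\mathbf{M})$ whose objects are the definable subsets of the powers $C^n$. $C$ is stably embedded in $\mathbf{M}$ if for every $0$-definable $\mathcal{S}\subseteq M^m\times M^n$ there is a $0$-definable $\mathcal{T}\subseteq M^k\times M^n$ such that for every $p\in M^m$ there is $c\in C^k$ with $\mathcal{S}(p)\cap C^n=\mathcal{T}(c)\cap C^n$, where $\mathcal{S}(p)=\{q:(p,q)\in\mathcal{S}\}$. Fiberability: if $\mathbf{M}$ is $\omega$-saturated, a definable $X\subseteq M^m$ is $0$-step fiberable over $C$ if there is a definable injective $f:X\to M^n$ with $f(X)\subseteq C^n$, and $(r+1)$-step fiberable over $C$ if there is a definable $f:X\to M^n$ such that $f(X)$ and every fiber $f^{-1}(y)$ ($y\in M^n$) are $r$-step fiberable over $C$. For general $\mathbf{M}$, a definable $X$ is $r$-step fiberable over $C$ iff $X^*$ is $r$-step fiberable over $C^*$ in an (equivalently, any) $\omega$-saturated elementary extension $\mathbf{M}^*$ of $\mathbf{M}$, where $X^*,C^*$ are defined in $\mathbf{M}^*$ by the same formulas with parameters. $X$ is fiberable over $C$ if it is $r$-step fiberable over $C$ for some $r$. $\operatorname{Def}(C)^{\mathrm{f}}$ is the full subcategory of $\operatorname{Def}(\mathbf{M})$ whose objects are the definable sets fiberable over $C$; it contains $\operatorname{Def}(C)$ and satisfies (a), (b), (c). *)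

theory Defs
  imports Main "HOL-Library.FuncSet"
begin

section \<open>First-order structures\<close>

datatype 'f trm = Var nat | Fn 'f "'f trm list"

datatype ('f, 'r) fm =
    Eq "'f trm" "'f trm"
  | Rel 'r "'f trm list"
  | Neg "('f, 'r) fm"
  | Conj "('f, 'r) fm" "('f, 'r) fm"
  | Ex nat "('f, 'r) fm"

text \<open>Only symbols in \<open>funs\<close> and \<open>rels\<close> belong to the language; either set may be empty.
  Constants are function symbols of arity 0.\<close>

record ('f, 'r) lang =
  funs :: "'f set"
  rels :: "'r set"
  far :: "'f \<Rightarrow> nat"
  rar :: "'r \<Rightarrow> nat"

record ('f, 'r, 'm) fo_struct =
  univ :: "'m set"
  ifun :: "'f \<Rightarrow> 'm list \<Rightarrow> 'm"
  irel :: "'r \<Rightarrow> 'm list \<Rightarrow> bool"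

fun wf_trm :: "('f, 'r) lang \<Rightarrow> 'f trm \<Rightarrow> bool" where
  "wf_trm L (Var i) = True"
| "wf_trm L (Fn f ts) = (f \<in> funs L \<and> length ts = far L f \<and> (\<forall>t\<in>set ts. wf_trm L t))"

fun fv_trm :: "'f trm \<Rightarrow> nat set" where
  "fv_trm (Var i) = {i}"
| "fv_trm (Fn f ts) = (\<Union>t\<in>set ts. fv_trm t)"

fun eval :: "('f, 'r, 'm) fo_struct \<Rightarrow> (nat \<Rightarrow> 'm) \<Rightarrow> 'f trm \<Rightarrow> 'm" where
  "eval M v (Var i) = v i"
| "eval M v (Fn f ts) = ifun M f (map (eval M v) ts)"

fun wf_fm :: "('f, 'r) lang \<Rightarrow> ('f, 'r) fm \<Rightarrow> bool" where
  "wf_fm L (Eq s t) = (wf_trm L s \<and> wf_trm L t)"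
| "wf_fm L (Rel r ts) = (r \<in> rels L \<and> length ts = rar L r \<and> (\<forall>t\<in>set ts. wf_trm L t))"
| "wf_fm L (Neg \<phi>) = wf_fm L \<phi>"
| "wf_fm L (Conj \<phi> \<psi>) = (wf_fm L \<phi> \<and> wf_fm L \<psi>)"
| "wf_fm L (Ex i \<phi>) = wf_fm L \<phi>"

fun fv :: "('f, 'r) fm \<Rightarrow> nat set" where
  "fv (Eq s t) = fv_trm s \<union> fv_trm t"
| "fv (Rel r ts) = (\<Union>t\<in>set ts. fv_trm t)"
| "fv (Neg \<phi>) = fv \<phi>"
| "fv (Conj \<phi> \<psi>) = fv \<phi> \<union> fv \<psi>"
| "fv (Ex i \<phi>) = fv \<phi> - {i}"

fun sat :: "('f, 'r, 'm) fo_struct \<Rightarrow> (nat \<Rightarrow> 'm) \<Rightarrow> ('f, 'r) fm \<Rightarrow> bool" where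
  "sat M v (Eq s t) = (eval M v s = eval M v t)"
| "sat M v (Rel r ts) = irel M r (map (eval M v) ts)"
| "sat M v (Neg \<phi>) = (\<not> sat M v \<phi>)"
| "sat M v (Conj \<phi> \<psi>) = (sat M v \<phi> \<and> sat M v \<psi>)"
| "sat M v (Ex i \<phi>) = (\<exists>a\<in>univ M. sat M (v(i := a)) \<phi>)"

definition is_struct :: "('f, 'r) lang \<Rightarrow> ('f, 'r, 'm) fo_struct \<Rightarrow> bool" where
  "is_struct L M \<longleftrightarrow> univ M \<noteq> {} \<and>
     (\<forall>f\<in>funs L. \<forall>as. length as = far L f \<and> set as \<subseteq> univ M \<longrightarrow> ifun M f as \<in> univ M)"

definition forms :: "('f, 'r) lang \<Rightarrow> nat \<Rightarrow> ('f, 'r) fm set" where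
  "forms L k = {\<phi>. wf_fm L \<phi> \<and> fv \<phi> \<subseteq> {..<k}}"

text \<open>A formula in \<open>forms L k\<close> is evaluated at a list \<open>as\<close> of length \<open>k\<close>
  via the assignment \<open>nth as\<close>; the values of \<open>nth\<close> beyond the length are irrelevant.\<close>

definition elem_emb ::
  "('f, 'r) lang \<Rightarrow> ('f, 'r, 'm) fo_struct \<Rightarrow> ('f, 'r, 'n) fo_struct \<Rightarrow> ('m \<Rightarrow> 'n) \<Rightarrow> bool" where
  "elem_emb L M N h \<longleftrightarrow> h ` univ M \<subseteq> univ N \<and>
     (\<forall>as \<phi>. set as \<subseteq> univ M \<and> \<phi> \<in> forms L (length as) \<longrightarrow>
        (sat M (nth as) \<phi> \<longleftrightarrow> sat N (nth (map h as)) \<phi>))"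

text \<open>In \<open>\<omega>\<close>-saturation, variable 0 is the variable of the 1-type and the remaining
  variables are replaced by the finitely many parameters \<open>ps\<close>.\<close>

definition omega_saturated :: "('f, 'r) lang \<Rightarrow> ('f, 'r, 'm) fo_struct \<Rightarrow> bool" where
  "omega_saturated L M \<longleftrightarrow>
     (\<forall>ps \<Gamma>. set ps \<subseteq> univ M \<and> \<Gamma> \<subseteq> forms L (Suc (length ps)) \<and>
        (\<forall>\<Delta>\<subseteq>\<Gamma>. finite \<Delta> \<longrightarrow> (\<exists>a\<in>univ M. \<forall>\<phi>\<in>\<Delta>. sat M (nth (a # ps)) \<phi>)) \<longrightarrow>
        (\<exists>a\<in>univ M. \<forall>\<phi>\<in>\<Gamma>. sat M (nth (a # ps)) \<phi>))"


section \<open>Definable sets and maps\<close>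

text \<open>Tuples are lists, and \<open>X \<times> Y\<close> is formed by concatenation.\<close>

definition pow :: "'m set \<Rightarrow> nat \<Rightarrow> 'm list set" where
  "pow A n = {as. length as = n \<and> set as \<subseteq> A}"

definition tprod :: "'m list set \<Rightarrow> 'm list set \<Rightarrow> 'm list set" where
  "tprod X Y = {x @ y | x y. x \<in> X \<and> y \<in> Y}"

definition solset ::
  "('f, 'r, 'm) fo_struct \<Rightarrow> nat \<Rightarrow> ('f, 'r) fm \<Rightarrow> 'm list \<Rightarrow> 'm list set" where
  "solset M m \<phi> ps = {x \<in> pow (univ M) m. sat M (nth (x @ ps)) \<phi>}"

definition definable ::
  "('f, 'r) lang \<Rightarrow> ('f, 'r, 'm) fo_struct \<Rightarrow> nat \<Rightarrow> 'm list set \<Rightarrow> bool" where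
  "definable L M m X \<longleftrightarrow>
     (\<exists>\<phi> ps. set ps \<subseteq> univ M \<and> \<phi> \<in> forms L (m + length ps) \<and> X = solset M m \<phi> ps)"

definition definable0 ::
  "('f, 'r) lang \<Rightarrow> ('f, 'r, 'm) fo_struct \<Rightarrow> nat \<Rightarrow> 'm list set \<Rightarrow> bool" where
  "definable0 L M m X \<longleftrightarrow> (\<exists>\<phi> \<in> forms L m. X = solset M m \<phi> [])"

text \<open>An object of \<open>Def(M)\<close> is a pair \<open>(m, X)\<close> with \<open>X \<subseteq> M\<^sup>m\<close> definable, so that the empty
  subsets of different powers of \<open>M\<close> are different objects. A full subcategory is given by its
  set of objects.\<close>

type_synonym 'm obj = "nat \<times> 'm list set"

definition Def_objs :: "('f, 'r) lang \<Rightarrow> ('f, 'r, 'm) fo_struct \<Rightarrow> 'm obj set" where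
  "Def_objs L M = {(m, X). definable L M m X}"

definition definable_map ::
  "('f, 'r) lang \<Rightarrow> ('f, 'r, 'm) fo_struct \<Rightarrow> 'm obj \<Rightarrow> 'm obj \<Rightarrow> ('m list \<Rightarrow> 'm list) \<Rightarrow> bool" where
  "definable_map L M X Y f \<longleftrightarrow>
     f ` snd X \<subseteq> snd Y \<and> definable L M (fst X + fst Y) {x @ f x | x. x \<in> snd X}"

definition fiber :: "'m list set \<Rightarrow> ('m list \<Rightarrow> 'm list) \<Rightarrow> 'm list \<Rightarrow> 'm list set" where
  "fiber X f y = {x \<in> X. f x = y}"

definition Def_sub :: "('f, 'r) lang \<Rightarrow> ('f, 'r, 'm) fo_struct \<Rightarrow> 'm set \<Rightarrow> 'm obj set" where
  "Def_sub L M C = {(n, X). definable L M n X \<and> X \<subseteq> pow C n}"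

definition stably_embedded :: "('f, 'r) lang \<Rightarrow> ('f, 'r, 'm) fo_struct \<Rightarrow> 'm set \<Rightarrow> bool" where
  "stably_embedded L M C \<longleftrightarrow>
     (\<forall>m n S. definable0 L M (m + n) S \<longrightarrow>
        (\<exists>k T. definable0 L M (k + n) T \<and>
           (\<forall>p\<in>pow (univ M) m. \<exists>c\<in>pow C k.
              {q. p @ q \<in> S} \<inter> pow C n = {q. c @ q \<in> T} \<inter> pow C n)))"


section \<open>Fubini measures\<close>

definition admissible :: "('f, 'r) lang \<Rightarrow> ('f, 'r, 'm) fo_struct \<Rightarrow> 'm obj set \<Rightarrow> bool" where
  "admissible L M Ob \<longleftrightarrow>
     Ob \<subseteq> Def_objs L M \<and>
     (\<forall>m X Y. (m, X) \<in> Ob \<and> (m, Y) \<in> Ob \<longrightarrow> (m, X \<union> Y) \<in> Ob) \<and>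
     (\<forall>m X Y. (m, X) \<in> Ob \<and> Y \<subseteq> X \<and> definable L M m Y \<longrightarrow> (m, Y) \<in> Ob) \<and>
     (\<forall>m n X Y. (m, X) \<in> Ob \<and> (n, Y) \<in> Ob \<longrightarrow> (m + n, tprod X Y) \<in> Ob)"

text \<open>The sort \<open>{comm_semiring_0, comm_monoid_mult}\<close> is that of commutative semirings
  in which \<open>0 = 1\<close> is allowed, unlike in \<open>comm_semiring_1\<close>.\<close>

definition fubini_measure ::
  "('f, 'r) lang \<Rightarrow> ('f, 'r, 'm) fo_struct \<Rightarrow> 'm obj set \<Rightarrow>
   ('m obj \<Rightarrow> 'a::{comm_semiring_0, comm_monoid_mult}) \<Rightarrow> bool" where
  "fubini_measure L M Ob \<mu> \<longleftrightarrow>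
     admissible L M Ob \<and>
     (\<forall>m. (m, {}) \<in> Ob \<longrightarrow> \<mu> (m, {}) = 0) \<and>
     (\<forall>m x. (m, {x}) \<in> Ob \<longrightarrow> \<mu> (m, {x}) = 1) \<and>
     (\<forall>m X Y. (m, X) \<in> Ob \<and> (m, Y) \<in> Ob \<and> X \<inter> Y = {} \<longrightarrow>
        \<mu> (m, X \<union> Y) = \<mu> (m, X) + \<mu> (m, Y)) \<and>
     (\<forall>m X n Y f. (m, X) \<in> Ob \<and> (n, Y) \<in> Ob \<and> definable_map L M (m, X) (n, Y) f \<longrightarrow>
        finite {\<mu> (m, fiber X f y) | y. y \<in> Y} \<and>
        (\<forall>a. definable L M n {y \<in> Y. \<mu> (m, fiber X f y) = a}) \<and>
        (\<forall>a. (\<forall>y\<in>Y. \<mu> (m, fiber X f y) = a) \<longrightarrow> \<mu> (m, X) = a * \<mu> (n, Y)))"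


section \<open>Fiberability\<close>

text \<open>\<open>fib_sat L N D r m X\<close> is the recursive notion, to be used for an \<open>\<omega>\<close>-saturated \<open>N\<close>.\<close>

fun fib_sat ::
  "('f, 'r) lang \<Rightarrow> ('f, 'r, 'n) fo_struct \<Rightarrow> 'n set \<Rightarrow> nat \<Rightarrow> nat \<Rightarrow> 'n list set \<Rightarrow> bool" where
  "fib_sat L N D 0 m X \<longleftrightarrow> definable L N m X \<and>
     (\<exists>n f. definable_map L N (m, X) (n, pow (univ N) n) f \<and> inj_on f X \<and> f ` X \<subseteq> pow D n)"
| "fib_sat L N D (Suc r) m X \<longleftrightarrow> definable L N m X \<and>
     (\<exists>n f. definable_map L N (m, X) (n, pow (univ N) n) f \<and>
        fib_sat L N D r n (f ` X) \<and> (\<forall>y\<in>pow (univ N) n. fib_sat L N D r m (fiber X f y)))"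

text \<open>\<open>transfer L M N h m X X'\<close>: for an elementary embedding \<open>h\<close> of \<open>M\<close> into \<open>N\<close>, the set
  \<open>X' \<subseteq> N\<^sup>m\<close> is defined in \<open>N\<close> by a formula with parameters that defines \<open>X\<close> in \<open>M\<close>,
  i.e. \<open>X' = X\<^sup>*\<close>.\<close>

definition transfer ::
  "('f, 'r) lang \<Rightarrow> ('f, 'r, 'm) fo_struct \<Rightarrow> ('f, 'r, 'n) fo_struct \<Rightarrow> ('m \<Rightarrow> 'n) \<Rightarrow>
   nat \<Rightarrow> 'm list set \<Rightarrow> 'n list set \<Rightarrow> bool" where
  "transfer L M N h m X X' \<longleftrightarrow>
     (\<exists>\<phi> ps. set ps \<subseteq> univ M \<and> \<phi> \<in> forms L (m + length ps) \<and>
        X = solset M m \<phi> ps \<and> X' = solset N m \<phi> (map h ps))"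

text \<open>HOL cannot quantify over types inside a definition, so the \<open>\<omega>\<close>-saturated elementary
  extension is sought among the structures over one fixed type. This type has cardinality
  \<open>2 ^ max(|'m|, |forms|)\<close>, and \<open>M\<close> has an \<open>\<omega>\<close>-saturated elementary extension of cardinality at
  most \<open>max(|M|, 2 ^ (|L| + \<aleph>\<^sub>0))\<close>, so the type is large enough; the choice of the
  extension does not matter.\<close>

type_synonym ('f, 'r, 'm) ext = "('m \<times> ('f, 'r) fm) set"

definition r_fiberable ::
  "('f, 'r) lang \<Rightarrow> ('f, 'r, 'm) fo_struct \<Rightarrow> 'm set \<Rightarrow> nat \<Rightarrow> nat \<Rightarrow> 'm list set \<Rightarrow> bool" where
  "r_fiberable L M C r m X \<longleftrightarrow>
     (\<exists>(N :: ('f, 'r, ('f, 'r, 'm) ext) fo_struct) h X' C'.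
        is_struct L N \<and> omega_saturated L N \<and> elem_emb L M N h \<and>
        transfer L M N h m X X' \<and> transfer L M N h 1 (pow C 1) (pow C' 1) \<and>
        fib_sat L N C' r m X')"

definition fiberable ::
  "('f, 'r) lang \<Rightarrow> ('f, 'r, 'm) fo_struct \<Rightarrow> 'm set \<Rightarrow> nat \<Rightarrow> 'm list set \<Rightarrow> bool" where
  "fiberable L M C m X \<longleftrightarrow> (\<exists>r. r_fiberable L M C r m X)"

definition Def_fib :: "('f, 'r) lang \<Rightarrow> ('f, 'r, 'm) fo_struct \<Rightarrow> 'm set \<Rightarrow> 'm obj set" where
  "Def_fib L M C = {(m, X). definable L M m X \<and> fiberable L M C m X}"

end

theory Submission
  imports Defs
begin

text \<open>A set in \<open>Def(C)\<^sup>f\<close> is fibered, in finitely many steps, over sets that embed into powers of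
  \<open>C\<close>, so its measure has to be the integral of the measures of the fibers of a fibration. The
  value is independent of the fibration, since two fibrations \<open>X \<rightarrow> Y\<close> and \<open>X \<rightarrow> Z\<close> yield the two
  iterated integrals of one function on \<open>Y \<times> Z\<close>. Integration requires that the measures of the
  members of a definable family take finitely many values, each on a definable set of parameters.
  For subsets of powers of \<open>C\<close> this holds because stable embeddedness parametrizes a definable family
  by a power of \<open>C\<close>. In general, compactness in an \<open>\<omega>\<close>-saturated extension \<open>N\<close> shows that a
  definable family all of whose members over \<open>N\<close> are fiberable in \<open>r\<close> steps is fibered uniformly,
  up to a finite case distinction, and one inducts on \<open>r\<close>. A back-and-forth argument makes
  fiberability independent of \<open>N\<close>, and the union of a chain of \<open>\<omega>\<close> ultrapowers of \<open>M\<close>, each by an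
  ultrafilter on the lists of formulas that contains the cone above every formula, is an
  \<open>\<omega>\<close>-saturated extension of bounded cardinality.\<close>

section \<open>Formulas and definable predicates\<close>

text \<open>A semiring has neither subtraction nor cancellation, so values are compared only by
  cutting sets into finitely many pieces and applying (F3) to each. Integrals are therefore finite
  sums over level sets, and (F1) and (F2) for measures of fibers must be carried through every
  extension step. This is why membership in the category is a property of families and not of single
  sets. Compactness acts in \<open>N\<close>, so all members over \<open>N\<close> must be
  fiberable, not just those over \<open>M\<close>. The parameters of a fibration of one member
  cannot be chosen definably in the index of that member. They are kept as auxiliary parameters;
  since the resulting value is the same for all admissible choices, an existential quantifier
  replaces the choice. The parameters from \<open>C\<close> that stable embeddedness supplies are
  treated in the same way. Statements move between \<open>M\<close> and \<open>N\<close> as pairs of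
  predicates defined by one formula. The two distinct points of \<open>C\<close> serve to code a
  union of two pieces.\<close>

lemma pow_append: "x \<in> pow A m \<Longrightarrow> y \<in> pow A n \<Longrightarrow> x @ y \<in> pow A (m + n)"
  by (auto simp: pow_def)

lemma pow_take: "z \<in> pow A (m + n) \<Longrightarrow> take m z \<in> pow A m"
  by (auto simp: pow_def dest: in_set_takeD)

lemma pow_drop: "z \<in> pow A (m + n) \<Longrightarrow> drop m z \<in> pow A n"
  by (auto simp: pow_def dest: in_set_dropD)

lemma pow_0 [simp]: "pow A 0 = {[]}"
  by (auto simp: pow_def)

lemma pow_length: "z \<in> pow A n \<Longrightarrow> length z = n"
  by (simp add: pow_def)

lemma pow_mono: "A \<subseteq> B \<Longrightarrow> pow A n \<subseteq> pow B n"
  by (auto simp: pow_def)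

lemma pow_map: "z \<in> pow A n \<Longrightarrow> f ` A \<subseteq> B \<Longrightarrow> map f z \<in> pow B n"
  by (auto simp: pow_def)

lemma pow_splitE:
  assumes "z \<in> pow A (m + n)"
  obtains x y where "x \<in> pow A m" "y \<in> pow A n" "z = x @ y"
  using pow_take[OF assms] pow_drop[OF assms] by (metis append_take_drop_id)

section \<open>Renaming of variables and blocks of quantifiers\<close>

lemma eval_cong: "(\<And>i. i \<in> fv_trm t \<Longrightarrow> v i = w i) \<Longrightarrow> eval M v t = eval M w t"
proof (induction t)
  case (Fn f ts)
  then have "map (eval M v) ts = map (eval M w) ts" by auto
  then show ?case by (simp only: eval.simps)
qed auto

lemma sat_cong: "(\<And>i. i \<in> fv \<phi> \<Longrightarrow> v i = w i) \<Longrightarrow> sat M v \<phi> = sat M w \<phi>"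
proof (induction \<phi> arbitrary: v w)
  case (Eq s t)
  then show ?case using eval_cong[of s v w M] eval_cong[of t v w M] by auto
next
  case (Rel r ts)
  then have "map (eval M v) ts = map (eval M w) ts" by (auto intro!: eval_cong)
  then show ?case by (simp only: sat.simps)
next
  case (Neg \<phi>)
  then show ?case by (metis fv.simps(3) sat.simps(3))
next
  case (Conj \<phi> \<psi>)
  then show ?case by (metis Un_iff fv.simps(4) sat.simps(4))
next
  case (Ex i \<phi>)
  have "sat M (v(i := a)) \<phi> = sat M (w(i := a)) \<phi>" for a
    using Ex.prems by (intro Ex.IH) auto
  then show ?case by simp
qed

fun ren_trm :: "(nat \<Rightarrow> nat) \<Rightarrow> 'f trm \<Rightarrow> 'f trm" where
  "ren_trm \<sigma> (Var i) = Var (\<sigma> i)"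
| "ren_trm \<sigma> (Fn f ts) = Fn f (map (ren_trm \<sigma>) ts)"

text \<open>The bound variable moves to an index above the images of all free variables, which
  avoids capture for arbitrary \<open>\<sigma>\<close>; \<open>insert 0\<close> keeps the maximum
  defined for sentences.\<close>

fun ren :: "(nat \<Rightarrow> nat) \<Rightarrow> ('f, 'r) fm \<Rightarrow> ('f, 'r) fm" where
  "ren \<sigma> (Eq s t) = Eq (ren_trm \<sigma> s) (ren_trm \<sigma> t)"
| "ren \<sigma> (Rel r ts) = Rel r (map (ren_trm \<sigma>) ts)"
| "ren \<sigma> (Neg \<phi>) = Neg (ren \<sigma> \<phi>)"
| "ren \<sigma> (Conj \<phi> \<psi>) = Conj (ren \<sigma> \<phi>) (ren \<sigma> \<psi>)"
| "ren \<sigma> (Ex i \<phi>) = (let j = Suc (Max (insert 0 (\<sigma> ` (fv \<phi> - {i})))) in Ex j (ren (\<sigma>(i := j)) \<phi>))"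

lemma finite_fv_trm [simp]: "finite (fv_trm t)"
  by (induction t) auto

lemma finite_fv [simp]: "finite (fv \<phi>)"
  by (induction \<phi>) auto

lemma fv_ren_trm [simp]: "fv_trm (ren_trm \<sigma> t) = \<sigma> ` fv_trm t"
  by (induction t) auto

lemma wf_ren_trm [simp]: "wf_trm L (ren_trm \<sigma> t) = wf_trm L t"
  by (induction t) auto

lemma eval_ren_trm [simp]: "eval M v (ren_trm \<sigma> t) = eval M (\<lambda>k. v (\<sigma> k)) t"
proof (induction t)
  case (Fn f ts)
  then have "map (eval M v) (map (ren_trm \<sigma>) ts) = map (eval M (\<lambda>k. v (\<sigma> k))) ts" by auto
  then show ?case by (simp only: ren_trm.simps eval.simps)
qed auto

lemma wf_ren [simp]: "wf_fm L (ren \<sigma> \<phi>) = wf_fm L \<phi>"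
  by (induction \<phi> arbitrary: \<sigma>) (auto simp: Let_def)

lemma fresh_var: "finite S \<Longrightarrow> Suc (Max (insert 0 S)) \<notin> S" for S :: "nat set"
  by (metis Max_ge finite.insertI insertI2 not_less_eq_eq order_refl)

lemma image_upd_fresh: "j \<notin> \<sigma> ` (S - {i}) \<Longrightarrow> (\<sigma>(i := j)) ` S - {j} = \<sigma> ` (S - {i})"
  by (auto simp: image_iff split: if_splits)

lemma fv_ren [simp]: "fv (ren \<sigma> \<phi>) = \<sigma> ` fv \<phi>"
proof (induction \<phi> arbitrary: \<sigma>)
  case (Ex i \<phi>)
  let ?j = "Suc (Max (insert 0 (\<sigma> ` (fv \<phi> - {i}))))"
  have "?j \<notin> \<sigma> ` (fv \<phi> - {i})" by (rule fresh_var) simp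
  then have "(\<sigma>(i := ?j)) ` fv \<phi> - {?j} = \<sigma> ` (fv \<phi> - {i})"
    by (rule image_upd_fresh)
  then show ?case using Ex by (simp add: Let_def)
qed auto

lemma sat_ren: "sat M v (ren \<sigma> \<phi>) = sat M (\<lambda>k. v (\<sigma> k)) \<phi>"
proof (induction \<phi> arbitrary: \<sigma> v)
  case (Rel r ts)
  have "map (eval M v) (map (ren_trm \<sigma>) ts) = map (eval M (\<lambda>k. v (\<sigma> k))) ts" by auto
  then show ?case by (simp only: ren.simps sat.simps)
next
  case (Ex i \<phi>)
  let ?j = "Suc (Max (insert 0 (\<sigma> ` (fv \<phi> - {i}))))"
  have *: "?j \<notin> \<sigma> ` (fv \<phi> - {i})" by (rule fresh_var) simp
  have "sat M (\<lambda>k. (v(?j := a)) ((\<sigma>(i := ?j)) k)) \<phi> = sat M ((\<lambda>k. v (\<sigma> k))(i := a)) \<phi>" for a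
  proof (rule sat_cong)
    fix k assume "k \<in> fv \<phi>"
    then have "k \<noteq> i \<Longrightarrow> \<sigma> k \<noteq> ?j" using * by (metis DiffI imageI singletonD)
    then show "(v(?j := a)) ((\<sigma>(i := ?j)) k) = ((\<lambda>k. v (\<sigma> k))(i := a)) k"
      by (cases "k = i") auto
  qed
  then show ?case by (simp only: ren.simps Let_def sat.simps Ex)
qed auto

fun exs :: "nat \<Rightarrow> nat \<Rightarrow> ('f, 'r) fm \<Rightarrow> ('f, 'r) fm" where
  "exs a 0 \<phi> = \<phi>"
| "exs a (Suc m) \<phi> = Ex a (exs (Suc a) m \<phi>)"

lemma wf_exs [simp]: "wf_fm L (exs a m \<phi>) = wf_fm L \<phi>"
  by (induction m arbitrary: a) auto

lemma fv_exs [simp]: "fv (exs a m \<phi>) = fv \<phi> - {a..<a + m}"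
  by (induction m arbitrary: a) auto

lemma pow_Suc: "pow A (Suc n) = {x # xs | x xs. x \<in> A \<and> xs \<in> pow A n}"
  by (auto simp: pow_def length_Suc_conv)

lemma sat_exs:
  "sat M v (exs a m \<phi>) \<longleftrightarrow>
     (\<exists>x\<in>pow (univ M) m. sat M (\<lambda>i. if a \<le> i \<and> i < a + m then x ! (i - a) else v i) \<phi>)"
proof (induction m arbitrary: a v)
  case 0
  have "(\<lambda>i. if a \<le> i \<and> i < a + 0 then x ! (i - a) else v i) = v" for x :: "'c list"
    by (rule ext) auto
  then show ?case by (simp only: pow_0) simp
next
  case (Suc m)
  have eq: "(\<lambda>i. if Suc a \<le> i \<and> i < Suc a + m then xs ! (i - Suc a) else (v(a := x)) i) =
      (\<lambda>i. if a \<le> i \<and> i < a + Suc m then (x # xs) ! (i - a) else v i)" for x xs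
  proof
    fix i
    consider "i < a" | "i = a" | k where "i = Suc a + k"
      by (metis Suc_leI le_iff_add linorder_neqE_nat)
    then show "(if Suc a \<le> i \<and> i < Suc a + m then xs ! (i - Suc a) else (v(a := x)) i) =
      (if a \<le> i \<and> i < a + Suc m then (x # xs) ! (i - a) else v i)"
      by cases auto
  qed
  have "(\<exists>x\<in>pow (univ M) (Suc m). P x) \<longleftrightarrow> (\<exists>a\<in>univ M. \<exists>x\<in>pow (univ M) m. P (a # x))" for P
    unfolding pow_Suc by blast
  then show ?case by (simp only: exs.simps sat.simps Suc eq)
qed

subsection \<open>Pairs of predicates defined by the same formula\<close>

text \<open>The parameters come from \<open>B\<close>. Taking \<open>N = M\<close> and \<open>B = univ M\<close> gives definability in
  \<open>M\<close>, while \<open>B = {}\<close> gives 0-definability, simultaneously in \<open>M\<close> and \<open>N\<close>.\<close>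

definition tr :: "('f, 'r) lang \<Rightarrow> ('f, 'r, 'm) fo_struct \<Rightarrow> ('f, 'r, 'n) fo_struct \<Rightarrow> ('m \<Rightarrow> 'n) \<Rightarrow>
    'm set \<Rightarrow> nat \<Rightarrow> ('m list \<Rightarrow> bool) \<Rightarrow> ('n list \<Rightarrow> bool) \<Rightarrow> bool" where
  "tr L M N h B n P P' \<longleftrightarrow> (\<exists>\<phi> ps. set ps \<subseteq> B \<and> \<phi> \<in> forms L (n + length ps) \<and>
     (\<forall>z\<in>pow (univ M) n. P z \<longleftrightarrow> sat M (nth (z @ ps)) \<phi>) \<and>
     (\<forall>z\<in>pow (univ N) n. P' z \<longleftrightarrow> sat N (nth (z @ map h ps)) \<phi>))"

text \<open>Tuples whose entries are coordinates of \<open>z\<close> or parameters. The class is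
  closed under splitting, joining and composition, so definability of a compound statement can be
  proved by resolution along its structure.\<close>

definition sel :: "('m \<Rightarrow> 'n) \<Rightarrow> 'm set \<Rightarrow> nat \<Rightarrow> nat \<Rightarrow> ('m list \<Rightarrow> 'm list) \<Rightarrow> ('n list \<Rightarrow> 'n list) \<Rightarrow> bool" where
  "sel h B n k t t' \<longleftrightarrow> (\<exists>\<sigma> ps. length \<sigma> = k \<and> set ps \<subseteq> B \<and> set \<sigma> \<subseteq> {..<n + length ps} \<and>
     (\<forall>z. length z = n \<longrightarrow> t z = map (nth (z @ ps)) \<sigma>) \<and>
     (\<forall>z. length z = n \<longrightarrow> t' z = map (nth (z @ map h ps)) \<sigma>))"

lemma tr_cong:
  assumes "tr L M N h B n P P'" "\<And>z. z \<in> pow (univ M) n \<Longrightarrow> P z = Q z"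
    "\<And>z. z \<in> pow (univ N) n \<Longrightarrow> P' z = Q' z"
  shows "tr L M N h B n Q Q'"
  using assms unfolding tr_def by metis

lemma tr_mono: "tr L M N h B n P P' \<Longrightarrow> B \<subseteq> B' \<Longrightarrow> tr L M N h B' n P P'"
  unfolding tr_def by (meson subset_trans)

lemma tr_neg: "tr L M N h B n P P' \<Longrightarrow> tr L M N h B n (\<lambda>z. \<not> P z) (\<lambda>z. \<not> P' z)"
proof -
  assume "tr L M N h B n P P'"
  then obtain \<phi> ps where "set ps \<subseteq> B" "\<phi> \<in> forms L (n + length ps)"
     "\<forall>z\<in>pow (univ M) n. P z \<longleftrightarrow> sat M (nth (z @ ps)) \<phi>"
     "\<forall>z\<in>pow (univ N) n. P' z \<longleftrightarrow> sat N (nth (z @ map h ps)) \<phi>"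
    unfolding tr_def by blast
  then show ?thesis unfolding tr_def
    by (intro exI[of _ "Neg \<phi>"] exI[of _ ps]) (auto simp: forms_def)
qed

lemma sat_nth_append:
  assumes "fv \<phi> \<subseteq> {..<length z}"
  shows "sat M (nth (z @ ps)) \<phi> = sat M (nth z) \<phi>"
  using assms by (intro sat_cong) (auto simp: nth_append)

text \<open>To conjoin two formulas, their parameter lists are put one behind the other; the second
  formula then has to read past the first list.\<close>

lemma sat_ren_skip:
  assumes "fv \<phi> \<subseteq> {..<length z + length ps'}"
  shows "sat M (nth (z @ ps @ ps')) (ren (\<lambda>i. if i < length z then i else i + length ps) \<phi>) =
     sat M (nth (z @ ps')) \<phi>"
  unfolding sat_ren using assms by (intro sat_cong) (auto simp: nth_append)

lemma tr_conj:
  assumes "tr L M N h B n P P'" "tr L M N h B n Q Q'"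
  shows "tr L M N h B n (\<lambda>z. P z \<and> Q z) (\<lambda>z. P' z \<and> Q' z)"
proof -
  obtain \<phi> ps where 1: "set ps \<subseteq> B" "\<phi> \<in> forms L (n + length ps)"
     "\<And>z. z\<in>pow (univ M) n \<Longrightarrow> P z \<longleftrightarrow> sat M (nth (z @ ps)) \<phi>"
     "\<And>z. z\<in>pow (univ N) n \<Longrightarrow> P' z \<longleftrightarrow> sat N (nth (z @ map h ps)) \<phi>"
    using assms(1) unfolding tr_def by blast
  obtain \<psi> qs where 2: "set qs \<subseteq> B" "\<psi> \<in> forms L (n + length qs)"
     "\<And>z. z\<in>pow (univ M) n \<Longrightarrow> Q z \<longleftrightarrow> sat M (nth (z @ qs)) \<psi>"
     "\<And>z. z\<in>pow (univ N) n \<Longrightarrow> Q' z \<longleftrightarrow> sat N (nth (z @ map h qs)) \<psi>"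
    using assms(2) unfolding tr_def by blast
  let ?\<chi> = "Conj \<phi> (ren (\<lambda>i. if i < n then i else i + length ps) \<psi>)"
  have fv: "fv \<phi> \<subseteq> {..<n + length ps}" "fv \<psi> \<subseteq> {..<n + length qs}" using 1 2 by (auto simp: forms_def)
  have A: "sat M (nth (z @ ps @ qs)) ?\<chi> \<longleftrightarrow> P z \<and> Q z" if "z \<in> pow (univ M) n" for z
    using sat_nth_append[of \<phi> "z @ ps" M qs] sat_ren_skip[of \<psi> z qs M ps] 1(3) 2(3) that fv
    by (simp add: pow_length)
  have B: "sat N (nth (z @ map h (ps @ qs))) ?\<chi> \<longleftrightarrow> P' z \<and> Q' z" if "z \<in> pow (univ N) n" for z
    using sat_nth_append[of \<phi> "z @ map h ps" N "map h qs"]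
      sat_ren_skip[of \<psi> z "map h qs" N "map h ps", unfolded length_map] 1(4) 2(4) that fv
    by (simp add: pow_length)
  have "?\<chi> \<in> forms L (n + length (ps @ qs))"
    using 1(2) 2(2) by (fastforce simp: forms_def)
  then show ?thesis unfolding tr_def
    using 1(1) 2(1) A B by (intro exI[of _ ?\<chi>] exI[of _ "ps @ qs"]) auto
qed

text \<open>The variables to be quantified sit between the free variables and the parameters. The
  renaming moves them to the end, where \<open>exs\<close> can bind them as one block.\<close>

definition ex_ren :: "nat \<Rightarrow> nat \<Rightarrow> nat \<Rightarrow> nat \<Rightarrow> nat" where
  "ex_ren n m l i = (if i < n then i else if i < n + m then i + l else i - m)"

lemma sat_exs_ren:
  assumes "length z = n" "length qs = l" "fv \<phi> \<subseteq> {..<n + m + l}"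
  shows "sat M (nth (z @ qs)) (exs (n + l) m (ren (ex_ren n m l) \<phi>)) \<longleftrightarrow>
     (\<exists>x\<in>pow (univ M) m. sat M (nth ((z @ x) @ qs)) \<phi>)"
  unfolding sat_exs sat_ren
proof (intro bex_cong refl sat_cong)
  fix x i assume "x \<in> pow (univ M) m" "i \<in> fv \<phi>"
  then have "length x = m" "i < n + m + l" using assms by (auto simp: pow_def)
  then show "(if n + l \<le> ex_ren n m l i \<and> ex_ren n m l i < n + l + m then x ! (ex_ren n m l i - (n + l))
      else (z @ qs) ! ex_ren n m l i) = ((z @ x) @ qs) ! i"
    using assms by (auto simp: ex_ren_def nth_append add.commute)
qed

text \<open>Resolution with this rule replaces \<open>z\<close> and \<open>x\<close> by the two
  halves of one tuple \<open>w\<close>. Nested quantifiers thus never lead to more than one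
  variable, and the halves are left to the \<open>sel\<close> rules.\<close>

lemma tr_ex:
  assumes "tr L M N h B (n + m) (\<lambda>w. P (take n w) (drop n w)) (\<lambda>w. P' (take n w) (drop n w))"
  shows "tr L M N h B n (\<lambda>z. \<exists>x\<in>pow (univ M) m. P z x) (\<lambda>z. \<exists>x\<in>pow (univ N) m. P' z x)"
proof -
  obtain \<phi> ps where 1: "set ps \<subseteq> B" "\<phi> \<in> forms L (n + m + length ps)"
     "\<And>z. z\<in>pow (univ M) (n + m) \<Longrightarrow> P (take n z) (drop n z) \<longleftrightarrow> sat M (nth (z @ ps)) \<phi>"
     "\<And>z. z\<in>pow (univ N) (n + m) \<Longrightarrow> P' (take n z) (drop n z) \<longleftrightarrow> sat N (nth (z @ map h ps)) \<phi>"
    using assms unfolding tr_def by blast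
  let ?\<psi> = "exs (n + length ps) m (ren (ex_ren n m (length ps)) \<phi>)"
  have fv: "fv \<phi> \<subseteq> {..<n + m + length ps}" using 1 by (simp add: forms_def)
  have "?\<psi> \<in> forms L (n + length ps)"
    using 1(2) fv by (fastforce simp: forms_def ex_ren_def)
  moreover have "(\<exists>x\<in>pow (univ M) m. P z x) \<longleftrightarrow> sat M (nth (z @ ps)) ?\<psi>" if "z \<in> pow (univ M) n" for z
    using 1(3)[OF pow_append[OF that]] sat_exs_ren[OF pow_length[OF that] refl fv] that
    by (auto simp: pow_length)
  moreover have "(\<exists>x\<in>pow (univ N) m. P' z x) \<longleftrightarrow> sat N (nth (z @ map h ps)) ?\<psi>" if "z \<in> pow (univ N) n" for z
    using 1(4)[OF pow_append[OF that]] sat_exs_ren[OF pow_length[OF that], of "map h ps", OF _ fv] that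
    by (auto simp: pow_length)
  ultimately show ?thesis using 1(1) unfolding tr_def by blast
qed

lemma tr_disj:
  assumes "tr L M N h B n P P'" "tr L M N h B n Q Q'"
  shows "tr L M N h B n (\<lambda>z. P z \<or> Q z) (\<lambda>z. P' z \<or> Q' z)"
  by (rule tr_cong[OF tr_neg[OF tr_conj[OF tr_neg[OF assms(1)] tr_neg[OF assms(2)]]]]) auto

lemma tr_imp:
  assumes "tr L M N h B n P P'" "tr L M N h B n Q Q'"
  shows "tr L M N h B n (\<lambda>z. P z \<longrightarrow> Q z) (\<lambda>z. P' z \<longrightarrow> Q' z)"
  by (rule tr_cong[OF tr_disj[OF tr_neg[OF assms(1)] assms(2)]]) auto

lemma tr_iff:
  assumes "tr L M N h B n P P'" "tr L M N h B n Q Q'"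
  shows "tr L M N h B n (\<lambda>z. P z \<longleftrightarrow> Q z) (\<lambda>z. P' z \<longleftrightarrow> Q' z)"
  by (rule tr_cong[OF tr_conj[OF tr_imp[OF assms] tr_imp[OF assms(2,1)]]]) auto

lemma tr_all:
  assumes "tr L M N h B (n + m) (\<lambda>w. P (take n w) (drop n w)) (\<lambda>w. P' (take n w) (drop n w))"
  shows "tr L M N h B n (\<lambda>z. \<forall>x\<in>pow (univ M) m. P z x) (\<lambda>z. \<forall>x\<in>pow (univ N) m. P' z x)"
  by (rule tr_cong[OF tr_neg[OF tr_ex[of L M N h B n m "\<lambda>z x. \<not> P z x" "\<lambda>z x. \<not> P' z x", OF tr_neg[OF assms]]]]) auto

lemma tr_True: "tr L M N h B n (\<lambda>z. True) (\<lambda>z. True)"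
  \<comment> \<open>A sentence is required: for \<open>n = 0\<close> and no parameters nothing may
    occur free, and the language may have no constants.\<close>
  unfolding tr_def
  by (intro exI[of _ "Neg (Ex 0 (Neg (Eq (Var 0) (Var 0))))"] exI[of _ "[]"]) (auto simp: forms_def)

lemma tr_const: "tr L M N h B n (\<lambda>z. c) (\<lambda>z. c)"
  by (cases c; rule tr_cong[OF tr_True] tr_cong[OF tr_neg[OF tr_True]]; simp)

lemma tr_eq1:
  assumes "sel h B n 1 s s'" "sel h B n 1 t t'"
  shows "tr L M N h B n (\<lambda>z. s z = t z) (\<lambda>z. s' z = t' z)"
proof -
  obtain \<sigma> ps where 1: "length \<sigma> = 1" "set ps \<subseteq> B" "set \<sigma> \<subseteq> {..<n + length ps}"
     "\<And>z. length z = n \<Longrightarrow> s z = map (nth (z @ ps)) \<sigma>"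
     "\<And>z. length z = n \<Longrightarrow> s' z = map (nth (z @ map h ps)) \<sigma>"
    using assms(1) unfolding sel_def by blast
  obtain \<tau> qs where 2: "length \<tau> = 1" "set qs \<subseteq> B" "set \<tau> \<subseteq> {..<n + length qs}"
     "\<And>z. length z = n \<Longrightarrow> t z = map (nth (z @ qs)) \<tau>"
     "\<And>z. length z = n \<Longrightarrow> t' z = map (nth (z @ map h qs)) \<tau>"
    using assms(2) unfolding sel_def by blast
  obtain a b where ab: "\<sigma> = [a]" "\<tau> = [b]" using 1(1) 2(1)
    by (metis One_nat_def length_0_conv length_Suc_conv)
  let ?\<phi> = "Eq (Var a) (Var (if b < n then b else b + length ps))"
  have "?\<phi> \<in> forms L (n + length (ps @ qs))" using 1(3) 2(3) ab by (auto simp: forms_def)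
  then show ?thesis unfolding tr_def using 1 2 ab
    by (intro exI[of _ ?\<phi>] exI[of _ "ps @ qs"]) (auto simp: pow_def nth_append)
qed

definition sub_ren :: "nat list \<Rightarrow> nat \<Rightarrow> nat \<Rightarrow> nat" where
  "sub_ren \<tau> l i = (if i < length \<tau> then \<tau> ! i else i - length \<tau> + l)"

lemma sat_sub_ren:
  assumes "length z = l" "set \<tau> \<subseteq> {..<l}" "fv \<phi> \<subseteq> {..<length \<tau> + length us}"
  shows "sat M (nth (z @ us)) (ren (sub_ren \<tau> l) \<phi>) \<longleftrightarrow> sat M (nth (map (nth z) \<tau> @ us)) \<phi>"
  unfolding sat_ren
proof (rule sat_cong)
  fix i assume "i \<in> fv \<phi>"
  then have "i < length \<tau> + length us" using assms by auto
  moreover have "i < length \<tau> \<Longrightarrow> \<tau> ! i < l" using assms(2) nth_mem by fastforce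
  ultimately show "(z @ us) ! sub_ren \<tau> l i = (map (nth z) \<tau> @ us) ! i"
    using assms(1) by (auto simp: sub_ren_def nth_append)
qed

lemma map_nth_in_pow: "set z \<subseteq> U \<Longrightarrow> set \<tau> \<subseteq> {..<length z} \<Longrightarrow> length \<tau> = k \<Longrightarrow> map (nth z) \<tau> \<in> pow U k"
  by (fastforce simp: pow_def)

lemma tr_sub:
  assumes "tr L M N h B k A A'" "sel h B n j t t'" "j = k" "B \<subseteq> univ M" "h ` B \<subseteq> univ N"
  shows "tr L M N h B n (\<lambda>z. A (t z)) (\<lambda>z. A' (t' z))"
proof -
  obtain \<phi> ps where 1: "set ps \<subseteq> B" "\<phi> \<in> forms L (k + length ps)"
     "\<And>z. z\<in>pow (univ M) k \<Longrightarrow> A z \<longleftrightarrow> sat M (nth (z @ ps)) \<phi>"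
     "\<And>z. z\<in>pow (univ N) k \<Longrightarrow> A' z \<longleftrightarrow> sat N (nth (z @ map h ps)) \<phi>"
    using assms(1) unfolding tr_def by blast
  obtain \<tau> qs where 2: "length \<tau> = k" "set qs \<subseteq> B" "set \<tau> \<subseteq> {..<n + length qs}"
     "\<And>z. length z = n \<Longrightarrow> t z = map (nth (z @ qs)) \<tau>"
     "\<And>z. length z = n \<Longrightarrow> t' z = map (nth (z @ map h qs)) \<tau>"
    using assms(2,3) unfolding sel_def by blast
  have fv: "fv \<phi> \<subseteq> {..<length \<tau> + length ps}" using 1 2(1) by (simp add: forms_def)
  have tin: "t z \<in> pow (univ M) k" if "z \<in> pow (univ M) n" for z
    using map_nth_in_pow[of "z @ qs" "univ M" \<tau> k] 2 that assms(4) by (auto simp: pow_def)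
  have tin': "t' z \<in> pow (univ N) k" if "z \<in> pow (univ N) n" for z
  proof -
    have "set (map h qs) \<subseteq> univ N" using 2(2) assms(5) by auto
    then show ?thesis using map_nth_in_pow[of "z @ map h qs" "univ N" \<tau> k] 2(1,3,5) that by (simp add: pow_def)
  qed
  let ?\<psi> = "ren (sub_ren \<tau> (n + length qs)) \<phi>"
  have "i < length \<tau> \<Longrightarrow> \<tau> ! i < n + length qs" for i using 2(3) nth_mem by fastforce
  then have "?\<psi> \<in> forms L (n + length (qs @ ps))"
    using 1(2) fv by (fastforce simp: forms_def sub_ren_def)
  moreover have "A (t z) \<longleftrightarrow> sat M (nth (z @ qs @ ps)) ?\<psi>" if "z \<in> pow (univ M) n" for z
    using sat_sub_ren[of "z @ qs" _ \<tau> \<phi> ps M] 1(3)[OF tin[OF that]] 2(3,4) that fv by (simp add: pow_length)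
  moreover have "A' (t' z) \<longleftrightarrow> sat N (nth (z @ map h (qs @ ps))) ?\<psi>" if "z \<in> pow (univ N) n" for z
    using sat_sub_ren[of "z @ map h qs" _ \<tau> \<phi> "map h ps" N] 1(4)[OF tin'[OF that]] 2(3,5) that fv
    by (simp add: pow_length)
  ultimately show ?thesis using 1(1) 2(2) unfolding tr_def
    by (intro exI[of _ ?\<psi>] exI[of _ "qs @ ps"]) auto
qed

section \<open>Calculus of coordinate selections\<close>

lemma sel_id: "sel h B n n (\<lambda>z. z) (\<lambda>z. z)"
  unfolding sel_def by (intro exI[of _ "[0..<n]"] exI[of _ "[]"]) (auto simp: map_nth)

lemma sel_const: "b \<in> pow B k \<Longrightarrow> b' = map h b \<Longrightarrow> sel h B n k (\<lambda>z. b) (\<lambda>z. b')"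
  unfolding sel_def by (intro exI[of _ "[n..<n+k]"] exI[of _ b])
    (auto simp: pow_def intro!: nth_equalityI)

text \<open>The length is the minimum of \<open>j\<close> and \<open>k\<close>, kept as a
  conditional that the simplifier decides from an inequality between lengths.\<close>

lemma sel_take: "sel h B n k t t' \<Longrightarrow> sel h B n (if j \<le> k then j else k) (\<lambda>z. take j (t z)) (\<lambda>z. take j (t' z))"
proof -
  assume "sel h B n k t t'"
  then obtain \<sigma> ps where 1: "length \<sigma> = k" "set ps \<subseteq> B" "set \<sigma> \<subseteq> {..<n + length ps}"
     "\<And>z. length z = n \<Longrightarrow> t z = map (nth (z @ ps)) \<sigma>"
     "\<And>z. length z = n \<Longrightarrow> t' z = map (nth (z @ map h ps)) \<sigma>"
    unfolding sel_def by blast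
  then show ?thesis unfolding sel_def
    by (intro exI[of _ "take j \<sigma>"] exI[of _ ps]) (auto simp: take_map min_def dest: in_set_takeD)
qed

lemma sel_drop: "sel h B n k t t' \<Longrightarrow> sel h B n (k - j) (\<lambda>z. drop j (t z)) (\<lambda>z. drop j (t' z))"
proof -
  assume "sel h B n k t t'"
  then obtain \<sigma> ps where 1: "length \<sigma> = k" "set ps \<subseteq> B" "set \<sigma> \<subseteq> {..<n + length ps}"
     "\<And>z. length z = n \<Longrightarrow> t z = map (nth (z @ ps)) \<sigma>"
     "\<And>z. length z = n \<Longrightarrow> t' z = map (nth (z @ map h ps)) \<sigma>"
    unfolding sel_def by blast
  then show ?thesis unfolding sel_def
    by (intro exI[of _ "drop j \<sigma>"] exI[of _ ps]) (auto simp: drop_map dest: in_set_dropD)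
qed

lemma map_nth_append_left: "set \<sigma> \<subseteq> {..<length z} \<Longrightarrow> map (nth (z @ qs)) \<sigma> = map (nth z) \<sigma>"
  by (auto simp: nth_append)

lemma map_nth_append_skip:
  "set \<tau> \<subseteq> {..<length z + length qs} \<Longrightarrow>
     map (nth (z @ ps @ qs)) (map (\<lambda>b. if b < length z then b else b + length ps) \<tau>) = map (nth (z @ qs)) \<tau>"
  by (auto simp: nth_append)

lemma sel_append:
  assumes "sel h B n j s s'" "sel h B n k t t'"
  shows "sel h B n (j + k) (\<lambda>z. s z @ t z) (\<lambda>z. s' z @ t' z)"
proof -
  obtain \<sigma> ps where 1: "length \<sigma> = j" "set ps \<subseteq> B" "set \<sigma> \<subseteq> {..<n + length ps}"
     "\<And>z. length z = n \<Longrightarrow> s z = map (nth (z @ ps)) \<sigma>"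
     "\<And>z. length z = n \<Longrightarrow> s' z = map (nth (z @ map h ps)) \<sigma>"
    using assms(1) unfolding sel_def by blast
  obtain \<tau> qs where 2: "length \<tau> = k" "set qs \<subseteq> B" "set \<tau> \<subseteq> {..<n + length qs}"
     "\<And>z. length z = n \<Longrightarrow> t z = map (nth (z @ qs)) \<tau>"
     "\<And>z. length z = n \<Longrightarrow> t' z = map (nth (z @ map h qs)) \<tau>"
    using assms(2) unfolding sel_def by blast
  let ?r = "\<sigma> @ map (\<lambda>b. if b < n then b else b + length ps) \<tau>"
  have "s z @ t z = map (nth (z @ ps @ qs)) ?r" if "length z = n" for z
    using map_nth_append_left[of \<sigma> "z @ ps" qs] map_nth_append_skip[of \<tau> z qs ps] 1(3,4) 2(3,4) that
    by (simp del: map_map)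
  moreover have "s' z @ t' z = map (nth (z @ map h (ps @ qs))) ?r" if "length z = n" for z
    using map_nth_append_left[of \<sigma> "z @ map h ps" "map h qs"]
      map_nth_append_skip[of \<tau> z "map h qs" "map h ps", unfolded length_map] 1(3,5) 2(3,5) that
    by (simp del: map_map)
  moreover have "set ?r \<subseteq> {..<n + length (ps @ qs)}" using 1(3) 2(3) by fastforce
  ultimately show ?thesis unfolding sel_def using 1(1,2) 2(1,2)
    by (intro exI[of _ ?r] exI[of _ "ps @ qs"]) simp
qed

lemma sel_length: "sel h B n k t t' \<Longrightarrow> length z = n \<Longrightarrow> length (t z) = k"
  unfolding sel_def by auto

lemma sel_length': "sel h B n k t t' \<Longrightarrow> length z = n \<Longrightarrow> length (t' z) = k"
  unfolding sel_def by auto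

lemma sel_in:
  assumes "sel h B n k t t'" "B \<subseteq> U" "z \<in> pow U n"
  shows "t z \<in> pow U k"
proof -
  obtain \<tau> qs where 2: "length \<tau> = k" "set qs \<subseteq> B" "set \<tau> \<subseteq> {..<n + length qs}"
     "\<And>z. length z = n \<Longrightarrow> t z = map (nth (z @ qs)) \<tau>"
    using assms(1) unfolding sel_def by blast
  show ?thesis using map_nth_in_pow[of "z @ qs" U \<tau> k] 2 assms by (auto simp: pow_def)
qed

lemma sel_in':
  assumes "sel h B n k t t'" "h ` B \<subseteq> U" "z \<in> pow U n"
  shows "t' z \<in> pow U k"
proof -
  obtain \<tau> qs where 2: "length \<tau> = k" "set qs \<subseteq> B" "set \<tau> \<subseteq> {..<n + length qs}"
     "\<And>z. length z = n \<Longrightarrow> t' z = map (nth (z @ map h qs)) \<tau>"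
    using assms(1) unfolding sel_def by blast
  have "set (map h qs) \<subseteq> U" using 2(2) assms(2) by auto
  then show ?thesis using map_nth_in_pow[of "z @ map h qs" U \<tau> k] 2(1,3,4) assms(3) by (simp add: pow_def)
qed

lemma tr_eq:
  assumes "sel h B n j s s'" "sel h B n k t t'" "j = k"
  shows "tr L M N h B n (\<lambda>z. s z = t z) (\<lambda>z. s' z = t' z)"
  using assms
proof (induction k arbitrary: j s s' t t')
  case 0
  have "s z = [] \<and> t z = []" if "z \<in> pow (univ M) n" for z
    using 0 that by (metis pow_length sel_length length_0_conv)
  moreover have "s' z = [] \<and> t' z = []" if "z \<in> pow (univ N) n" for z
    using 0 that by (metis pow_length sel_length' length_0_conv)
  ultimately show ?case by (intro tr_cong[OF tr_True]) simp_all
next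
  case (Suc k)
  have *: "(take 1 xs = take 1 ys \<and> drop 1 xs = drop 1 ys) = (xs = ys)" for xs ys :: "'x list"
    by (metis append_take_drop_id)
  have 1: "sel h B n 1 (\<lambda>z. take 1 (s z)) (\<lambda>z. take 1 (s' z))" "sel h B n 1 (\<lambda>z. take 1 (t z)) (\<lambda>z. take 1 (t' z))"
    using sel_take[OF Suc.prems(1), of 1] sel_take[OF Suc.prems(2), of 1] Suc.prems(3) by auto
  have 2: "sel h B n k (\<lambda>z. drop 1 (s z)) (\<lambda>z. drop 1 (s' z))" "sel h B n k (\<lambda>z. drop 1 (t z)) (\<lambda>z. drop 1 (t' z))"
    using sel_drop[OF Suc.prems(1), of 1] sel_drop[OF Suc.prems(2), of 1] Suc.prems(3) by auto
  show ?case
    by (rule tr_cong[OF tr_conj[OF tr_eq1[OF 1] Suc.IH[OF 2 refl]]]; rule *)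
qed

lemma tr_pow:
  assumes "tr L M N h B 1 (\<lambda>z. z \<in> pow C 1) (\<lambda>z. z \<in> pow C' 1)" "sel h B n k t t'" "j = k"
     "B \<subseteq> univ M" "h ` B \<subseteq> univ N"
  shows "tr L M N h B n (\<lambda>z. t z \<in> pow C j) (\<lambda>z. t' z \<in> pow C' j)"
  using assms(2,3)
proof (induction k arbitrary: j t t')
  case 0
  have "t z = []" if "z \<in> pow (univ M) n" for z
    using 0 that by (metis pow_length sel_length length_0_conv)
  moreover have "t' z = []" if "z \<in> pow (univ N) n" for z
    using 0 that by (metis pow_length sel_length' length_0_conv)
  ultimately show ?case using 0 by (intro tr_cong[OF tr_True]) simp_all
next
  case (Suc k)
  have *: "(take 1 xs \<in> pow E 1 \<and> drop 1 xs \<in> pow E k) = (xs \<in> pow E (Suc k))"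
    if "length xs = Suc k" for xs :: "'x list" and E
    using that by (cases xs) (auto simp: pow_def)
  have 1: "sel h B n 1 (\<lambda>z. take 1 (t z)) (\<lambda>z. take 1 (t' z))"
    using sel_take[OF Suc.prems(1), of 1] by auto
  have 2: "sel h B n k (\<lambda>z. drop 1 (t z)) (\<lambda>z. drop 1 (t' z))"
    using sel_drop[OF Suc.prems(1), of 1] by auto
  show ?case unfolding Suc.prems(2)
  proof (rule tr_cong[OF tr_conj[OF tr_sub[OF assms(1) 1 refl assms(4,5)] Suc.IH[OF 2 refl]]])
    fix z assume "z \<in> pow (univ M) n"
    then show "(take 1 (t z) \<in> pow C 1 \<and> drop 1 (t z) \<in> pow C k) = (t z \<in> pow C (Suc k))"
      by (intro * sel_length[OF Suc.prems(1)] pow_length)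
  next
    fix z assume "z \<in> pow (univ N) n"
    then show "(take 1 (t' z) \<in> pow C' 1 \<and> drop 1 (t' z) \<in> pow C' k) = (t' z \<in> pow C' (Suc k))"
      by (intro * sel_length'[OF Suc.prems(1)] pow_length)
  qed
qed

lemma tr_fam:
  assumes "tr L M N h B (k + m) (\<lambda>z. drop k z \<in> F (take k z)) (\<lambda>z. drop k z \<in> F' (take k z))"
    "sel h B n k' s s'" "sel h B n m' t t'" "k' = k" "m' = m" "B \<subseteq> univ M" "h ` B \<subseteq> univ N"
  shows "tr L M N h B n (\<lambda>z. t z \<in> F (s z)) (\<lambda>z. t' z \<in> F' (s' z))"
proof -
  have *: "tr L M N h B n (\<lambda>z. drop k (s z @ t z) \<in> F (take k (s z @ t z))) (\<lambda>z. drop k (s' z @ t' z) \<in> F' (take k (s' z @ t' z)))"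
    by (rule tr_sub[OF assms(1) sel_append[OF assms(2,3)]]) (use assms in auto)
  have "length (s z) = k" if "z \<in> pow (univ M) n" for z
    using that assms(2,4) by (metis pow_length sel_length)
  moreover have "length (s' z) = k" if "z \<in> pow (univ N) n" for z
    using that assms(2,4) by (metis pow_length sel_length')
  ultimately show ?thesis by (intro tr_cong[OF *]) simp_all
qed

lemma tr_fin_ex:
  assumes "finite I" "\<And>i. i \<in> I \<Longrightarrow> tr L M N h B n (P i) (P' i)"
  shows "tr L M N h B n (\<lambda>z. \<exists>i\<in>I. P i z) (\<lambda>z. \<exists>i\<in>I. P' i z)"
  using assms
proof (induction I rule: finite_induct)
  case empty
  then show ?case using tr_const[of L M N h B n False] by simp
next
  case (insert i I)
  have "tr L M N h B n (\<lambda>z. P i z \<or> (\<exists>i\<in>I. P i z)) (\<lambda>z. P' i z \<or> (\<exists>i\<in>I. P' i z))"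
    by (rule tr_disj) (use insert in auto)
  then show ?case by (rule tr_cong) auto
qed

lemmas tr_logic = tr_conj tr_disj tr_imp tr_iff tr_neg tr_ex tr_all
lemma sel_take_id: "sel h B n (if j \<le> n then j else n) (take j) (take j)"
  and sel_drop_id: "sel h B n (n - j) (drop j) (drop j)"
  by (rule sel_take[OF sel_id], rule sel_drop[OF sel_id])

lemmas sel_intros = sel_take sel_drop sel_append sel_id sel_take_id sel_drop_id

section \<open>Transfer along elementary embeddings\<close>

lemma tr_elementary:
  assumes "elem_emb L M N h" "B \<subseteq> univ M" "tr L M N h B n P P'" "z \<in> pow (univ M) n"
  shows "P z \<longleftrightarrow> P' (map h z)"
proof -
  obtain \<phi> ps where 1: "set ps \<subseteq> B" "\<phi> \<in> forms L (n + length ps)"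
     "\<And>z. z\<in>pow (univ M) n \<Longrightarrow> P z \<longleftrightarrow> sat M (nth (z @ ps)) \<phi>"
     "\<And>z. z\<in>pow (univ N) n \<Longrightarrow> P' z \<longleftrightarrow> sat N (nth (z @ map h ps)) \<phi>"
    using assms(3) unfolding tr_def by blast
  have "sat M (nth (z @ ps)) \<phi> \<longleftrightarrow> sat N (nth (map h (z @ ps))) \<phi>"
    using assms 1 unfolding elem_emb_def by (auto simp: pow_def)
  moreover have "map h z \<in> pow (univ N) n" using assms unfolding elem_emb_def by (metis pow_map)
  ultimately show ?thesis using 1 assms by simp
qed

lemma tr_right:
  assumes "tr L M N h B n P P'" "h ` B \<subseteq> univ N"
  shows "tr L N N id (univ N) n P' P'"
proof -
  obtain \<phi> ps where 1: "set ps \<subseteq> B" "\<phi> \<in> forms L (n + length ps)"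
     "\<And>z. z\<in>pow (univ N) n \<Longrightarrow> P' z \<longleftrightarrow> sat N (nth (z @ map h ps)) \<phi>"
    using assms(1) unfolding tr_def by blast
  then show ?thesis unfolding tr_def using assms(2) by (intro exI[of _ \<phi>] exI[of _ "map h ps"]) auto
qed

lemma tr_left:
  assumes "tr L M N h B n P P'"
  shows "tr L M M id B n P P"
proof -
  obtain \<phi> ps where 1: "set ps \<subseteq> B" "\<phi> \<in> forms L (n + length ps)"
     "\<And>z. z\<in>pow (univ M) n \<Longrightarrow> P z \<longleftrightarrow> sat M (nth (z @ ps)) \<phi>"
    using assms(1) unfolding tr_def by blast
  then show ?thesis unfolding tr_def by (intro exI[of _ \<phi>] exI[of _ ps]) auto
qed

text \<open>The origin of starred predicates: a formula that defines \<open>P\<close> over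
  \<open>M\<close> is read in \<open>N\<close>. By \<open>star_unique\<close> another formula gives
  the same result when the embedding is elementary.\<close>

lemma tr_extend:
  assumes "tr L M M id B n P P"
  obtains P' where "tr L M N h B n P P'"
proof -
  obtain \<phi> ps where 1: "set ps \<subseteq> B" "\<phi> \<in> forms L (n + length ps)"
     "\<And>z. z\<in>pow (univ M) n \<Longrightarrow> P z \<longleftrightarrow> sat M (nth (z @ ps)) \<phi>"
    using assms(1) unfolding tr_def by blast
  then show ?thesis using that[of "\<lambda>z. sat N (nth (z @ map h ps)) \<phi>"] unfolding tr_def by blast
qed

lemma tr_form: "\<rho> \<in> forms L n \<Longrightarrow> tr L M N h {} n (\<lambda>z. sat M (nth z) \<rho>) (\<lambda>z. sat N (nth z) \<rho>)"
  unfolding tr_def by (intro exI[of _ \<rho>] exI[of _ "[]"]) simp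

lemma tr_formE:
  assumes "tr L M N h {} n P P'"
  obtains \<rho> where "\<rho> \<in> forms L n" "\<And>z. z \<in> pow (univ M) n \<Longrightarrow> P z \<longleftrightarrow> sat M (nth z) \<rho>"
    "\<And>z. z \<in> pow (univ N) n \<Longrightarrow> P' z \<longleftrightarrow> sat N (nth z) \<rho>"
proof -
  obtain \<phi> ps where "set ps \<subseteq> {}" "\<phi> \<in> forms L (n + length ps)"
     "\<forall>z\<in>pow (univ M) n. P z \<longleftrightarrow> sat M (nth (z @ ps)) \<phi>"
     "\<forall>z\<in>pow (univ N) n. P' z \<longleftrightarrow> sat N (nth (z @ map h ps)) \<phi>"
    using assms unfolding tr_def by blast
  then show ?thesis using that[of \<phi>] by simp
qed

lemma tr_sub0:
  "\<rho> \<in> forms L k \<Longrightarrow> sel h {} n j t t' \<Longrightarrow> j = k \<Longrightarrow>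
     tr L M N h {} n (\<lambda>z. sat M (nth (t z)) \<rho>) (\<lambda>z. sat N (nth (t' z)) \<rho>)"
  by (rule tr_sub[OF tr_form]) (assumption | simp)+

lemma tr_paramE:
  assumes "tr L M N h B n P P'"
  obtains l ps \<rho> where "ps \<in> pow B l" "\<rho> \<in> forms L (n + l)"
    "\<And>z. z \<in> pow (univ M) n \<Longrightarrow> P z \<longleftrightarrow> sat M (nth (z @ ps)) \<rho>"
    "\<And>z. z \<in> pow (univ N) n \<Longrightarrow> P' z \<longleftrightarrow> sat N (nth (z @ map h ps)) \<rho>"
proof -
  obtain \<phi> ps where "set ps \<subseteq> B" "\<phi> \<in> forms L (n + length ps)"
     "\<forall>z\<in>pow (univ M) n. P z \<longleftrightarrow> sat M (nth (z @ ps)) \<phi>"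
     "\<forall>z\<in>pow (univ N) n. P' z \<longleftrightarrow> sat N (nth (z @ map h ps)) \<phi>"
    using assms unfolding tr_def by blast
  then show ?thesis using that[of ps "length ps" \<phi>] by (simp add: pow_def)
qed

lemma sel_comp:
  assumes "sel h B b a w w'" "sel h B n b t t'"
  shows "sel h B n a (\<lambda>z. w (t z)) (\<lambda>z. w' (t' z))"
proof -
  obtain \<sigma> ps where 1: "length \<sigma> = a" "set ps \<subseteq> B" "set \<sigma> \<subseteq> {..<b + length ps}"
     "\<And>z. length z = b \<Longrightarrow> w z = map (nth (z @ ps)) \<sigma>"
     "\<And>z. length z = b \<Longrightarrow> w' z = map (nth (z @ map h ps)) \<sigma>"
    using assms(1) unfolding sel_def by blast
  obtain \<tau> qs where 2: "length \<tau> = b" "set qs \<subseteq> B" "set \<tau> \<subseteq> {..<n + length qs}"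
     "\<And>z. length z = n \<Longrightarrow> t z = map (nth (z @ qs)) \<tau>"
     "\<And>z. length z = n \<Longrightarrow> t' z = map (nth (z @ map h qs)) \<tau>"
    using assms(2) unfolding sel_def by blast
  let ?r = "map (sub_ren \<tau> (n + length qs)) \<sigma>"
  have \<tau>: "i < b \<Longrightarrow> \<tau> ! i < n + length qs" for i using 2(1,3) nth_mem by fastforce
  have key: "map (nth (map (nth v) \<tau> @ us)) \<sigma> = map (nth (v @ us)) ?r"
    if "length v = n + length qs" "length us = length ps" for v us
    using that 1(3) 2(1) \<tau> by (auto simp: sub_ren_def nth_append)
  have "set ?r \<subseteq> {..<n + length (qs @ ps)}"
    using 1(3) 2(1) \<tau> by (fastforce simp: sub_ren_def)
  moreover have "w (t z) = map (nth (z @ qs @ ps)) ?r" if "length z = n" for z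
    using 1(4)[of "t z"] 2(1) 2(4)[OF that] key[of "z @ qs" ps] that by simp
  moreover have "w' (t' z) = map (nth (z @ map h (qs @ ps))) ?r" if "length z = n" for z
    using 1(5)[of "t' z"] 2(1) 2(5)[OF that] key[of "z @ map h qs" "map h ps"] that by simp
  ultimately show ?thesis unfolding sel_def using 1(1,2) 2(2)
    by (intro exI[of _ ?r] exI[of _ "qs @ ps"]) simp
qed

lemma sel_eq_length: "sel h B n j t t' \<Longrightarrow> j = k \<Longrightarrow> sel h B n k t t'"
  by simp

lemma tr_right0:
  assumes "tr L M N h {} n P P'"
  shows "tr L N N id {} n P' P'"
  using assms by (rule tr_formE) (auto simp: tr_def intro!: exI[of _ "[]"])

section \<open>Definable families, maps and simple functions\<close>

locale fo_structure =
  fixes L :: "('f, 'r) lang" and M :: "('f, 'r, 'm) fo_struct"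
  assumes struct: "is_struct L M"
begin

abbreviation U :: "'m set" where "U \<equiv> univ M"

definition D :: "nat \<Rightarrow> ('m list \<Rightarrow> bool) \<Rightarrow> bool" where
  "D n P \<longleftrightarrow> tr L M M id U n P P"

definition select :: "nat \<Rightarrow> nat \<Rightarrow> ('m list \<Rightarrow> 'm list) \<Rightarrow> bool" where
  "select n k t \<longleftrightarrow> sel id U n k t t"

definition dfam :: "nat \<Rightarrow> nat \<Rightarrow> ('m list \<Rightarrow> 'm list set) \<Rightarrow> bool" where
  "dfam k m F \<longleftrightarrow> (\<forall>p\<in>pow U k. F p \<subseteq> pow U m) \<and> D (k + m) (\<lambda>z. drop k z \<in> F (take k z))"

text \<open>Agrees with \<open>definable_map\<close> between definable sets, but gives the graph as
  a predicate on concatenated tuples, the form that the closure rules handle.\<close>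

definition dmap :: "nat \<Rightarrow> 'm list set \<Rightarrow> nat \<Rightarrow> 'm list set \<Rightarrow> ('m list \<Rightarrow> 'm list) \<Rightarrow> bool" where
  "dmap m X n Y f \<longleftrightarrow> definable L M m X \<and> definable L M n Y \<and> f ` X \<subseteq> Y \<and>
     D (m + n) (\<lambda>z. take m z \<in> X \<and> f (take m z) = drop m z)"

lemma univ_nonempty: "U \<noteq> {}"
  using struct by (simp add: is_struct_def)

lemma D_cong: "D n P \<Longrightarrow> (\<And>z. z \<in> pow U n \<Longrightarrow> P z = Q z) \<Longrightarrow> D n Q"
  unfolding D_def by (erule tr_cong)

lemma D_conj: "D n P \<Longrightarrow> D n Q \<Longrightarrow> D n (\<lambda>z. P z \<and> Q z)"
  unfolding D_def by (rule tr_conj)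
lemma D_disj: "D n P \<Longrightarrow> D n Q \<Longrightarrow> D n (\<lambda>z. P z \<or> Q z)"
  unfolding D_def by (rule tr_disj)
lemma D_imp: "D n P \<Longrightarrow> D n Q \<Longrightarrow> D n (\<lambda>z. P z \<longrightarrow> Q z)"
  unfolding D_def by (rule tr_imp)
lemma D_iff: "D n P \<Longrightarrow> D n Q \<Longrightarrow> D n (\<lambda>z. P z \<longleftrightarrow> Q z)"
  unfolding D_def by (rule tr_iff)
lemma D_neg: "D n P \<Longrightarrow> D n (\<lambda>z. \<not> P z)"
  unfolding D_def by (rule tr_neg)
lemma D_const: "D n (\<lambda>z. c)"
  unfolding D_def by (rule tr_const)
lemma D_ex: "D (n + m) (\<lambda>w. P (take n w) (drop n w)) \<Longrightarrow> D n (\<lambda>z. \<exists>x\<in>pow U m. P z x)"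
  unfolding D_def by (rule tr_ex)
lemma D_all: "D (n + m) (\<lambda>w. P (take n w) (drop n w)) \<Longrightarrow> D n (\<lambda>z. \<forall>x\<in>pow U m. P z x)"
  unfolding D_def by (rule tr_all)
lemma D_fin_ex: "finite I \<Longrightarrow> (\<And>i. i \<in> I \<Longrightarrow> D n (P i)) \<Longrightarrow> D n (\<lambda>z. \<exists>i\<in>I. P i z)"
  unfolding D_def by (rule tr_fin_ex)
lemma D_eq: "select n j s \<Longrightarrow> select n k t \<Longrightarrow> j = k \<Longrightarrow> D n (\<lambda>z. s z = t z)"
  unfolding D_def select_def by (rule tr_eq)
lemma D_pred: "D k A \<Longrightarrow> select n j t \<Longrightarrow> j = k \<Longrightarrow> D n (\<lambda>z. A (t z))"
  unfolding D_def select_def by (rule tr_sub) (assumption | simp)+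
lemma D_fam: "dfam k m F \<Longrightarrow> select n k' s \<Longrightarrow> select n m' t \<Longrightarrow> k' = k \<Longrightarrow> m' = m \<Longrightarrow> D n (\<lambda>z. t z \<in> F (s z))"
  unfolding D_def select_def dfam_def by (rule tr_fam[of _ _ _ _ _ k m]) (elim conjE, assumption | simp)+

lemma select_id: "select n n (\<lambda>z. z)"
  unfolding select_def by (rule sel_id)
lemma select_const: "b \<in> pow U k \<Longrightarrow> select n k (\<lambda>z. b)"
  unfolding select_def by (rule sel_const) simp_all
lemma select_take: "select n k t \<Longrightarrow> select n (if j \<le> k then j else k) (\<lambda>z. take j (t z))"
  unfolding select_def by (rule sel_take)
lemma select_drop: "select n k t \<Longrightarrow> select n (k - j) (\<lambda>z. drop j (t z))"
  unfolding select_def by (rule sel_drop)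
lemma select_append: "select n j s \<Longrightarrow> select n k t \<Longrightarrow> select n (j + k) (\<lambda>z. s z @ t z)"
  unfolding select_def by (rule sel_append)
lemma select_length: "select n k t \<Longrightarrow> length z = n \<Longrightarrow> length (t z) = k"
  unfolding select_def by (rule sel_length)
lemma select_in: "select n k t \<Longrightarrow> z \<in> pow U n \<Longrightarrow> t z \<in> pow U k"
  unfolding select_def by (rule sel_in) (assumption | simp)+

lemmas D_logic = D_conj D_disj D_imp D_iff D_neg D_ex D_all D_const
lemma select_take_id: "select n (if j \<le> n then j else n) (take j)"
  and select_drop_id: "select n (n - j) (drop j)"
  unfolding select_def by (rule sel_take_id, rule sel_drop_id)

lemmas select_intros = select_take select_drop select_append select_id select_take_id select_drop_id

section \<open>Definable sets, families and maps in one structure\<close>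

lemma definable_iff: "definable L M m X \<longleftrightarrow> X \<subseteq> pow U m \<and> D m (\<lambda>z. z \<in> X)"
proof
  assume "definable L M m X"
  then obtain \<phi> ps where "set ps \<subseteq> U" "\<phi> \<in> forms L (m + length ps)" "X = solset M m \<phi> ps"
    unfolding definable_def by blast
  then show "X \<subseteq> pow U m \<and> D m (\<lambda>z. z \<in> X)"
    unfolding D_def tr_def solset_def by (auto intro!: exI[of _ \<phi>] exI[of _ ps])
next
  assume A: "X \<subseteq> pow U m \<and> D m (\<lambda>z. z \<in> X)"
  then obtain \<phi> ps where "set ps \<subseteq> U" "\<phi> \<in> forms L (m + length ps)"
    "\<forall>z\<in>pow U m. z \<in> X \<longleftrightarrow> sat M (nth (z @ ps)) \<phi>"
    unfolding D_def tr_def by blast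
  then show "definable L M m X" using A
    unfolding definable_def solset_def by (intro exI[of _ \<phi>] exI[of _ ps]) auto
qed

lemma definable_sub: "definable L M m X \<Longrightarrow> X \<subseteq> pow U m"
  by (simp add: definable_iff)

lemma definable_in: "definable L M m X \<Longrightarrow> x \<in> X \<Longrightarrow> x \<in> pow U m"
  by (auto simp: definable_iff)

lemma definable_Collect: "D m P \<Longrightarrow> definable L M m {z \<in> pow U m. P z}"
  unfolding definable_iff by (auto elim: D_cong)

lemma D_set: "definable L M k X \<Longrightarrow> select n j t \<Longrightarrow> j = k \<Longrightarrow> D n (\<lambda>z. t z \<in> X)"
  by (rule D_pred[of k "\<lambda>z. z \<in> X"]) (auto simp: definable_iff)

lemma definable_subset_Collect:
  assumes "definable L M m X" "D m P"
  shows "definable L M m {z \<in> X. P z}"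
proof -
  have "{z \<in> X. P z} = {z \<in> pow U m. z \<in> X \<and> P z}" using definable_in[OF assms(1)] by auto
  moreover have "definable L M m {z \<in> pow U m. z \<in> X \<and> P z}"
    using assms by (intro definable_Collect D_conj) (simp_all add: definable_iff)
  ultimately show ?thesis by simp
qed

lemma definable_Un: "definable L M m X \<Longrightarrow> definable L M m Y \<Longrightarrow> definable L M m (X \<union> Y)"
  unfolding definable_iff using D_disj[of m "\<lambda>z. z \<in> X" "\<lambda>z. z \<in> Y"] by auto

lemma definable_Int: "definable L M m X \<Longrightarrow> definable L M m Y \<Longrightarrow> definable L M m (X \<inter> Y)"
  unfolding definable_iff using D_conj[of m "\<lambda>z. z \<in> X" "\<lambda>z. z \<in> Y"] by auto

lemma definable_empty: "definable L M m {}"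
  unfolding definable_iff using D_const[of m False] by auto

lemma definable_pow: "definable L M m (pow U m)"
  using definable_Collect[OF D_const[of m True]] by simp

lemma definable_single: "x \<in> pow U m \<Longrightarrow> definable L M m {x}"
  unfolding definable_iff using D_eq[OF select_id select_const, of x m m] by simp

lemma tprod_iff: "X \<subseteq> pow U m \<Longrightarrow> z \<in> tprod X Y \<longleftrightarrow> take m z \<in> X \<and> drop m z \<in> Y"
  by (auto simp: tprod_def pow_def) (metis append_take_drop_id)

lemma tprod_sub: "X \<subseteq> pow U m \<Longrightarrow> Y \<subseteq> pow U n \<Longrightarrow> tprod X Y \<subseteq> pow U (m + n)"
  by (auto simp: tprod_def intro!: pow_append)

lemma definable_tprod:
  assumes "definable L M m X" "definable L M n Y"
  shows "definable L M (m + n) (tprod X Y)"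
proof -
  have "D (m + n) (\<lambda>z. take m z \<in> X \<and> drop m z \<in> Y)"
    by (rule D_conj D_set[OF assms(1)] D_set[OF assms(2)] select_intros | simp)+
  then show ?thesis
    using tprod_sub definable_sub[OF assms(1)] definable_sub[OF assms(2)]
    by (simp add: definable_iff tprod_iff)
qed

lemma dfam_Collect: "D (k + m) (\<lambda>z. P (take k z) (drop k z)) \<Longrightarrow> dfam k m (\<lambda>p. {x \<in> pow U m. P p x})"
  unfolding dfam_def by (auto elim!: D_cong dest: pow_drop)

lemma dfam_cong: "dfam k m F \<Longrightarrow> (\<And>p. p \<in> pow U k \<Longrightarrow> F p = G p) \<Longrightarrow> dfam k m G"
  unfolding dfam_def by (auto elim!: D_cong dest: pow_take)

lemma dfam_const: "definable L M m X \<Longrightarrow> dfam k m (\<lambda>_. X)"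
  unfolding dfam_def using definable_sub by (auto intro!: D_set select_intros)

lemma dfam_in: "dfam k m F \<Longrightarrow> p \<in> pow U k \<Longrightarrow> x \<in> F p \<Longrightarrow> x \<in> pow U m"
  unfolding dfam_def by auto

lemma dfam_inst: "dfam k m F \<Longrightarrow> p \<in> pow U k \<Longrightarrow> definable L M m (F p)"
  unfolding definable_iff using dfam_in
  by (auto intro!: D_fam[of k m F] select_const select_intros)

lemma D_map:
  assumes "dmap m X n Y f" "select l m' s" "select l n' t" "m' = m" "n' = n"
  shows "D l (\<lambda>z. s z \<in> X \<and> f (s z) = t z)"
proof -
  have 1: "D l (\<lambda>z. take m (s z @ t z) \<in> X \<and> f (take m (s z @ t z)) = drop m (s z @ t z))"
    by (rule D_pred[OF _ select_append[OF assms(2,3)]]) (use assms in \<open>auto simp: dmap_def\<close>)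
  show ?thesis
    by (rule D_cong[OF 1]) (use assms select_length[OF assms(2)] in \<open>simp add: pow_length\<close>)
qed

lemma dmapI:
  assumes "definable L M m X" "definable L M n Y" "f ` X \<subseteq> Y"
    "D (m + n) (\<lambda>z. take m z \<in> X \<and> f (take m z) = drop m z)"
  shows "dmap m X n Y f"
  using assms by (simp add: dmap_def)

lemma dmap_dom: "dmap m X n Y f \<Longrightarrow> definable L M m X"
  and dmap_cod: "dmap m X n Y f \<Longrightarrow> definable L M n Y"
  and dmap_maps: "dmap m X n Y f \<Longrightarrow> x \<in> X \<Longrightarrow> f x \<in> Y"
  by (auto simp: dmap_def)

lemma definable_graph_iff:
  assumes "X \<subseteq> pow U m" "f ` X \<subseteq> pow U n"
  shows "definable L M (m + n) {x @ f x | x. x \<in> X} \<longleftrightarrow>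
    D (m + n) (\<lambda>z. take m z \<in> X \<and> f (take m z) = drop m z)"
proof -
  have *: "z \<in> {x @ f x | x. x \<in> X} \<longleftrightarrow> take m z \<in> X \<and> f (take m z) = drop m z" for z
  proof
    assume "z \<in> {x @ f x | x. x \<in> X}"
    then show "take m z \<in> X \<and> f (take m z) = drop m z" using assms pow_length by fastforce
  next
    assume "take m z \<in> X \<and> f (take m z) = drop m z"
    then show "z \<in> {x @ f x | x. x \<in> X}"
      by (metis (mono_tags, lifting) append_take_drop_id mem_Collect_eq)
  qed
  have "{x @ f x | x. x \<in> X} \<subseteq> pow U (m + n)"
    using assms by (auto intro!: pow_append)
  then show ?thesis by (simp only: definable_iff *) simp
qed

lemma dmap_iff:
  assumes "definable L M m X" "definable L M n Y"
  shows "dmap m X n Y f \<longleftrightarrow> definable_map L M (m, X) (n, Y) f"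
proof (cases "f ` X \<subseteq> Y")
  case True
  then have "f ` X \<subseteq> pow U n" using definable_sub[OF assms(2)] by auto
  from definable_graph_iff[OF definable_sub[OF assms(1)] this] True assms
  show ?thesis by (simp add: dmap_def definable_map_def)
qed (simp add: dmap_def definable_map_def)

lemma dmap_restrict:
  assumes "dmap m X n Y f" "definable L M m X'" "X' \<subseteq> X" "definable L M n Y'" "f ` X' \<subseteq> Y'"
  shows "dmap m X' n Y' f"
proof (rule dmapI[OF assms(2,4,5)])
  have "D (m + n) (\<lambda>z. take m z \<in> X' \<and> (take m z \<in> X \<and> f (take m z) = drop m z))"
    by (rule D_map[OF assms(1)] D_set[OF assms(2)] D_logic select_intros | simp)+
  then show "D (m + n) (\<lambda>z. take m z \<in> X' \<and> f (take m z) = drop m z)"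
    by (rule D_cong) (use assms(3) in auto)
qed

lemma dmap_comp:
  assumes "dmap m X n Y f" "dmap n Y l Z g"
  shows "dmap m X l Z (\<lambda>x. g (f x))"
proof (rule dmapI)
  show "definable L M m X" "definable L M l Z" using assms by (auto simp: dmap_def)
  show "(\<lambda>x. g (f x)) ` X \<subseteq> Z" using assms by (auto simp: dmap_def)
  have "D (m + l) (\<lambda>z. \<exists>y\<in>pow U n. (take m z \<in> X \<and> f (take m z) = y) \<and> (y \<in> Y \<and> g y = drop m z))"
    by (rule D_ex D_conj[OF D_map[OF assms(1)] D_map[OF assms(2)]] select_intros | simp)+
  then show "D (m + l) (\<lambda>z. take m z \<in> X \<and> g (f (take m z)) = drop m z)"
    by (rule D_cong) (use dmap_maps[OF assms(1)] definable_in[OF dmap_cod[OF assms(1)]] in auto)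
qed

lemma dmap_const:
  assumes "definable L M m X" "definable L M n Y" "c \<in> Y"
  shows "dmap m X n Y (\<lambda>_. c)"
proof (rule dmapI[OF assms(1,2)])
  have c: "c \<in> pow U n" using assms definable_in by blast
  show "D (m + n) (\<lambda>z. take m z \<in> X \<and> c = drop m z)"
    by (rule D_conj D_set[OF assms(1)] D_eq select_const[OF c] select_intros | simp)+
qed (use assms in auto)

lemma dmap_take:
  assumes "definable L M (m + n) X" "definable L M m Y" "take m ` X \<subseteq> Y"
  shows "dmap (m + n) X m Y (take m)"
  by (rule dmapI[OF assms] D_conj D_set[OF assms(1)] D_eq select_intros | simp)+

lemma dmap_drop:
  assumes "definable L M (m + n) X" "definable L M n Y" "drop m ` X \<subseteq> Y"
  shows "dmap (m + n) X n Y (drop m)"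
  by (rule dmapI[OF assms] D_conj D_set[OF assms(1)] D_eq select_intros | simp)+

lemma dfam_fiber:
  assumes "dmap m X n Y f"
  shows "dfam n m (fiber X f)"
proof -
  have "dfam n m (\<lambda>y. {x \<in> pow U m. x \<in> X \<and> f x = y})"
    by (rule dfam_Collect D_map[OF assms] select_intros | simp)+
  then show ?thesis
    by (rule dfam_cong) (use definable_in[OF dmap_dom[OF assms]] in \<open>auto simp: fiber_def\<close>)
qed

lemma definable_fiber:
  assumes "dmap m X n Y f"
  shows "definable L M m (fiber X f y)"
proof (cases "y \<in> pow U n")
  case True
  then show ?thesis using dfam_inst[OF dfam_fiber[OF assms]] by simp
next
  case False
  then have "fiber X f y = {}"
    using dmap_maps[OF assms] definable_in[OF dmap_cod[OF assms]] by (auto simp: fiber_def)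
  then show ?thesis by (simp add: definable_empty)
qed

lemma definable_image:
  assumes "dmap m X n Y f"
  shows "definable L M n (f ` X)"
proof -
  have "definable L M n {y \<in> pow U n. \<exists>x\<in>pow U m. x \<in> X \<and> f x = y}"
    by (rule definable_Collect D_ex D_map[OF assms] select_intros | simp)+
  moreover have "{y \<in> pow U n. \<exists>x\<in>pow U m. x \<in> X \<and> f x = y} = f ` X"
    using definable_in[OF dmap_dom[OF assms]] definable_in[OF dmap_cod[OF assms]] dmap_maps[OF assms]
    by auto
  ultimately show ?thesis by simp
qed

text \<open>Conditions (F1) and (F2), freed from the map and its fibers so that they make sense for
  any function of a parameter.\<close>

definition simple :: "nat \<Rightarrow> ('m list \<Rightarrow> 'b) \<Rightarrow> bool" where
  "simple n w \<longleftrightarrow> finite (w ` pow U n) \<and> (\<forall>a. D n (\<lambda>z. w z = a))"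

lemma simple_const: "simple n (\<lambda>_. c)"
  unfolding simple_def by (auto intro: D_const finite_subset[of _ "{c}"])

lemma simple_cong: "simple n w \<Longrightarrow> (\<And>z. z \<in> pow U n \<Longrightarrow> w z = w' z) \<Longrightarrow> simple n w'"
  unfolding simple_def by (auto intro: D_cong[of n "\<lambda>z. w z = a" for a])

lemma simple_comb:
  assumes "simple n v" "simple n w"
  shows "simple n (\<lambda>z. g (v z) (w z))"
  unfolding simple_def
proof
  let ?I = "v ` pow U n \<times> w ` pow U n"
  have fin: "finite ?I" using assms by (simp add: simple_def)
  have "(\<lambda>z. g (v z) (w z)) ` pow U n \<subseteq> (\<lambda>(a, b). g a b) ` ?I" by force
  then show "finite ((\<lambda>z. g (v z) (w z)) ` pow U n)" using fin by (meson finite_imageI finite_subset)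
  show "\<forall>c. D n (\<lambda>z. g (v z) (w z) = c)"
  proof
    fix c
    have "D n (\<lambda>z. \<exists>i\<in>{i\<in>?I. g (fst i) (snd i) = c}. v z = fst i \<and> w z = snd i)"
      by (rule D_fin_ex) (use assms fin in \<open>auto simp: simple_def intro!: D_conj\<close>)
    then show "D n (\<lambda>z. g (v z) (w z) = c)" by (rule D_cong) auto
  qed
qed

lemma simple_fun: "simple n w \<Longrightarrow> simple n (\<lambda>z. g (w z))"
  using simple_comb[of n w w "\<lambda>a b. g a"] by simp

lemma simple_sum: "finite I \<Longrightarrow> (\<And>i. i \<in> I \<Longrightarrow> simple n (w i)) \<Longrightarrow> simple n (\<lambda>z. \<Sum>i\<in>I. w i z :: 'b::comm_monoid_add)"
proof (induction I rule: finite_induct)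
  case (insert i I)
  then have "simple n (\<lambda>z. w i z + (\<Sum>i\<in>I. w i z))"
    using simple_comb[of n "w i" "\<lambda>z. \<Sum>i\<in>I. w i z" "(+)"] by blast
  then show ?case using insert by simp
qed (simp add: simple_const)

lemma simple_sub: "simple k w \<Longrightarrow> select n j t \<Longrightarrow> j = k \<Longrightarrow> simple n (\<lambda>z. w (t z))"
proof -
  assume *: "simple k w" "select n j t" "j = k"
  then have "(\<lambda>z. w (t z)) ` pow U n \<subseteq> w ` pow U k" by (auto dest: select_in)
  then have "finite ((\<lambda>z. w (t z)) ` pow U n)" using *(1) unfolding simple_def by (meson finite_subset)
  moreover have "D n (\<lambda>z. w (t z) = a)" for a
    using *(1) by (intro D_pred[OF _ *(2,3), of "\<lambda>z. w z = a"]) (simp add: simple_def)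
  ultimately show ?thesis unfolding simple_def by blast
qed

lemma simple_D: "simple n w \<Longrightarrow> D n (\<lambda>z. w z = a)" by (simp add: simple_def)

lemma simple_level: "simple n w \<Longrightarrow> definable L M n Y \<Longrightarrow> definable L M n {y \<in> Y. w y = a}"
  by (simp add: simple_D definable_subset_Collect)

lemma simple_finite: "simple n w \<Longrightarrow> definable L M n Y \<Longrightarrow> finite (w ` Y)"
  unfolding simple_def by (meson definable_sub finite_subset image_mono)

end

section \<open>Integration in a category of families\<close>

context fo_structure
begin

lemma dfam_level:
  assumes "dfam k n Y" "simple (k + n) w"
  shows "dfam k n (\<lambda>p. {y \<in> Y p. w (p @ y) = a})"
proof -
  have "dfam k n (\<lambda>p. {y \<in> pow U n. y \<in> Y p \<and> w (p @ y) = a})"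
    by (rule dfam_Collect D_conj D_fam[OF assms(1)] D_pred[OF simple_D[OF assms(2)]] select_intros | simp)+
  then show ?thesis by (rule dfam_cong) (use dfam_in[OF assms(1)] in auto)
qed

lemma dfam_level_const:
  assumes "definable L M n Y" "simple (k + n) w"
  shows "dfam k n (\<lambda>p. {y \<in> Y. w (p @ y) = a})"
  by (rule dfam_level[OF dfam_const[OF assms(1)] assms(2)])

lemma dfam_level_const':
  assumes "definable L M n Y" "simple (n + k) w"
  shows "dfam k n (\<lambda>p. {y \<in> Y. w (y @ p) = a})"
proof -
  have "dfam k n (\<lambda>p. {y \<in> pow U n. y \<in> Y \<and> w (y @ p) = a})"
    by (rule dfam_Collect D_conj D_set[OF assms(1)] D_pred[OF simple_D[OF assms(2)]] select_intros | simp)+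
  then show ?thesis by (rule dfam_cong) (use definable_in[OF assms(1)] in auto)
qed

lemma simple_inst: "simple (k + n) w \<Longrightarrow> p \<in> pow U k \<Longrightarrow> simple n (\<lambda>y. w (p @ y))"
  by (rule simple_sub[of "k + n" w n "k + n"], assumption, rule select_append[OF select_const select_id], auto)

lemma simple_inst': "simple (n + k) w \<Longrightarrow> p \<in> pow U k \<Longrightarrow> simple n (\<lambda>y. w (y @ p))"
  by (rule simple_sub[of "n + k" w n "n + k"], assumption, rule select_append[OF select_id select_const], auto)

end

text \<open>\<open>K k m F\<close> says that the family of the sets \<open>F p \<subseteq> M\<^sup>m\<close>, for \<open>p \<in> M\<^sup>k\<close>, belongs
  uniformly to the category; a single set is a family with \<open>k = 0\<close>.\<close>

locale family_category = fo_structure L M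
  for L :: "('f, 'r) lang" and M :: "('f, 'r, 'm) fo_struct" +
  fixes K :: "nat \<Rightarrow> nat \<Rightarrow> ('m list \<Rightarrow> 'm list set) \<Rightarrow> bool"
  assumes K_dfam: "K k m F \<Longrightarrow> dfam k m F"
    and K_sub: "K k m F \<Longrightarrow> dfam l m G \<Longrightarrow> (\<And>q. q \<in> pow U l \<Longrightarrow> \<exists>p\<in>pow U k. G q \<subseteq> F p) \<Longrightarrow> K l m G"
    and K_prod: "K 0 m (\<lambda>_. X) \<Longrightarrow> K 0 n (\<lambda>_. Y) \<Longrightarrow> K 0 (m + n) (\<lambda>_. tprod X Y)"
    and K_single: "x \<in> pow U m \<Longrightarrow> K 0 m (\<lambda>_. {x})"
begin

abbreviation Ks :: "nat \<Rightarrow> 'm list set \<Rightarrow> bool" where "Ks m X \<equiv> K 0 m (\<lambda>_. X)"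

lemma Ks_definable: "Ks m X \<Longrightarrow> definable L M m X"
  using dfam_inst[OF K_dfam, of 0 m "\<lambda>_. X" "[]"] by simp

lemma K_fam_sub: "Ks m X \<Longrightarrow> dfam l m G \<Longrightarrow> (\<And>q. q \<in> pow U l \<Longrightarrow> G q \<subseteq> X) \<Longrightarrow> K l m G"
  by (rule K_sub) auto

lemma Ks_sub: "Ks m X \<Longrightarrow> definable L M m Y \<Longrightarrow> Y \<subseteq> X \<Longrightarrow> Ks m Y"
  by (rule K_fam_sub[OF _ dfam_const]) auto

lemma K_inst_sub: "K k m F \<Longrightarrow> p \<in> pow U k \<Longrightarrow> definable L M m Y \<Longrightarrow> Y \<subseteq> F p \<Longrightarrow> Ks m Y"
  by (rule K_sub[OF _ dfam_const]) auto

lemma K_inst: "K k m F \<Longrightarrow> p \<in> pow U k \<Longrightarrow> Ks m (F p)"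
  using K_inst_sub[of k m F p "F p"] dfam_inst[OF K_dfam] by auto

end

text \<open>Here (F1) and (F2) are demanded for every family of the category. Since the fibers of a
  map form such a family, this covers the usual conditions; the demand on all families is the one
  that an extension step reproduces.\<close>

locale measured_category = family_category L M K
  for L :: "('f, 'r) lang" and M :: "('f, 'r, 'm) fo_struct" and K +
  fixes \<nu> :: "nat \<Rightarrow> 'm list set \<Rightarrow> 'a::{comm_semiring_0, comm_monoid_mult}"
  assumes nu_simple: "K k m F \<Longrightarrow> simple k (\<lambda>p. \<nu> m (F p))"
    and nu_empty: "\<nu> m {} = 0"
    and nu_single: "x \<in> pow U m \<Longrightarrow> \<nu> m {x} = 1"
    and nu_add: "K 0 m (\<lambda>_. X \<union> Y) \<Longrightarrow> definable L M m X \<Longrightarrow> definable L M m Y \<Longrightarrow> X \<inter> Y = {} \<Longrightarrow>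
      \<nu> m (X \<union> Y) = \<nu> m X + \<nu> m Y"
    and nu_fub: "K 0 m (\<lambda>_. X) \<Longrightarrow> K 0 n (\<lambda>_. Y) \<Longrightarrow> dmap m X n Y f \<Longrightarrow>
      (\<And>y. y \<in> Y \<Longrightarrow> \<nu> m (fiber X f y) = a) \<Longrightarrow> \<nu> m X = a * \<nu> n Y"
begin

lemma nu_UN:
  assumes "finite I" "Ks m (\<Union>i\<in>I. Y i)" "\<And>i. i \<in> I \<Longrightarrow> definable L M m (Y i)"
    "\<And>i j. i \<in> I \<Longrightarrow> j \<in> I \<Longrightarrow> i \<noteq> j \<Longrightarrow> Y i \<inter> Y j = {}"
  shows "\<nu> m (\<Union>i\<in>I. Y i) = (\<Sum>i\<in>I. \<nu> m (Y i))"
  using assms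
proof (induction I rule: finite_induct)
  case (insert i I)
  have "definable L M m (\<Union>i\<in>I. Y i)" using insert(1) insert.prems(2)
    by (induction I rule: finite_induct) (auto simp: definable_empty intro!: definable_Un)
  then have K: "Ks m (\<Union>i\<in>I. Y i)" using insert.prems by (auto intro: Ks_sub)
  have "\<nu> m (Y i \<union> (\<Union>i\<in>I. Y i)) = \<nu> m (Y i) + \<nu> m (\<Union>i\<in>I. Y i)"
  proof (rule nu_add)
    show "Y i \<inter> \<Union> (Y ` I) = {}" using insert by blast
  qed (use insert K Ks_definable in auto)
  also have "\<nu> m (\<Union>i\<in>I. Y i) = (\<Sum>i\<in>I. \<nu> m (Y i))"
    by (rule insert.IH) (use K insert.prems in auto)
  finally show ?case using insert by simp
qed (simp add: nu_empty)

text \<open>For infinitely many values the sum would default to 0; a \<open>simple\<close> integrand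
  over a definable set never has that many.\<close>

definition intg :: "nat \<Rightarrow> 'm list set \<Rightarrow> ('m list \<Rightarrow> 'a) \<Rightarrow> 'a" where
  "intg n Y w = (\<Sum>a\<in>w ` Y. a * \<nu> n {y \<in> Y. w y = a})"

lemma intg_cong: "(\<And>y. y \<in> Y \<Longrightarrow> w y = w' y) \<Longrightarrow> intg n Y w = intg n Y w'"
  unfolding intg_def by (rule sum.cong) (auto intro!: arg_cong[of _ _ "\<nu> n"] arg_cong2[of _ _ _ _ "(*)"])

text \<open>Gives all members of a family of integrals the same index set, so that the sum over
  values can be pulled out of an integral or out of a dependence on parameters.\<close>

lemma intg_superset:
  assumes "finite S" "w ` Y \<subseteq> S"
  shows "intg n Y w = (\<Sum>a\<in>S. a * \<nu> n {y \<in> Y. w y = a})"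
  unfolding intg_def
proof (rule sum.mono_neutral_left[OF assms], rule)
  fix a assume "a \<in> S - w ` Y"
  then have "{y \<in> Y. w y = a} = {}" by auto
  then show "a * \<nu> n {y \<in> Y. w y = a} = 0" by (simp only: nu_empty mult_zero_right)
qed

text \<open>The substitute for linearity arguments: integrands are compared on a common refinement
  of their level sets, and only additivity of the measure is used to regroup the pieces by
  value.\<close>

lemma intg_partition:
  assumes "Ks n Y" "finite I" "\<And>i. i \<in> I \<Longrightarrow> definable L M n (P i)" "Y = (\<Union>i\<in>I. P i)"
    "\<And>i j. i \<in> I \<Longrightarrow> j \<in> I \<Longrightarrow> i \<noteq> j \<Longrightarrow> P i \<inter> P j = {}"
    "\<And>i y. i \<in> I \<Longrightarrow> y \<in> P i \<Longrightarrow> w y = c i"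
  shows "intg n Y w = (\<Sum>i\<in>I. c i * \<nu> n (P i))"
proof -
  \<comment> \<open>An empty piece may carry a \<open>c i\<close> that is not a value of
    \<open>w\<close>. Such indices are set aside before grouping by value; they contribute
    0.\<close>
  let ?J = "{i \<in> I. c i \<in> w ` Y}"
  have img: "w ` Y \<subseteq> c ` I" using assms(4,6) by auto
  then have fin: "finite (w ` Y)" using assms(2) by (meson finite_imageI finite_subset)
  have "a * \<nu> n {y \<in> Y. w y = a} = (\<Sum>i\<in>{i \<in> ?J. c i = a}. c i * \<nu> n (P i))" if a: "a \<in> w ` Y" for a
  proof -
    let ?I = "{i \<in> I. c i = a}"
    have eq: "{y \<in> Y. w y = a} = (\<Union>i\<in>?I. P i)" using assms(4,6) by auto
    have "definable L M n (\<Union>i\<in>J. P i)" if "finite J" "J \<subseteq> I" for J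
      using that assms(3) by (induction J rule: finite_induct) (auto simp: definable_empty intro!: definable_Un)
    then have "definable L M n (\<Union>i\<in>?I. P i)" using assms(2) by simp
    then have "Ks n (\<Union>i\<in>?I. P i)" using assms(1,4) by (auto intro: Ks_sub)
    then have "\<nu> n (\<Union>i\<in>?I. P i) = (\<Sum>i\<in>?I. \<nu> n (P i))"
      by (intro nu_UN) (use assms in auto)
    then have "a * \<nu> n {y \<in> Y. w y = a} = (\<Sum>i\<in>?I. c i * \<nu> n (P i))"
      unfolding eq by (simp add: sum_distrib_left)
    moreover have "?I = {i \<in> ?J. c i = a}" using a by auto
    ultimately show ?thesis by simp
  qed
  then have "intg n Y w = (\<Sum>a\<in>w ` Y. \<Sum>i\<in>{i \<in> ?J. c i = a}. c i * \<nu> n (P i))"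
    unfolding intg_def by (rule sum.cong[OF refl])
  also have "\<dots> = (\<Sum>i\<in>?J. c i * \<nu> n (P i))"
    by (rule sum.group) (use assms(2) fin in auto)
  also have "\<dots> = (\<Sum>i\<in>I. c i * \<nu> n (P i))"
  proof (rule sum.mono_neutral_left[OF assms(2)], simp, rule)
    fix i assume "i \<in> I - ?J"
    then have "P i = {}" using assms(6)[of i] unfolding assms(4) by (auto simp: image_iff)
    then show "c i * \<nu> n (P i) = 0" by (simp only: nu_empty mult_zero_right)
  qed
  finally show ?thesis .
qed

lemma intg_const: "Ks n Y \<Longrightarrow> intg n Y (\<lambda>_. c) = c * \<nu> n Y"
  using intg_partition[of n Y "{()}" "\<lambda>_. Y" "\<lambda>_. c" "\<lambda>_. c"] Ks_definable by simp

lemma intg_add: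
  assumes "Ks n Y" "simple n v" "simple n w"
  shows "intg n Y (\<lambda>y. v y + w y) = intg n Y v + intg n Y w"
proof -
  let ?I = "v ` Y \<times> w ` Y"
  let ?P = "\<lambda>i. {y \<in> Y. (v y, w y) = i}"
  have def: "definable L M n Y" using assms(1) by (rule Ks_definable)
  have "simple n (\<lambda>y. (v y, w y))" using assms(2,3) by (rule simple_comb)
  then have P: "definable L M n (?P i)" for i by (rule simple_level[OF _ def])
  have fin: "finite ?I" using assms(2,3) def by (simp add: simple_finite)
  have part: "intg n Y u = (\<Sum>i\<in>?I. c i * \<nu> n (?P i))"
    if "\<And>y. y \<in> Y \<Longrightarrow> u y = c (v y, w y)" for u c
    by (rule intg_partition[OF assms(1) fin P]) (use that in auto)
  have "intg n Y (\<lambda>y. v y + w y) = (\<Sum>i\<in>?I. (fst i + snd i) * \<nu> n (?P i))" by (rule part) simp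
  also have "\<dots> = (\<Sum>i\<in>?I. fst i * \<nu> n (?P i)) + (\<Sum>i\<in>?I. snd i * \<nu> n (?P i))"
    by (simp only: distrib_right sum.distrib)
  also have "(\<Sum>i\<in>?I. fst i * \<nu> n (?P i)) = intg n Y v" by (rule part[symmetric]) simp
  also have "(\<Sum>i\<in>?I. snd i * \<nu> n (?P i)) = intg n Y w" by (rule part[symmetric]) simp
  finally show ?thesis .
qed

lemma intg_cmult:
  assumes "Ks n Y" "simple n w"
  shows "intg n Y (\<lambda>y. c * w y) = c * intg n Y w"
proof -
  have def: "definable L M n Y" using assms(1) by (rule Ks_definable)
  have "intg n Y (\<lambda>y. c * w y) = (\<Sum>a\<in>w ` Y. (c * a) * \<nu> n {y \<in> Y. w y = a})"
    by (rule intg_partition[OF assms(1)]) (use assms(2) def in \<open>auto intro: simple_finite simple_level\<close>)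
  then show ?thesis unfolding intg_def by (simp add: sum_distrib_left mult.assoc)
qed

lemma intg_sum:
  assumes "Ks n Y" "finite I" "\<And>i. i \<in> I \<Longrightarrow> simple n (w i)"
  shows "intg n Y (\<lambda>y. \<Sum>i\<in>I. w i y) = (\<Sum>i\<in>I. intg n Y (w i))"
  using assms(2,3)
proof (induction I rule: finite_induct)
  case empty
  then show ?case using intg_const[OF assms(1), of 0] by simp
next
  case (insert i I)
  then show ?case using intg_add[OF assms(1), of "w i" "\<lambda>y. \<Sum>i\<in>I. w i y"] by (simp add: simple_sum)
qed

text \<open>With the values of \<open>w\<close> on the whole of \<open>M^(k+n)\<close> as a fixed
  index set, the integral is a finite sum of multiples of measures of families of level sets, each
  of which is simple in \<open>p\<close>.\<close>

lemma intg_simple: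
  assumes "K k n Y" "simple (k + n) w"
  shows "simple k (\<lambda>p. intg n (Y p) (\<lambda>y. w (p @ y)))"
proof -
  let ?S = "w ` pow U (k + n)"
  have fin: "finite ?S" using assms(2) by (simp add: simple_def)
  have 1: "intg n (Y p) (\<lambda>y. w (p @ y)) = (\<Sum>a\<in>?S. a * \<nu> n {y \<in> Y p. w (p @ y) = a})"
    if "p \<in> pow U k" for p
    using that dfam_in[OF K_dfam[OF assms(1)] that] by (intro intg_superset[OF fin]) (auto intro!: pow_append)
  have "K k n (\<lambda>p. {y \<in> Y p. w (p @ y) = a})" for a
    by (rule K_sub[OF assms(1) dfam_level[OF K_dfam[OF assms(1)] assms(2)]]) auto
  then have "simple k (\<lambda>p. \<nu> n {y \<in> Y p. w (p @ y) = a})" for a by (rule nu_simple)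
  then have "simple k (\<lambda>p. a * \<nu> n {y \<in> Y p. w (p @ y) = a})" for a by (rule simple_fun)
  then have "simple k (\<lambda>p. \<Sum>a\<in>?S. a * \<nu> n {y \<in> Y p. w (p @ y) = a})" by (intro simple_sum fin)
  then show ?thesis by (rule simple_cong) (simp add: 1)
qed

lemma K_fiber:
  assumes "Ks m X" "dmap m X n Y f"
  shows "K n m (fiber X f)"
  by (rule K_fam_sub[OF assms(1) dfam_fiber[OF assms(2)]]) (auto simp: fiber_def)

text \<open>(F3) treats only fibers of constant measure; the base is cut into the finitely many sets
  on which the measure of the fiber is constant.\<close>

lemma fubini:
  assumes "Ks m X" "Ks n Y" "dmap m X n Y f"
  shows "intg n Y (\<lambda>y. \<nu> m (fiber X f y)) = \<nu> m X"
proof -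
  let ?w = "\<lambda>y. \<nu> m (fiber X f y)"
  let ?Y = "\<lambda>a. {y \<in> Y. ?w y = a}" and ?X = "\<lambda>a. {x \<in> X. ?w (f x) = a}"
  have w: "simple n ?w" using K_fiber[OF assms(1,3)] by (rule nu_simple)
  have defY: "definable L M n (?Y a)" for a by (rule simple_level[OF w Ks_definable[OF assms(2)]])
  have "D m (\<lambda>x. \<exists>y\<in>pow U n. (x \<in> X \<and> f x = y) \<and> y \<in> ?Y a)" for a
    by (rule D_ex D_conj D_map[OF assms(3)] D_set[OF defY] select_intros | simp only: diff_add_inverse le_add1 if_True)+
  then have "D m (\<lambda>x. x \<in> ?X a)" for a
    by (rule D_cong) (use dmap_maps[OF assms(3)] definable_in[OF Ks_definable[OF assms(2)]] in auto)
  then have defX: "definable L M m (?X a)" for a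
    unfolding definable_iff using definable_in[OF Ks_definable[OF assms(1)]] by auto
  have XU: "X = (\<Union>a\<in>?w ` Y. ?X a)" using dmap_maps[OF assms(3)] by auto
  have "\<nu> m X = (\<Sum>a\<in>?w ` Y. \<nu> m (?X a))"
  proof (subst XU, rule nu_UN)
    show "finite (?w ` Y)" using w Ks_definable[OF assms(2)] by (rule simple_finite)
    show "Ks m (\<Union>a\<in>?w ` Y. ?X a)" using XU assms(1) by simp
  qed (use defX in auto)
  also have "\<dots> = (\<Sum>a\<in>?w ` Y. a * \<nu> n (?Y a))"
  proof (rule sum.cong[OF refl])
    fix a
    have "dmap m (?X a) n (?Y a) f"
      by (rule dmap_restrict[OF assms(3) defX _ defY]) (use dmap_maps[OF assms(3)] in auto)
    then show "\<nu> m (?X a) = a * \<nu> n (?Y a)"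
    proof (rule nu_fub[rotated 2])
      fix y assume "y \<in> ?Y a"
      moreover from this have "fiber (?X a) f y = fiber X f y" by (auto simp: fiber_def)
      ultimately show "\<nu> m (fiber (?X a) f y) = a" by simp
    qed (use assms defX defY in \<open>auto intro: Ks_sub\<close>)
  qed
  finally show ?thesis by (simp add: intg_def)
qed

text \<open>The fibers of a bijection are points, so (F3) applies with factor 1.\<close>

lemma nu_bij:
  assumes "Ks m X" "Ks n Y" "dmap m X n Y f" "bij_betw f X Y"
  shows "\<nu> m X = \<nu> n Y"
proof -
  have "\<nu> m X = 1 * \<nu> n Y"
  proof (rule nu_fub[OF assms(1-3)])
    fix y assume "y \<in> Y"
    then obtain x where x: "x \<in> X" "f x = y" using assms(4) by (auto simp: bij_betw_def)
    then have "fiber X f y = {x}" using assms(4) by (auto simp: fiber_def bij_betw_def inj_on_def)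
    then show "\<nu> m (fiber X f y) = 1" using nu_single definable_in[OF Ks_definable[OF assms(1)] x(1)] by simp
  qed
  then show ?thesis by simp
qed

text \<open>Each level set \<open>?E a\<close> of \<open>w\<close> is measured through both
  projections of the product. The fibers of a projection are copies of slices of \<open>?E a\<close>
  in a higher power of \<open>M\<close>, and \<open>nu_bij\<close> identifies them with the
  slices.\<close>

lemma intg_tprod:
  assumes "Ks n Y" "Ks l Z" "simple (n + l) w"
  shows "intg (n + l) (tprod Y Z) w = intg n Y (\<lambda>y. intg l Z (\<lambda>z. w (y @ z)))" (is ?A)
    and "intg (n + l) (tprod Y Z) w = intg l Z (\<lambda>z. intg n Y (\<lambda>y. w (y @ z)))" (is ?B)
proof -
  let ?S = "w ` pow U (n + l)"
  let ?E = "\<lambda>a. {u \<in> tprod Y Z. w u = a}"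
  have fin: "finite ?S" using assms(3) by (simp add: simple_def)
  have Y: "Y \<subseteq> pow U n" and Z: "Z \<subseteq> pow U l"
    using Ks_definable[OF assms(1)] Ks_definable[OF assms(2)] by (auto dest: definable_sub)
  have defE: "definable L M (n + l) (?E a)" for a
    by (rule simple_level[OF assms(3) Ks_definable[OF K_prod[OF assms(1,2)]]])
  then have KE: "Ks (n + l) (?E a)" for a by (rule Ks_sub[OF K_prod[OF assms(1,2)]]) auto
  have int: "intg (n + l) (tprod Y Z) w = (\<Sum>a\<in>?S. a * \<nu> (n + l) (?E a))"
    by (rule intg_superset[OF fin]) (use tprod_sub[OF Y Z] in auto)
  have KZ: "K n l (\<lambda>y. {z \<in> Z. w (y @ z) = a})" for a
    by (rule K_fam_sub[OF assms(2) dfam_level_const[OF Ks_definable[OF assms(2)] assms(3)]]) auto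
  have KY: "K l n (\<lambda>z. {y \<in> Y. w (y @ z) = a})" for a
    by (rule K_fam_sub[OF assms(1) dfam_level_const'[OF Ks_definable[OF assms(1)] assms(3)]]) auto
  have mt: "dmap (n + l) (?E a) n Y (take n)" for a
    by (rule dmap_take[OF defE Ks_definable[OF assms(1)]]) (use Y in \<open>auto simp: tprod_iff\<close>)
  have md: "dmap (n + l) (?E a) l Z (drop n)" for a
    by (rule dmap_drop[OF defE Ks_definable[OF assms(2)]]) (use Y in \<open>auto simp: tprod_iff\<close>)
  have 1: "\<nu> (n + l) (fiber (?E a) (take n) y) = \<nu> l {z \<in> Z. w (y @ z) = a}" if "y \<in> Y" for a y
  proof (rule nu_bij)
    show K1: "Ks (n + l) (fiber (?E a) (take n) y)"
      by (rule Ks_sub[OF KE[of a] definable_fiber[OF mt]]) (auto simp: fiber_def)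
    show K2: "Ks l {z \<in> Z. w (y @ z) = a}" by (rule K_inst[OF KZ]) (use that Y in auto)
    have "length y = n" using that Y by (metis pow_length subsetD)
    then have td: "take n (y @ z) = y" "drop n (y @ z) = z" for z by simp_all
    have app: "y @ drop n x = x" if "take n x = y" for x using that by (metis append_take_drop_id)
    show "dmap (n + l) (fiber (?E a) (take n) y) l {z \<in> Z. w (y @ z) = a} (drop n)"
      by (rule dmap_drop[OF Ks_definable[OF K1] Ks_definable[OF K2]])
        (auto simp: fiber_def tprod_iff[OF Y])
    show "bij_betw (drop n) (fiber (?E a) (take n) y) {z \<in> Z. w (y @ z) = a}"
      by (rule bij_betwI[of _ _ _ "\<lambda>z. y @ z"])
        (use that app in \<open>auto simp: fiber_def tprod_iff[OF Y] td simp del: take_append drop_append\<close>)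
  qed
  have 2: "\<nu> (n + l) (fiber (?E a) (drop n) z) = \<nu> n {y \<in> Y. w (y @ z) = a}" if "z \<in> Z" for a z
  proof (rule nu_bij)
    show K1: "Ks (n + l) (fiber (?E a) (drop n) z)"
      by (rule Ks_sub[OF KE[of a] definable_fiber[OF md]]) (auto simp: fiber_def)
    show K2: "Ks n {y \<in> Y. w (y @ z) = a}" by (rule K_inst[OF KY]) (use that Z in auto)
    show "dmap (n + l) (fiber (?E a) (drop n) z) n {y \<in> Y. w (y @ z) = a} (take n)"
      by (rule dmap_take[OF Ks_definable[OF K1] Ks_definable[OF K2]])
        (auto simp: fiber_def tprod_iff[OF Y])
    have "length y = n" if "y \<in> Y" for y using that Y by (metis pow_length subsetD)
    then have td: "take n (y @ z) = y" "drop n (y @ z) = z" if "y \<in> Y" for y using that by simp_all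
    show "bij_betw (take n) (fiber (?E a) (drop n) z) {y \<in> Y. w (y @ z) = a}"
      by (rule bij_betwI[of _ _ _ "\<lambda>y. y @ z"])
        (use that in \<open>auto simp: fiber_def tprod_iff[OF Y] td simp del: take_append drop_append\<close>)
  qed
  have "(\<Sum>a\<in>?S. a * \<nu> (n + l) (?E a)) = (\<Sum>a\<in>?S. intg n Y (\<lambda>y. a * \<nu> l {z \<in> Z. w (y @ z) = a}))"
  proof (rule sum.cong[OF refl])
    fix a
    have "\<nu> (n + l) (?E a) = intg n Y (\<lambda>y. \<nu> l {z \<in> Z. w (y @ z) = a})"
      unfolding fubini[OF KE assms(1) mt, symmetric] by (rule intg_cong) (rule 1)
    then show "a * \<nu> (n + l) (?E a) = intg n Y (\<lambda>y. a * \<nu> l {z \<in> Z. w (y @ z) = a})"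
      by (simp add: intg_cmult[OF assms(1) nu_simple[OF KZ]])
  qed
  also have "\<dots> = intg n Y (\<lambda>y. \<Sum>a\<in>?S. a * \<nu> l {z \<in> Z. w (y @ z) = a})"
    by (rule intg_sum[OF assms(1) fin, symmetric]) (rule simple_fun[OF nu_simple[OF KZ]])
  also have "\<dots> = intg n Y (\<lambda>y. intg l Z (\<lambda>z. w (y @ z)))"
    by (rule intg_cong, rule intg_superset[OF fin, symmetric]) (use Y Z in \<open>auto intro!: pow_append\<close>)
  finally show ?A using int by simp
  have "(\<Sum>a\<in>?S. a * \<nu> (n + l) (?E a)) = (\<Sum>a\<in>?S. intg l Z (\<lambda>z. a * \<nu> n {y \<in> Y. w (y @ z) = a}))"
  proof (rule sum.cong[OF refl])
    fix a
    have "\<nu> (n + l) (?E a) = intg l Z (\<lambda>z. \<nu> n {y \<in> Y. w (y @ z) = a})"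
      unfolding fubini[OF KE assms(2) md, symmetric] by (rule intg_cong) (rule 2)
    then show "a * \<nu> (n + l) (?E a) = intg l Z (\<lambda>z. a * \<nu> n {y \<in> Y. w (y @ z) = a})"
      by (simp add: intg_cmult[OF assms(2) nu_simple[OF KY]])
  qed
  also have "\<dots> = intg l Z (\<lambda>z. \<Sum>a\<in>?S. a * \<nu> n {y \<in> Y. w (y @ z) = a})"
    by (rule intg_sum[OF assms(2) fin, symmetric]) (rule simple_fun[OF nu_simple[OF KY]])
  also have "\<dots> = intg l Z (\<lambda>z. intg n Y (\<lambda>y. w (y @ z)))"
    by (rule intg_cong, rule intg_superset[OF fin, symmetric]) (use Y Z in \<open>auto intro!: pow_append\<close>)
  finally show ?B using int by simp
qed

end

section \<open>Extending a measure along fibrations\<close>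

context measured_category
begin

text \<open>Base and fibers lie in the old category while \<open>X\<close> may be new. The fibers
  must do so uniformly in \<open>y\<close>, which makes their measure an integrable function on the
  base.\<close>

definition fibration :: "nat \<Rightarrow> 'm list set \<Rightarrow> nat \<Rightarrow> 'm list set \<Rightarrow> ('m list \<Rightarrow> 'm list) \<Rightarrow> bool" where
  "fibration m X n Y f \<longleftrightarrow> dmap m X n Y f \<and> Ks n Y \<and> K n m (fiber X f)"

definition fib_int :: "nat \<Rightarrow> 'm list set \<Rightarrow> nat \<Rightarrow> 'm list set \<Rightarrow> ('m list \<Rightarrow> 'm list) \<Rightarrow> 'a" where
  "fib_int m X n Y f = intg n Y (\<lambda>y. \<nu> m (fiber X f y))"

lemma fibration_restrict:
  assumes "fibration m X n Y f" "definable L M m X'" "X' \<subseteq> X"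
  shows "fibration m X' n Y f"
proof -
  have f: "dmap m X n Y f" using assms(1) by (simp add: fibration_def)
  have d: "dmap m X' n Y f"
    by (rule dmap_restrict[OF f assms(2,3) dmap_cod[OF f]]) (use dmap_maps[OF f] assms(3) in auto)
  moreover have "K n m (fiber X' f)"
    by (rule K_sub[OF _ dfam_fiber[OF d]]) (use assms in \<open>fastforce simp: fibration_def fiber_def\<close>)+
  ultimately show ?thesis using assms(1) by (simp add: fibration_def)
qed

text \<open>Fubini inside each fiber of \<open>f\<close> introduces an integral over
  \<open>Z\<close>, and the two integrals are then exchanged. Since nothing is asked of the fibers
  of \<open>g\<close>, the lemma serves both for uniqueness and for Fubini in the extension.\<close>

lemma fib_int_swap:
  assumes "fibration m X n Y f" "dmap m X l Z g" "Ks l Z"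
  shows "fib_int m X n Y f = intg l Z (\<lambda>z. fib_int m (fiber X g z) n Y f)"
proof -
  have f: "dmap m X n Y f" "Ks n Y" "K n m (fiber X f)" using assms(1) by (auto simp: fibration_def)
  have X: "definable L M m X" using f(1) by (rule dmap_dom)
  define h where "h u = {x \<in> X. f x = take n u \<and> g x = drop n u}" for u
  have "dfam (n + l) m (\<lambda>u. {x \<in> pow U m. (x \<in> X \<and> f x = take n u) \<and> (x \<in> X \<and> g x = drop n u)})"
    by (rule dfam_Collect D_conj D_map[OF f(1)] D_map[OF assms(2)] select_intros | simp)+
  then have "dfam (n + l) m h"
    by (rule dfam_cong) (use definable_in[OF X] in \<open>auto simp: h_def\<close>)
  \<comment> \<open>Each \<open>h u\<close> is contained in the fiber of \<open>f\<close> over the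
    first half of \<open>u\<close>; this puts the family into \<open>K\<close>.\<close>
  then have "K (n + l) m h"
    by (rule K_sub[OF f(3)]) (auto simp: h_def fiber_def dest: pow_take)
  then have w: "simple (n + l) (\<lambda>u. \<nu> m (h u))" by (rule nu_simple)
  have Yl: "length y = n" if "y \<in> Y" for y
    using that definable_in[OF Ks_definable[OF f(2)]] by (metis pow_length)
  have h1: "h (y @ z) = fiber (fiber X f y) g z" "h (y @ z) = fiber (fiber X g z) f y" if "y \<in> Y" for y z
    using Yl[OF that] by (auto simp: h_def fiber_def)
  have "fib_int m X n Y f = intg n Y (\<lambda>y. intg l Z (\<lambda>z. \<nu> m (h (y @ z))))"
    unfolding fib_int_def
  proof (rule intg_cong)
    fix y assume y: "y \<in> Y"
    have Kf: "Ks m (fiber X f y)"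
      using K_inst[OF f(3)] y definable_in[OF Ks_definable[OF f(2)]] by blast
    have "dmap m (fiber X f y) l Z g"
      by (rule dmap_restrict[OF assms(2) Ks_definable[OF Kf] _ dmap_cod[OF assms(2)]])
        (use dmap_maps[OF assms(2)] in \<open>auto simp: fiber_def\<close>)
    from fubini[OF Kf assms(3) this]
    show "\<nu> m (fiber X f y) = intg l Z (\<lambda>z. \<nu> m (h (y @ z)))" by (simp add: h1(1)[OF y])
  qed
  also have "\<dots> = intg l Z (\<lambda>z. intg n Y (\<lambda>y. \<nu> m (h (y @ z))))"
    using intg_tprod[OF f(2) assms(3) w] by simp
  also have "\<dots> = intg l Z (\<lambda>z. fib_int m (fiber X g z) n Y f)"
    unfolding fib_int_def by (intro intg_cong) (simp add: h1(2))
  finally show ?thesis .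
qed

text \<open>After the swap the inner integrals concern the fibers of \<open>g\<close>, which are old
  sets, and for these Fubini along \<open>f\<close> returns the old measure.\<close>

lemma fib_int_unique:
  assumes "fibration m X n Y f" "fibration m X l Z g"
  shows "fib_int m X n Y f = fib_int m X l Z g"
proof -
  have f: "dmap m X n Y f" "Ks n Y" using assms(1) by (auto simp: fibration_def)
  have g: "dmap m X l Z g" "Ks l Z" "K l m (fiber X g)" using assms(2) by (auto simp: fibration_def)
  have "fib_int m (fiber X g z) n Y f = \<nu> m (fiber X g z)" if "z \<in> Z" for z
  proof -
    have Kg: "Ks m (fiber X g z)"
      using K_inst[OF g(3)] that definable_in[OF Ks_definable[OF g(2)]] by blast
    have "dmap m (fiber X g z) n Y f"
      by (rule dmap_restrict[OF f(1) Ks_definable[OF Kg] _ dmap_cod[OF f(1)]])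
        (use dmap_maps[OF f(1)] in \<open>auto simp: fiber_def\<close>)
    from fubini[OF Kg f(2) this] show ?thesis by (simp add: fib_int_def)
  qed
  then show ?thesis
    unfolding fib_int_swap[OF assms(1) g(1,2)] by (simp add: fib_int_def cong: intg_cong)
qed

definition nu_ext :: "nat \<Rightarrow> 'm list set \<Rightarrow> 'a" where
  "nu_ext m X = (THE a. \<exists>n Y f. fibration m X n Y f \<and> a = fib_int m X n Y f)"

lemma nu_ext_eq:
  assumes "fibration m X n Y f"
  shows "nu_ext m X = fib_int m X n Y f"
  unfolding nu_ext_def using assms fib_int_unique by (intro the_equality) blast+

text \<open>Over a one-point base the only fiber is the set itself; this makes the new value of an
  old set its old measure.\<close>

lemma fibration_point:
  assumes "Ks m X"
  shows "fibration m X 0 {[]} (\<lambda>_. [])"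
proof -
  have K0: "Ks 0 {[]}" by (rule K_single) simp
  have d: "dmap m X 0 {[]} (\<lambda>_. [])"
    using dmap_const[OF Ks_definable[OF assms] Ks_definable[OF K0]] by simp
  then show ?thesis using K0 K_fiber[OF assms d] by (simp add: fibration_def)
qed

lemma nu_ext_extends:
  assumes "Ks m X"
  shows "nu_ext m X = \<nu> m X"
proof -
  have f: "fibration m X 0 {[]} (\<lambda>_. [])" by (rule fibration_point[OF assms])
  have "fib_int m X 0 {[]} (\<lambda>_. []) = \<nu> m X"
    unfolding fib_int_def by (rule fubini[OF assms]) (use f in \<open>auto simp: fibration_def\<close>)
  then show ?thesis by (simp add: nu_ext_eq[OF f])
qed

end

text \<open>One case of a case distinction on the parameter \<open>p\<close>: with an auxiliary parameter
  \<open>q \<in> M\<^sup>j\<close> such that \<open>Q (p @ q)\<close>, the relation \<open>G (p @ q)\<close> is the graph of a map from \<open>F p\<close>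
  to \<open>M\<^sup>n\<close> whose image and fibers belong uniformly to the category.\<close>

type_synonym 'm step = "nat \<times> nat \<times> ('m list \<Rightarrow> bool) \<times> ('m list \<Rightarrow> 'm list \<Rightarrow> 'm list \<Rightarrow> bool)"

fun (in family_category) step_case :: "nat \<Rightarrow> nat \<Rightarrow> ('m list \<Rightarrow> 'm list set) \<Rightarrow> 'm step \<Rightarrow> bool" where
  "step_case k m F (j, n, Q, G) \<longleftrightarrow>
     D (k + j) Q \<and>
     D (k + j + (m + n)) (\<lambda>z. G (take (k + j) z) (take m (drop (k + j) z)) (drop m (drop (k + j) z))) \<and>
     (\<forall>p\<in>pow U k. \<forall>q\<in>pow U j. Q (p @ q) \<longrightarrow> (\<forall>x\<in>F p. \<exists>!y. y \<in> pow U n \<and> G (p @ q) x y)) \<and>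
     K (k + j) n (\<lambda>u. {y \<in> pow U n. Q u \<and> (\<exists>x\<in>F (take k u). G u x y)}) \<and>
     K (k + j + n) m (\<lambda>u. {x \<in> F (take k u). Q (take (k + j) u) \<and> G (take (k + j) u) x (drop (k + j) u)})"

fun applies :: "'m set \<Rightarrow> 'm step \<Rightarrow> 'm list \<Rightarrow> bool" where
  "applies V (j, n, Q, G) p \<longleftrightarrow> (\<exists>q\<in>pow V j. Q (p @ q))"

text \<open>The auxiliary parameter \<open>q\<close> need not depend definably on \<open>p\<close>.
  As every admissible \<open>q\<close> yields the same value \<open>w p\<close>, the level sets are
  defined by quantifying existentially over \<open>q\<close>, and no choice is made.\<close>

lemma (in fo_structure) simple_cases:
  assumes S: "finite S" "\<And>p. p \<in> pow U k \<Longrightarrow> \<exists>d\<in>S. applies U d p"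
    and Q: "\<And>d. d \<in> S \<Longrightarrow> D (k + fst d) (fst (snd (snd d)))"
    and Vsf: "\<And>d. d \<in> S \<Longrightarrow> simple (k + fst d) (V d)"
    and V: "\<And>d p q. d \<in> S \<Longrightarrow> p \<in> pow U k \<Longrightarrow> q \<in> pow U (fst d) \<Longrightarrow> fst (snd (snd d)) (p @ q) \<Longrightarrow> w p = V d (p @ q)"
  shows "simple k w"
proof -
  have Vd: "(\<exists>q\<in>pow U (fst d). fst (snd (snd d)) (p @ q) \<and> V d (p @ q) = a) \<longleftrightarrow> applies U d p \<and> w p = a"
    if "d \<in> S" "p \<in> pow U k" for d p a
    using V[OF that] by (cases d) auto
  have "w ` pow U k \<subseteq> (\<Union>d\<in>S. V d ` pow U (k + fst d))"
  proof
    fix a assume "a \<in> w ` pow U k"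
    then obtain p where p: "p \<in> pow U k" "w p = a" by blast
    from S(2)[OF p(1)] obtain d where d: "d \<in> S" "applies U d p" by blast
    with Vd[OF d(1) p(1), of a] p(2) obtain q where "q \<in> pow U (fst d)" "V d (p @ q) = a" by blast
    then show "a \<in> (\<Union>d\<in>S. V d ` pow U (k + fst d))"
      using d(1) p(1) by (blast intro: pow_append)
  qed
  moreover have "finite (\<Union>d\<in>S. V d ` pow U (k + fst d))"
    using S(1) Vsf by (auto simp: simple_def)
  ultimately have fin: "finite (w ` pow U k)" by (rule finite_subset)
  have "D k (\<lambda>p. w p = a)" for a
  proof -
    have "D k (\<lambda>p. \<exists>d\<in>S. \<exists>q\<in>pow U (fst d). fst (snd (snd d)) (p @ q) \<and> V d (p @ q) = a)"
    proof (rule D_fin_ex[OF S(1)])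
      fix d assume d: "d \<in> S"
      show "D k (\<lambda>p. \<exists>q\<in>pow U (fst d). fst (snd (snd d)) (p @ q) \<and> V d (p @ q) = a)"
        by (rule D_ex D_conj D_pred[OF Q[OF d]] D_pred[OF simple_D[OF Vsf[OF d]]] select_intros | simp)+
    qed
    then show ?thesis
      by (rule D_cong) (use Vd S(2) in \<open>simp cong: bex_cong\<close>)
  qed
  then show ?thesis using fin by (simp add: simple_def)
qed

text \<open>The assumption \<open>step\<close> isolates what the measure has to know about the
  passage from \<open>K\<close> to \<open>K'\<close>. Its proof by compactness is thereby separated
  from the theory of integration.\<close>

locale family_extension = family_category L M K + K': family_category L M K'
  for L :: "('f, 'r) lang" and M :: "('f, 'r, 'm) fo_struct" and K K' +
  assumes K_le: "K k m F \<Longrightarrow> K' k m F"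
    and step: "K' k m F \<Longrightarrow> \<exists>S. finite S \<and> (\<forall>d\<in>S. step_case k m F d) \<and>
      (\<forall>p\<in>pow (univ M) k. \<exists>d\<in>S. applies (univ M) d p)"

locale measure_extension = family_extension L M K K' + measured_category L M K \<nu>
  for L :: "('f, 'r) lang" and M :: "('f, 'r, 'm) fo_struct" and K K'
    and \<nu> :: "nat \<Rightarrow> 'm list set \<Rightarrow> 'a::{comm_semiring_0, comm_monoid_mult}"
begin

text \<open>Fixing \<open>p\<close> and \<open>q\<close> turns the relation into a map and the
  uniform families of the case into one base and its fibers, the latter still uniformly in
  \<open>y\<close>.\<close>

lemma step_fibration:
  assumes "K' k m F" "step_case k m F (j, n, Q, G)"
    and pq: "p \<in> pow U k" "q \<in> pow U j" "Q (p @ q)"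
  shows "\<exists>f. fibration m (F p) n {y \<in> pow U n. \<exists>x\<in>F p. G (p @ q) x y} f \<and>
    (\<forall>y\<in>pow U n. fiber (F p) f y = {x \<in> F p. G (p @ q) x y})"
proof -
  have G: "D (k + j + (m + n)) (\<lambda>z. G (take (k + j) z) (take m (drop (k + j) z)) (drop m (drop (k + j) z)))"
    and ex1: "\<forall>x\<in>F p. \<exists>!y. y \<in> pow U n \<and> G (p @ q) x y"
    and Kim: "K (k + j) n (\<lambda>u. {y \<in> pow U n. Q u \<and> (\<exists>x\<in>F (take k u). G u x y)})"
    and Kfib: "K (k + j + n) m (\<lambda>u. {x \<in> F (take k u). Q (take (k + j) u) \<and> G (take (k + j) u) x (drop (k + j) u)})"
    using assms(2) pq by auto
  define f where "f x = (THE y. y \<in> pow U n \<and> G (p @ q) x y)" for x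
  let ?Y = "{y \<in> pow U n. \<exists>x\<in>F p. G (p @ q) x y}"
  have tk: "take k (p @ q) = p" "p @ q \<in> pow U (k + j)" using pq by (auto simp: pow_length pow_append)
  have f: "f x \<in> pow U n \<and> G (p @ q) x (f x)" if "x \<in> F p" for x
    unfolding f_def by (rule theI') (use ex1 that in blast)
  have fG: "f x = y \<longleftrightarrow> y \<in> pow U n \<and> G (p @ q) x y" if "x \<in> F p" for x y
    using f[OF that] ex1 that by blast
  have fib: "fiber (F p) f y = {x \<in> F p. G (p @ q) x y}" if "y \<in> pow U n" for y
    using fG that by (auto simp: fiber_def)
  have X: "definable L M m (F p)" using dfam_inst[OF K'.K_dfam[OF assms(1)] pq(1)] .
  have "Ks n ((\<lambda>u. {y \<in> pow U n. Q u \<and> (\<exists>x\<in>F (take k u). G u x y)}) (p @ q))"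
    by (rule K_inst[OF Kim]) (rule tk)
  then have KY: "Ks n ?Y" using tk pq by simp
  have d: "dmap m (F p) n ?Y f"
  proof (rule dmapI[OF X Ks_definable[OF KY]])
    show "f ` F p \<subseteq> ?Y" using f by blast
    have "D (m + n) (\<lambda>z. take m z \<in> F p \<and> (\<lambda>z. G (take (k + j) z) (take m (drop (k + j) z)) (drop m (drop (k + j) z))) ((p @ q) @ z))"
      by (rule D_conj D_set[OF X] D_pred[OF G] select_const[OF tk(2)] select_intros | simp only: diff_add_inverse le_add1 if_True)+
    then show "D (m + n) (\<lambda>z. take m z \<in> F p \<and> f (take m z) = drop m z)"
    proof (rule D_cong)
      fix z assume z: "z \<in> pow U (m + n)"
      have td: "take (k + j) ((p @ q) @ z) = p @ q" "drop (k + j) ((p @ q) @ z) = z"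
        using pow_length[OF tk(2)] by (metis append_eq_conv_conj)+
      show "(take m z \<in> F p \<and> G (take (k + j) ((p @ q) @ z)) (take m (drop (k + j) ((p @ q) @ z)))
          (drop m (drop (k + j) ((p @ q) @ z)))) = (take m z \<in> F p \<and> f (take m z) = drop m z)"
        unfolding td using fG[of "take m z" "drop m z"] pow_drop[OF z] by blast
    qed
  qed
  have "K n m (fiber (F p) f)"
  proof (rule K_sub[OF Kfib dfam_fiber[OF d]])
    fix y assume y: "y \<in> pow U n"
    show "\<exists>u\<in>pow U (k + j + n). fiber (F p) f y \<subseteq> {x \<in> F (take k u). Q (take (k + j) u) \<and> G (take (k + j) u) x (drop (k + j) u)}"
      using y pq by (intro bexI[of _ "p @ q @ y"])
        (auto simp: fib pow_length add.assoc intro!: pow_append)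
  qed
  then have "fibration m (F p) n ?Y f" using d KY by (simp add: fibration_def)
  then show ?thesis using fib by blast
qed

lemma ex_fibration:
  assumes "K'.Ks m X"
  obtains n Y f where "fibration m X n Y f"
proof -
  from step[OF assms] obtain S where S: "\<forall>d\<in>S. step_case 0 m (\<lambda>_. X) d"
    "\<forall>p\<in>pow U 0. \<exists>d\<in>S. applies U d p"
    by blast
  then obtain d where d: "d \<in> S" "applies U d []" by auto
  obtain j n Q G where deq: "d = (j, n, Q, G)" by (cases d)
  then obtain q where q: "q \<in> pow U j" "Q ([] @ q)" using d by auto
  have "step_case 0 m (\<lambda>_. X) (j, n, Q, G)" using S(1) d(1) deq by blast
  from step_fibration[OF assms this _ q] that show ?thesis by auto
qed

lemma nu_ext_simple:
  assumes "K' k m F"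
  shows "simple k (\<lambda>p. nu_ext m (F p))"
proof -
  from step[OF assms] obtain S where S: "finite S" "\<And>d. d \<in> S \<Longrightarrow> step_case k m F d"
    "\<And>p. p \<in> pow U k \<Longrightarrow> \<exists>d\<in>S. applies U d p"
    by blast
  \<comment> \<open>The integral that a case prescribes, as a function of \<open>p @ q\<close>.
    Where \<open>Q\<close> fails the base is empty, so the expression stays simple on the whole
    parameter space.\<close>
  define V where "V = (\<lambda>(j, n, Q, G) u. intg n {y \<in> pow U n. Q u \<and> (\<exists>x\<in>F (take k u). G u x y)}
     (\<lambda>y. \<nu> m {x \<in> F (take k (u @ y)). Q (take (k + j) (u @ y)) \<and> G (take (k + j) (u @ y)) x (drop (k + j) (u @ y))}))"
  have Vsf: "simple (k + fst d) (V d)" if d: "d \<in> S" for d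
  proof -
    obtain j n Q G where deq: "d = (j, n, Q, G)" by (cases d)
    have "K (k + j) n (\<lambda>u. {y \<in> pow U n. Q u \<and> (\<exists>x\<in>F (take k u). G u x y)})"
      "K (k + j + n) m (\<lambda>u. {x \<in> F (take k u). Q (take (k + j) u) \<and> G (take (k + j) u) x (drop (k + j) u)})"
      using S(2)[OF d] deq by auto
    from intg_simple[OF this(1) nu_simple[OF this(2)]] show ?thesis by (simp add: V_def deq)
  qed
  have V: "nu_ext m (F p) = V (j, n, Q, G) (p @ q)"
    if "(j, n, Q, G) \<in> S" "p \<in> pow U k" "q \<in> pow U j" "Q (p @ q)" for j n Q G p q
  proof -
    from step_fibration[OF assms S(2)[OF that(1)] that(2-4)]
    obtain f where f: "fibration m (F p) n {y \<in> pow U n. \<exists>x\<in>F p. G (p @ q) x y} f"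
      "\<And>y. y\<in>pow U n \<Longrightarrow> fiber (F p) f y = {x \<in> F p. G (p @ q) x y}"
      by blast
    have "take k (p @ q) = p" "\<And>y. take k ((p @ q) @ y) = p" "\<And>y. take (k + j) ((p @ q) @ y) = p @ q"
      "\<And>y. drop (k + j) ((p @ q) @ y) = y"
      using that by (auto simp: pow_length)
    then show ?thesis
      unfolding nu_ext_eq[OF f(1)] fib_int_def V_def prod.case using that(4)
      by (simp only: simp_thms) (rule intg_cong, simp add: f(2))
  qed
  show ?thesis
  proof (rule simple_cases[OF S(1,3)])
    show "D (k + fst d) (fst (snd (snd d)))" if "d \<in> S" for d using S(2)[OF that] by (cases d) auto
    show "simple (k + fst d) (V d)" if "d \<in> S" for d using Vsf that .
    show "nu_ext m (F p) = V d (p @ q)"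
      if "d \<in> S" "p \<in> pow U k" "q \<in> pow U (fst d)" "fst (snd (snd d)) (p @ q)" for d p q
      using V that by (cases d) auto
  qed
qed

text \<open>A single fibration of \<open>X\<close> restricts to every fiber of \<open>g\<close> and
  so computes all the values at once. The base \<open>Z\<close> has to be an old set, because the
  integral over it uses the old measure.\<close>

lemma nu_ext_fubini:
  assumes "K'.Ks m X" "Ks l Z" "dmap m X l Z g"
  shows "nu_ext m X = intg l Z (\<lambda>z. nu_ext m (fiber X g z))"
proof -
  obtain n Y f where f: "fibration m X n Y f" using ex_fibration[OF assms(1)] .
  have "nu_ext m (fiber X g z) = fib_int m (fiber X g z) n Y f" for z
    by (rule nu_ext_eq[OF fibration_restrict[OF f definable_fiber[OF assms(3)]]]) (auto simp: fiber_def)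
  then show ?thesis
    by (simp add: nu_ext_eq[OF f] fib_int_swap[OF f assms(3,2)])
qed

text \<open>A fibration of the union restricts to both parts, so additivity reduces to the fibers
  over a common base.\<close>

lemma nu_ext_add:
  assumes "K'.Ks m (X \<union> Y)" "definable L M m X" "definable L M m Y" "X \<inter> Y = {}"
  shows "nu_ext m (X \<union> Y) = nu_ext m X + nu_ext m Y"
proof -
  obtain n Z f where f: "fibration m (X \<union> Y) n Z f" using ex_fibration[OF assms(1)] .
  have fX: "fibration m X n Z f" and fY: "fibration m Y n Z f"
    by (rule fibration_restrict[OF f]; use assms in auto)+
  have Z: "Ks n Z" using f by (simp add: fibration_def)
  have "fib_int m (X \<union> Y) n Z f = intg n Z (\<lambda>z. \<nu> m (fiber X f z) + \<nu> m (fiber Y f z))"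
    unfolding fib_int_def
  proof (rule intg_cong)
    fix z assume "z \<in> Z"
    then have z: "z \<in> pow U n" using definable_in[OF Ks_definable[OF Z]] by blast
    have eq: "fiber (X \<union> Y) f z = fiber X f z \<union> fiber Y f z" by (auto simp: fiber_def)
    have "Ks m (fiber (X \<union> Y) f z)" using f z by (auto simp: fibration_def intro: K_inst)
    then show "\<nu> m (fiber (X \<union> Y) f z) = \<nu> m (fiber X f z) + \<nu> m (fiber Y f z)"
      unfolding eq by (rule nu_add)
        (use fX fY assms(4) definable_fiber[of m X n Z f z] definable_fiber[of m Y n Z f z]
          in \<open>auto simp: fibration_def fiber_def[of X] fiber_def[of Y]\<close>)
  qed
  also have "\<dots> = fib_int m X n Z f + fib_int m Y n Z f"
    unfolding fib_int_def by (rule intg_add[OF Z]) (use fX fY in \<open>auto simp: fibration_def intro: nu_simple\<close>)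
  finally show ?thesis by (simp add: nu_ext_eq[OF f] nu_ext_eq[OF fX] nu_ext_eq[OF fY])
qed

text \<open>The base \<open>Z\<close> may be new. It is fibered by \<open>f\<close> over an old set
  \<open>Y\<close>; for each \<open>y\<close>, the map \<open>g\<close> from the part of
  \<open>X\<close> over \<open>y\<close> has an old base, namely the fiber of \<open>f\<close>, and
  \<open>nu_ext_fubini\<close> applies there as well as to the composite map.\<close>

lemma nu_ext_fub:
  assumes "K'.Ks m X" "K'.Ks l Z" "dmap m X l Z g" "\<And>z. z \<in> Z \<Longrightarrow> nu_ext m (fiber X g z) = a"
  shows "nu_ext m X = a * nu_ext l Z"
proof -
  obtain n Y f where f: "fibration l Z n Y f" using ex_fibration[OF assms(2)] .
  then have f': "dmap l Z n Y f" "Ks n Y" "K n l (fiber Z f)" by (auto simp: fibration_def)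
  have gf: "dmap m X n Y (\<lambda>x. f (g x))" by (rule dmap_comp[OF assms(3) f'(1)])
  have "nu_ext m X = intg n Y (\<lambda>y. nu_ext m (fiber X (\<lambda>x. f (g x)) y))"
    by (rule nu_ext_fubini[OF assms(1) f'(2) gf])
  also have "\<dots> = intg n Y (\<lambda>y. a * \<nu> l (fiber Z f y))"
  proof (rule intg_cong)
    fix y assume y: "y \<in> Y"
    let ?X = "fiber X (\<lambda>x. f (g x)) y" and ?Z = "fiber Z f y"
    have KX: "K'.Ks m ?X" by (rule K'.Ks_sub[OF assms(1) definable_fiber[OF gf]]) (auto simp: fiber_def)
    have KZ: "Ks l ?Z" using K_inst[OF f'(3)] y definable_in[OF Ks_definable[OF f'(2)]] by blast
    have d: "dmap m ?X l ?Z g"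
      by (rule dmap_restrict[OF assms(3) K'.Ks_definable[OF KX] _ Ks_definable[OF KZ]])
        (use dmap_maps[OF assms(3)] in \<open>auto simp: fiber_def\<close>)
    have "nu_ext m ?X = intg l ?Z (\<lambda>z. nu_ext m (fiber ?X g z))" by (rule nu_ext_fubini[OF KX KZ d])
    also have "\<dots> = intg l ?Z (\<lambda>_. a)"
    proof (rule intg_cong)
      fix z assume "z \<in> ?Z"
      then have "z \<in> Z" "fiber ?X g z = fiber X g z" by (auto simp: fiber_def)
      then show "nu_ext m (fiber ?X g z) = a" using assms(4) by simp
    qed
    finally show "nu_ext m ?X = a * \<nu> l ?Z" by (simp add: intg_const[OF KZ])
  qed
  also have "\<dots> = a * fib_int l Z n Y f"
    unfolding fib_int_def by (rule intg_cmult[OF f'(2) nu_simple[OF f'(3)]])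
  finally show ?thesis by (simp add: nu_ext_eq[OF f])
qed

lemma empty_in_K: "Ks m {}"
proof -
  obtain x where "x \<in> U" using univ_nonempty by blast
  then have "replicate m x \<in> pow U m" by (auto simp: pow_def)
  from K_single[OF this] show ?thesis by (rule Ks_sub) (auto simp: definable_empty)
qed

text \<open>The conclusion has the shape of the assumption on \<open>K\<close>, which allows
  iteration over the number of fibration steps.\<close>

theorem measured_extension: "measured_category L M K' nu_ext"
proof
  show "nu_ext m {} = 0" for m using nu_ext_extends[OF empty_in_K] by (simp add: nu_empty)
  show "nu_ext m {x} = 1" if "x \<in> pow U m" for m x
    using nu_ext_extends[OF K_single[OF that]] nu_single[OF that] by simp
qed (use nu_ext_simple nu_ext_add nu_ext_fub in blast)+

end

section \<open>Existence of \<open>\<omega>\<close>-saturated elementary extensions\<close>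

definition ultra :: "'i set set \<Rightarrow> bool" where
  "ultra W \<longleftrightarrow> (\<forall>A B. A \<inter> B \<in> W \<longleftrightarrow> A \<in> W \<and> B \<in> W) \<and> (\<forall>A. - A \<in> W \<longleftrightarrow> A \<notin> W)"

text \<open>Zorn's lemma for the families that contain \<open>B\<close> and have the finite
  intersection property. Maximality puts every superset of a finite intersection of members into the
  family; and if \<open>A\<close> cannot be added, finitely many members intersect inside its
  complement.\<close>

lemma ultra_exists:
  fixes B :: "'i set set"
  assumes "\<And>S. finite S \<Longrightarrow> S \<subseteq> B \<Longrightarrow> \<Inter>S \<noteq> {}"
  shows "\<exists>W. B \<subseteq> W \<and> ultra W"
proof -
  define fip where "fip W \<longleftrightarrow> (\<forall>S. finite S \<and> S \<subseteq> W \<longrightarrow> \<Inter>S \<noteq> {})" for W :: "'i set set"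
  have "\<exists>W\<in>{W. B \<subseteq> W \<and> fip W}. \<forall>X\<in>{W. B \<subseteq> W \<and> fip W}. W \<subseteq> X \<longrightarrow> X = W"
  proof (rule subset_Zorn_nonempty)
    show "{W. B \<subseteq> W \<and> fip W} \<noteq> {}" using assms by (auto simp: fip_def)
    fix \<C> assume C: "\<C> \<noteq> {}" "subset.chain {W. B \<subseteq> W \<and> fip W} \<C>"
    have "fip (\<Union>\<C>)" unfolding fip_def
    proof (intro allI impI)
      fix S assume S: "finite S \<and> S \<subseteq> \<Union>\<C>"
      then obtain W where "W \<in> \<C>" "S \<subseteq> W"
        using finite_subset_Union_chain[of S \<C> "{W. B \<subseteq> W \<and> fip W}"] C by blast
      then show "\<Inter>S \<noteq> {}" using C S unfolding subset.chain_def fip_def by blast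
    qed
    then show "\<Union>\<C> \<in> {W. B \<subseteq> W \<and> fip W}" using C unfolding subset.chain_def by blast
  qed
  then obtain W where "W \<in> {W. B \<subseteq> W \<and> fip W}" "\<forall>X\<in>{W. B \<subseteq> W \<and> fip W}. W \<subseteq> X \<longrightarrow> X = W" ..
  then have W: "B \<subseteq> W" "fip W" "\<And>X. B \<subseteq> X \<Longrightarrow> fip X \<Longrightarrow> W \<subseteq> X \<Longrightarrow> X = W" by simp_all
  have up: "X \<in> W" if "finite S" "S \<subseteq> W" "\<Inter>S \<subseteq> X" for S X
  proof -
    have "fip (insert X W)" unfolding fip_def
    proof (intro allI impI)
      fix T assume T: "finite T \<and> T \<subseteq> insert X W"
      have "finite (S \<union> (T - {X}))" "S \<union> (T - {X}) \<subseteq> W" using T that by auto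
      then have "\<Inter>(S \<union> (T - {X})) \<noteq> {}" by (intro W(2)[unfolded fip_def, rule_format] conjI)
      then show "\<Inter>T \<noteq> {}" using that(3) by blast
    qed
    then have "insert X W = W" using W by blast
    then show ?thesis by blast
  qed
  have neg: "- A \<in> W" if "A \<notin> W" for A
  proof -
    have "\<not> fip (insert A W)" using W(1) W(3)[of "insert A W"] that by blast
    then obtain T where T: "finite T" "T \<subseteq> insert A W" "\<Inter>T = {}" unfolding fip_def by blast
    then show ?thesis by (intro up[of "T - {A}"]) auto
  qed
  have "A \<inter> C \<in> W \<longleftrightarrow> A \<in> W \<and> C \<in> W" for A C
  proof
    assume "A \<inter> C \<in> W"
    then show "A \<in> W \<and> C \<in> W" by (auto intro: up[of "{A \<inter> C}"])
  next
    assume "A \<in> W \<and> C \<in> W"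
    then show "A \<inter> C \<in> W" by (intro up[of "{A, C}"]) auto
  qed
  moreover have "\<not> (A \<in> W \<and> - A \<in> W)" for A
  proof
    assume "A \<in> W \<and> - A \<in> W"
    then have "\<Inter>{A, - A} \<noteq> {}" by (intro W(2)[unfolded fip_def, rule_format]) simp
    then show False by simp
  qed
  ultimately have "ultra W" using neg unfolding ultra_def by auto
  then show ?thesis using W(1) by blast
qed

subsection \<open>The limit of the iterated ultrapowers\<close>

text \<open>Elements of the \<open>n\<close>-th iterated ultrapower are functions on the space of sequences of indices
  that depend on the first \<open>n\<close> coordinates only. The quantifier \<open>quant (Suc n)\<close> puts the new
  coordinate outermost, which makes the \<open>(n+1)\<close>-st stage an ultrapower of the \<open>n\<close>-th.\<close>

fun quant :: "'i set set \<Rightarrow> nat \<Rightarrow> ((nat \<Rightarrow> 'i) \<Rightarrow> bool) \<Rightarrow> bool" where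
  "quant W 0 A = A (\<lambda>_. undefined)"
| "quant W (Suc n) A = ({x. quant W n (\<lambda>j. A (j(n := x)))} \<in> W)"

definition dep :: "nat \<Rightarrow> ((nat \<Rightarrow> 'i) \<Rightarrow> 'b) \<Rightarrow> bool" where
  "dep n g \<longleftrightarrow> (\<forall>j j'. (\<forall>i<n. j i = j' i) \<longrightarrow> g j = g j')"

lemma dep_mono: "dep n g \<Longrightarrow> n \<le> m \<Longrightarrow> dep m g"
  by (auto simp: dep_def)

lemma dep_upd: "dep n g \<Longrightarrow> g (j(n := x)) = g j"
  unfolding dep_def by (metis fun_upd_other less_irrefl)

lemma dep_fun: "dep n g \<Longrightarrow> dep n (\<lambda>j. F (g j))"
  unfolding dep_def by metis

lemma dep_const: "dep n (\<lambda>_. c)"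
  by (simp add: dep_def)

locale ultra_index =
  fixes W :: "'i set set"
  assumes W: "ultra W"
begin

lemma W_Int: "A \<inter> B \<in> W \<longleftrightarrow> A \<in> W \<and> B \<in> W" and W_Compl: "- A \<in> W \<longleftrightarrow> A \<notin> W"
  using W by (auto simp: ultra_def)

lemma W_mono: "A \<in> W \<Longrightarrow> A \<subseteq> B \<Longrightarrow> B \<in> W"
  using W_Int[of A B] by (simp add: Int_absorb2)

lemma W_const: "{x. c} \<in> W \<longleftrightarrow> c"
proof -
  have "\<not> ({} \<in> W \<and> UNIV \<in> W)" "{} \<in> W \<or> UNIV \<in> W" using W_Compl[of UNIV] by auto
  moreover have "{} \<in> W \<Longrightarrow> UNIV \<in> W" by (rule W_mono) auto
  ultimately show ?thesis by (cases c) auto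
qed

abbreviation "quantW \<equiv> quant W"

lemma quant_conj: "quantW n (\<lambda>j. A j \<and> B j) \<longleftrightarrow> quantW n A \<and> quantW n B"
  by (induction n arbitrary: A B) (simp_all add: W_Int[symmetric] Int_def)

lemma quant_neg: "quantW n (\<lambda>j. \<not> A j) \<longleftrightarrow> \<not> quantW n A"
proof (induction n arbitrary: A)
  case (Suc n)
  have "{x. \<not> quantW n (\<lambda>j. A (j(n := x)))} = - {x. quantW n (\<lambda>j. A (j(n := x)))}" by auto
  then show ?case by (simp add: Suc W_Compl)
qed simp

lemma quant_mono: "quantW n A \<Longrightarrow> (\<And>j. A j \<Longrightarrow> B j) \<Longrightarrow> quantW n B"
proof (induction n arbitrary: A B)
  case (Suc n)
  from Suc.prems(1) show ?case unfolding quant.simps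
  proof (rule W_mono, intro Collect_mono impI)
    fix x assume "quantW n (\<lambda>j. A (j(n := x)))"
    then show "quantW n (\<lambda>j. B (j(n := x)))" by (rule Suc.IH) (rule Suc.prems(2))
  qed
qed auto

text \<open>A coordinate on which nothing depends is quantified away, because a constant condition
  holds on all indices or on none. Truth therefore does not depend on the stage at which it is
  computed.\<close>

lemma quant_stable: "dep n A \<Longrightarrow> n \<le> m \<Longrightarrow> quantW m A \<longleftrightarrow> quantW n A"
proof (induction m)
  case (Suc m)
  show ?case
  proof (cases "n = Suc m")
    case False
    then have "n \<le> m" using Suc by simp
    then have "A (j(m := x)) = A j" for j x using Suc.prems dep_mono dep_upd by metis
    then have "quantW (Suc m) A \<longleftrightarrow> {x. quantW m A} \<in> W" by simp
    then show ?thesis using Suc \<open>n \<le> m\<close> by (simp only: W_const)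
  qed simp
qed simp

definition alm :: "((nat \<Rightarrow> 'i) \<Rightarrow> bool) \<Rightarrow> bool" where
  "alm A \<longleftrightarrow> (\<exists>n. dep n A \<and> quantW n A)"

lemma alm_iff: "dep n A \<Longrightarrow> alm A \<longleftrightarrow> quantW n A"
  unfolding alm_def by (metis nat_le_linear quant_stable)

definition fin_dep :: "((nat \<Rightarrow> 'i) \<Rightarrow> 'b) \<Rightarrow> bool" where
  "fin_dep g \<longleftrightarrow> (\<exists>n. dep n g)"

lemma fin_dep_const: "fin_dep (\<lambda>_. c)"
  unfolding fin_dep_def by (rule exI, rule dep_const)

lemma fin_dep_comb: "fin_dep f \<Longrightarrow> fin_dep g \<Longrightarrow> fin_dep (\<lambda>j. F (f j) (g j))"
proof -
  assume "fin_dep f" "fin_dep g"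
  then obtain n m where "dep n f" "dep m g" unfolding fin_dep_def by blast
  then have "dep (max n m) f" "dep (max n m) g" by (auto elim: dep_mono)
  then have "dep (max n m) (\<lambda>j. F (f j) (g j))" unfolding dep_def by metis
  then show ?thesis unfolding fin_dep_def by blast
qed

lemma fin_dep_common:
  assumes "finite S" "\<And>g. g \<in> S \<Longrightarrow> fin_dep g"
  shows "\<exists>n. \<forall>g\<in>S. dep n g"
  using assms
proof (induction S rule: finite_induct)
  case (insert g S)
  then obtain n where "\<forall>g\<in>S. dep n g" by auto
  moreover obtain m where "dep m g" using insert.prems unfolding fin_dep_def by auto
  ultimately have "\<forall>g\<in>insert g S. dep (max n m) g"
    by (metis insert_iff dep_mono max.cobounded1 max.cobounded2)
  then show ?case by blast
qed simp

lemma alm_conj: "fin_dep A \<Longrightarrow> fin_dep B \<Longrightarrow> alm (\<lambda>j. A j \<and> B j) \<longleftrightarrow> alm A \<and> alm B"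
proof -
  assume "fin_dep A" "fin_dep B"
  then obtain n m where "dep n A" "dep m B" unfolding fin_dep_def by blast
  then have d: "dep (max n m) A" "dep (max n m) B" by (auto elim: dep_mono)
  then have "dep (max n m) (\<lambda>j. A j \<and> B j)" unfolding dep_def by metis
  then show ?thesis using d by (simp add: alm_iff quant_conj)
qed

lemma alm_neg: "fin_dep A \<Longrightarrow> alm (\<lambda>j. \<not> A j) \<longleftrightarrow> \<not> alm A"
proof -
  assume "fin_dep A"
  then obtain n where "dep n A" unfolding fin_dep_def by blast
  moreover from this have "dep n (\<lambda>j. \<not> A j)" by (rule dep_fun)
  ultimately show ?thesis by (simp add: alm_iff quant_neg)
qed

lemma alm_mono:
  assumes "alm A" "fin_dep B" "\<And>j. A j \<Longrightarrow> B j"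
  shows "alm B"
proof -
  obtain n m where "dep n A" "dep m B" using assms unfolding fin_dep_def alm_def by blast
  then have d: "dep (max n m) A" "dep (max n m) B" by (auto elim: dep_mono)
  then show ?thesis using assms quant_mono by (auto simp: alm_iff)
qed

lemma alm_const: "alm (\<lambda>_. c) \<longleftrightarrow> c"
  by (simp add: alm_iff[OF dep_const[of 0]])

lemma alm_ball:
  assumes "finite S" "\<And>s. s \<in> S \<Longrightarrow> fin_dep (A s)" "\<And>s. s \<in> S \<Longrightarrow> alm (A s)"
  shows "alm (\<lambda>j. \<forall>s\<in>S. A s j) \<and> fin_dep (\<lambda>j. \<forall>s\<in>S. A s j)"
  using assms
proof (induction S rule: finite_induct)
  case (insert s S)
  then have "alm (\<lambda>j. A s j \<and> (\<forall>s\<in>S. A s j))" by (subst alm_conj) auto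
  moreover have "fin_dep (\<lambda>j. A s j \<and> (\<forall>s\<in>S. A s j))" 
    using insert fin_dep_comb[of "A s" "\<lambda>j. \<forall>s\<in>S. A s j" "(\<and>)"] by blast
  ultimately show ?case by simp
qed (simp add: alm_const fin_dep_const)

end

text \<open>A function depending on finitely many coordinates is coded by its graph on finite lists of
  indices. These are lists of lists of formulas, coded by formulas, so that the code lies in the
  type \<open>ext\<close>.\<close>

fun encl :: "('f, 'r) fm list \<Rightarrow> ('f, 'r) fm" where
  "encl [] = Eq (Var 0) (Var 0)"
| "encl (\<phi> # \<phi>s) = Conj \<phi> (encl \<phi>s)"

lemma encl_inj: "encl xs = encl ys \<Longrightarrow> xs = ys"
proof (induction xs arbitrary: ys)
  case Nil
  then show ?case by (cases ys) auto
next
  case (Cons x xs)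
  then show ?case by (cases ys) auto
qed

definition encll :: "('f, 'r) fm list list \<Rightarrow> ('f, 'r) fm" where
  "encll xss = encl (map encl xss)"

lemma encll_inj: "encll xs = encll ys \<longleftrightarrow> xs = ys"
  unfolding encll_def using encl_inj by (metis injI inj_map_eq_map)

type_synonym ('f, 'r) seqs = "nat \<Rightarrow> ('f, 'r) fm list"

section \<open>Los's theorem and saturation of the limit\<close>

locale limit_ultrapower = ultra_index W for W :: "('f, 'r) fm list set set" +
  fixes L :: "('f, 'r) lang" and M :: "('f, 'r, 'm) fo_struct"
  assumes M: "is_struct L M" and W_cofinal: "{\<Delta>. \<phi> \<in> set \<Delta>} \<in> W"
begin

definition adm :: "(('f, 'r) seqs \<Rightarrow> 'm) \<Rightarrow> bool" where
  "adm g \<longleftrightarrow> fin_dep g \<and> range g \<subseteq> univ M"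

definition code :: "(('f, 'r) seqs \<Rightarrow> 'm) \<Rightarrow> ('f, 'r, 'm) ext" where
  "code g = {(g (\<lambda>i. if i < length l then l ! i else undefined), encll l) | l. True}"

lemma code_inj:
  assumes "adm g" "adm g'" "code g = code g'"
  shows "g = g'"
proof
  fix j :: "('f, 'r) seqs"
  obtain n where n: "dep n g" "dep n g'"
    using fin_dep_common[of "{g, g'}"] assms(1,2) by (auto simp: adm_def)
  let ?l = "map j [0..<n]"
  let ?j = "(\<lambda>i. if i < length ?l then ?l ! i else undefined) :: ('f, 'r) seqs"
  have "(g ?j, encll ?l) \<in> code g" unfolding code_def by (intro CollectI exI[of _ ?l] conjI refl TrueI)
  then have "(g ?j, encll ?l) \<in> code g'" by (simp only: assms(3))
  then obtain l where "encll ?l = encll l" "g ?j = g' (\<lambda>i. if i < length l then l ! i else undefined)"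
    unfolding code_def by blast
  then have "g ?j = g' ?j" by (simp only: encll_inj)
  moreover have "g ?j = g j" "g' ?j = g' j" using n unfolding dep_def by auto
  ultimately show "g j = g' j" by simp
qed

definition eqv :: "(('f, 'r) seqs \<Rightarrow> 'm) \<Rightarrow> (('f, 'r) seqs \<Rightarrow> 'm) \<Rightarrow> bool" where
  "eqv g g' \<longleftrightarrow> alm (\<lambda>j. g j = g' j)"

lemma eqv_refl: "eqv g g" by (simp add: eqv_def alm_const)

lemma eqv_sym: "eqv g g' \<Longrightarrow> eqv g' g"
  by (simp add: eqv_def eq_commute)

lemma eqv_trans:
  assumes "eqv f g" "eqv g k" "adm f" "adm g" "adm k"
  shows "eqv f k"
proof -
  have "fin_dep (\<lambda>j. f j = g j)" "fin_dep (\<lambda>j. g j = k j)" "fin_dep (\<lambda>j. f j = k j)"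
    using assms by (auto simp: adm_def intro: fin_dep_comb)
  then have "alm (\<lambda>j. f j = g j \<and> g j = k j)" using assms by (simp add: alm_conj eqv_def)
  then show ?thesis unfolding eqv_def by (rule alm_mono) (use \<open>fin_dep (\<lambda>j. f j = k j)\<close> in auto)
qed

text \<open>An equivalence class of codes would lie one power set too high for the type
  \<open>ext\<close>. The code of one chosen member takes its place.\<close>

definition cls :: "(('f, 'r) seqs \<Rightarrow> 'm) \<Rightarrow> ('f, 'r, 'm) ext" where
  "cls g = code (SOME g'. adm g' \<and> eqv g g')"

lemma cls_eq_iff:
  assumes "adm f" "adm g"
  shows "cls f = cls g \<longleftrightarrow> eqv f g"
proof
  define f' where "f' = (SOME g'. adm g' \<and> eqv f g')"
  define g' where "g' = (SOME g'. adm g' \<and> eqv g g')"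
  have f': "adm f' \<and> eqv f f'" unfolding f'_def by (rule someI[of _ f]) (use assms eqv_refl in auto)
  have g': "adm g' \<and> eqv g g'" unfolding g'_def by (rule someI[of _ g]) (use assms eqv_refl in auto)
  assume "cls f = cls g"
  then have "f' = g'" using code_inj f' g' by (simp add: cls_def f'_def g'_def)
  then show "eqv f g" using f' g' assms eqv_sym eqv_trans by blast
next
  assume "eqv f g"
  then have "(\<lambda>g'. adm g' \<and> eqv f g') = (\<lambda>g'. adm g' \<and> eqv g g')"
    using assms eqv_sym eqv_trans by blast
  then show "cls f = cls g" by (simp add: cls_def)
qed

definition rep :: "('f, 'r, 'm) ext \<Rightarrow> ('f, 'r) seqs \<Rightarrow> 'm" where
  "rep x = (SOME g. adm g \<and> cls g = x)"

lemma rep_adm: "adm g \<Longrightarrow> adm (rep (cls g))" and cls_rep: "adm g \<Longrightarrow> cls (rep (cls g)) = cls g"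
proof -
  assume g: "adm g"
  have "adm (rep (cls g)) \<and> cls (rep (cls g)) = cls g" unfolding rep_def by (rule someI[of _ g]) (use g in auto)
  then show "adm (rep (cls g))" "cls (rep (cls g)) = cls g" by auto
qed

lemma rep_eqv: "adm g \<Longrightarrow> alm (\<lambda>j. rep (cls g) j = g j)"
  using cls_eq_iff[of "rep (cls g)" g] rep_adm cls_rep by (simp add: eqv_def)

definition N :: "('f, 'r, ('f, 'r, 'm) ext) fo_struct" where
  "N = \<lparr>univ = cls ` Collect adm,
     ifun = \<lambda>f xs. cls (\<lambda>j. ifun M f (map (\<lambda>x. rep x j) xs)),
     irel = \<lambda>r xs. alm (\<lambda>j. irel M r (map (\<lambda>x. rep x j) xs))\<rparr>"

lemma fin_dep_map:
  assumes "\<And>x. x \<in> set xs \<Longrightarrow> fin_dep (f x)"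
  shows "fin_dep (\<lambda>j. F (map (\<lambda>x. f x j) xs))"
proof -
  obtain n where "\<forall>g\<in>f ` set xs. dep n g" using fin_dep_common[of "f ` set xs"] assms by auto
  then have "dep n (\<lambda>j. map (\<lambda>x. f x j) xs)" unfolding dep_def by auto
  then show ?thesis unfolding fin_dep_def using dep_fun by blast
qed

lemma adm_ifun:
  assumes "f \<in> funs L" "length xs = far L f" "\<And>x. x \<in> set xs \<Longrightarrow> adm (k x)"
  shows "adm (\<lambda>j. ifun M f (map (\<lambda>x. k x j) xs))"
  unfolding adm_def
proof
  show "fin_dep (\<lambda>j. ifun M f (map (\<lambda>x. k x j) xs))"
    using assms(3) by (intro fin_dep_map) (auto simp: adm_def)
  show "range (\<lambda>j. ifun M f (map (\<lambda>x. k x j) xs)) \<subseteq> univ M"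
  proof (intro image_subsetI)
    fix j
    have "set (map (\<lambda>x. k x j) xs) \<subseteq> univ M" using assms(3) by (auto simp: adm_def)
    then show "ifun M f (map (\<lambda>x. k x j) xs) \<in> univ M" using M assms(1,2) unfolding is_struct_def by simp
  qed
qed

lemma alm_rep_map:
  assumes "\<And>x. x \<in> set xs \<Longrightarrow> adm (k x)"
  shows "alm (\<lambda>j. map (\<lambda>x. rep x j) (map (\<lambda>x. cls (k x)) xs) = map (\<lambda>x. k x j) xs)"
proof -
  have fd: "fin_dep (\<lambda>j. rep (cls (k x)) j = k x j)" if "x \<in> set xs" for x
    using assms[OF that] rep_adm[OF assms[OF that]] by (auto simp: adm_def intro: fin_dep_comb)
  have "alm (\<lambda>j. \<forall>x\<in>set xs. rep (cls (k x)) j = k x j)"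
    using alm_ball[of "set xs" "\<lambda>x j. rep (cls (k x)) j = k x j"] fd rep_eqv assms by blast
  then show ?thesis by (simp add: comp_def)
qed

lemma eval_los:
  assumes "wf_trm L t" "\<And>i. adm (v i)"
  shows "adm (\<lambda>j. eval M (\<lambda>i. v i j) t) \<and> eval N (\<lambda>i. cls (v i)) t = cls (\<lambda>j. eval M (\<lambda>i. v i j) t)"
  using assms
proof (induction t)
  case (Fn f ts)
  let ?k = "\<lambda>t j. eval M (\<lambda>i. v i j) t"
  have IH: "adm (?k t)" "eval N (\<lambda>i. cls (v i)) t = cls (?k t)" if "t \<in> set ts" for t
    using Fn that by auto
  have f: "f \<in> funs L" "length ts = far L f" using Fn.prems by auto
  have 1: "adm (\<lambda>j. ifun M f (map (\<lambda>t. ?k t j) ts))" by (rule adm_ifun[OF f]) (rule IH)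
  have map: "map (eval N (\<lambda>i. cls (v i))) ts = map (\<lambda>t. cls (?k t)) ts" using IH by auto
  have 2: "adm (\<lambda>j. ifun M f (map (\<lambda>x. rep x j) (map (\<lambda>t. cls (?k t)) ts)))"
    by (rule adm_ifun) (use f IH rep_adm in auto)
  have "eqv (\<lambda>j. ifun M f (map (\<lambda>x. rep x j) (map (\<lambda>t. cls (?k t)) ts))) (\<lambda>j. ifun M f (map (\<lambda>t. ?k t j) ts))"
    unfolding eqv_def
    by (rule alm_mono[OF alm_rep_map[of ts ?k]])
      (use IH(1) 1 2 in \<open>auto simp: adm_def intro: fin_dep_comb simp del: map_map\<close>)
  then have "cls (\<lambda>j. ifun M f (map (\<lambda>x. rep x j) (map (\<lambda>t. cls (?k t)) ts))) = cls (\<lambda>j. ifun M f (map (\<lambda>t. ?k t j) ts))"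
    using cls_eq_iff[OF 2 1] by blast
  then have "eval N (\<lambda>i. cls (v i)) (Fn f ts) = cls (\<lambda>j. ifun M f (map (\<lambda>t. ?k t j) ts))"
    unfolding eval.simps map by (simp add: N_def del: map_map)
  then show ?case using 1 by simp
qed simp

lemma fin_dep_sat:
  assumes "\<And>i. adm (v i)"
  shows "fin_dep (\<lambda>j. sat M (\<lambda>i. v i j) \<phi>)"
proof -
  obtain n where n: "\<forall>g\<in>v ` fv \<phi>. dep n g" using fin_dep_common[of "v ` fv \<phi>"] assms by (auto simp: adm_def)
  have "dep n (\<lambda>j. sat M (\<lambda>i. v i j) \<phi>)" unfolding dep_def
    by (intro allI impI sat_cong) (use n in \<open>auto simp: dep_def\<close>)
  then show ?thesis unfolding fin_dep_def by blast
qed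

text \<open>The choice is made from \<open>A j\<close> alone, so it depends on no coordinates beyond
  those of \<open>A\<close>. Where there is no solution it still takes a value in the
  universe.\<close>

lemma witness:
  assumes "dep n A"
  shows "\<exists>g. dep n g \<and> range g \<subseteq> univ M \<and> (\<forall>j a. a \<in> univ M \<and> A j a \<longrightarrow> A j (g j))"
proof -
  obtain u where u: "u \<in> univ M" using M unfolding is_struct_def by blast
  define g where "g j = (SOME b. b \<in> univ M \<and> ((\<exists>a\<in>univ M. A j a) \<longrightarrow> A j b))" for j
  have g: "g j \<in> univ M \<and> ((\<exists>a\<in>univ M. A j a) \<longrightarrow> A j (g j))" for j
    unfolding g_def by (rule someI_ex) (use u in blast)
  have "dep n g" unfolding g_def by (rule dep_fun[OF assms])
  then show ?thesis using g by blast
qed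

text \<open>Los's theorem for the limit. In the existential case \<open>witness\<close> picks
  solutions that depend on the coordinates of the finitely many relevant \<open>v i\<close>, so the
  element found is again admissible.\<close>

lemma sat_los:
  assumes "wf_fm L \<phi>" "\<And>i. adm (v i)"
  shows "sat N (\<lambda>i. cls (v i)) \<phi> \<longleftrightarrow> alm (\<lambda>j. sat M (\<lambda>i. v i j) \<phi>)"
  using assms
proof (induction \<phi> arbitrary: v)
  case (Eq s t)
  then show ?case using eval_los[of s v] eval_los[of t v] by (simp add: cls_eq_iff eqv_def)
next
  case (Rel r ts)
  let ?k = "\<lambda>t j. eval M (\<lambda>i. v i j) t"
  have IH: "adm (?k t)" "eval N (\<lambda>i. cls (v i)) t = cls (?k t)" if "t \<in> set ts" for t
    using Rel that eval_los[of t v] by auto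
  have map: "map (eval N (\<lambda>i. cls (v i))) ts = map (\<lambda>t. cls (?k t)) ts" using IH by auto
  have e: "alm (\<lambda>j. map (\<lambda>x. rep x j) (map (\<lambda>t. cls (?k t)) ts) = map (\<lambda>t. ?k t j) ts)" (is "alm ?E")
    by (rule alm_rep_map) (rule IH)
  have fd1: "fin_dep (\<lambda>j. F (map (\<lambda>x. rep x j) (map (\<lambda>t. cls (?k t)) ts)))" for F :: "'m list \<Rightarrow> 'z"
    by (rule fin_dep_map) (use IH(1) rep_adm in \<open>auto simp: adm_def\<close>)
  have fd2: "fin_dep (\<lambda>j. F (map (\<lambda>t. ?k t j) ts))" for F :: "'m list \<Rightarrow> 'z"
    by (rule fin_dep_map) (use IH(1) in \<open>auto simp: adm_def\<close>)
  have fdE: "fin_dep ?E" by (rule fin_dep_comb[OF fd1[of "\<lambda>x. x"] fd2[of "\<lambda>x. x"]])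
  have "alm (\<lambda>j. irel M r (map (\<lambda>x. rep x j) (map (\<lambda>t. cls (?k t)) ts))) \<longleftrightarrow> alm (\<lambda>j. irel M r (map (\<lambda>t. ?k t j) ts))"
  proof
    assume "alm (\<lambda>j. irel M r (map (\<lambda>x. rep x j) (map (\<lambda>t. cls (?k t)) ts)))"
    then have "alm (\<lambda>j. irel M r (map (\<lambda>x. rep x j) (map (\<lambda>t. cls (?k t)) ts)) \<and> ?E j)"
      using e alm_conj[OF fd1 fdE] by blast
    then show "alm (\<lambda>j. irel M r (map (\<lambda>t. ?k t j) ts))" by (rule alm_mono[OF _ fd2]) metis
  next
    assume "alm (\<lambda>j. irel M r (map (\<lambda>t. ?k t j) ts))"
    then have "alm (\<lambda>j. irel M r (map (\<lambda>t. ?k t j) ts) \<and> ?E j)"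
      using e alm_conj[OF fd2 fdE] by blast
    then show "alm (\<lambda>j. irel M r (map (\<lambda>x. rep x j) (map (\<lambda>t. cls (?k t)) ts)))" by (rule alm_mono[OF _ fd1]) metis
  qed
  then show ?case unfolding sat.simps map by (simp add: N_def del: map_map)
next
  case (Neg \<phi>)
  then show ?case using alm_neg[OF fin_dep_sat[of v \<phi>]] by simp
next
  case (Conj \<phi> \<psi>)
  then show ?case using alm_conj[OF fin_dep_sat[of v \<phi>] fin_dep_sat[of v \<psi>]] by simp
next
  case (Ex i \<phi>)
  have upd: "(\<lambda>i. cls (v i))(i := cls g) = (\<lambda>k. cls ((v(i := g)) k))" for g by (rule ext) simp
  have updM: "(\<lambda>k. (v(i := g)) k j) = (\<lambda>k. v k j)(i := g j)" for g j by (rule ext) simp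
  have adm_upd: "adm ((v(i := g)) k)" if "adm g" for g k using that Ex.prems by simp
  have "sat N (\<lambda>i. cls (v i)) (Ex i \<phi>) \<longleftrightarrow> (\<exists>g. adm g \<and> sat N (\<lambda>k. cls ((v(i := g)) k)) \<phi>)"
    unfolding sat.simps upd[symmetric] by (auto simp: N_def)
  also have "\<dots> \<longleftrightarrow> (\<exists>g. adm g \<and> alm (\<lambda>j. sat M ((\<lambda>k. v k j)(i := g j)) \<phi>))"
  proof (rule ex_cong1, rule conj_cong[OF refl])
    fix g assume g: "adm g"
    have "wf_fm L \<phi>" using Ex.prems by simp
    from Ex.IH[OF this adm_upd[OF g]]
    show "sat N (\<lambda>k. cls ((v(i := g)) k)) \<phi> \<longleftrightarrow> alm (\<lambda>j. sat M ((\<lambda>k. v k j)(i := g j)) \<phi>)"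
      by (simp only: updM)
  qed
  also have "\<dots> \<longleftrightarrow> alm (\<lambda>j. sat M (\<lambda>i. v i j) (Ex i \<phi>))"
  proof
    assume "\<exists>g. adm g \<and> alm (\<lambda>j. sat M ((\<lambda>k. v k j)(i := g j)) \<phi>)"
    then obtain g where g: "adm g" "alm (\<lambda>j. sat M ((\<lambda>k. v k j)(i := g j)) \<phi>)" by blast
    have "fin_dep (\<lambda>j. sat M (\<lambda>i. v i j) (Ex i \<phi>))" by (rule fin_dep_sat) (rule Ex.prems)
    from g(2) this show "alm (\<lambda>j. sat M (\<lambda>i. v i j) (Ex i \<phi>))"
      by (rule alm_mono) (use g(1) in \<open>auto simp: adm_def\<close>)
  next
    assume a: "alm (\<lambda>j. sat M (\<lambda>i. v i j) (Ex i \<phi>))"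
    obtain n where n: "\<forall>g\<in>v ` fv \<phi>. dep n g"
      using fin_dep_common[of "v ` fv \<phi>"] Ex.prems by (auto simp: adm_def)
    have "dep n (\<lambda>j a. sat M ((\<lambda>k. v k j)(i := a)) \<phi>)" unfolding dep_def
      by (intro allI impI ext sat_cong) (use n in \<open>auto simp: dep_def\<close>)
    from witness[OF this] obtain g where g: "dep n g" "range g \<subseteq> univ M"
      "\<And>j a. a \<in> univ M \<Longrightarrow> sat M ((\<lambda>k. v k j)(i := a)) \<phi> \<Longrightarrow> sat M ((\<lambda>k. v k j)(i := g j)) \<phi>" by blast
    have ga: "adm g" using g by (auto simp: adm_def fin_dep_def)
    have "fin_dep (\<lambda>j. sat M (\<lambda>k. (v(i := g)) k j) \<phi>)" by (rule fin_dep_sat) (rule adm_upd[OF ga])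
    then have "fin_dep (\<lambda>j. sat M ((\<lambda>k. v k j)(i := g j)) \<phi>)" by (simp only: updM)
    with a have "alm (\<lambda>j. sat M ((\<lambda>k. v k j)(i := g j)) \<phi>)"
      by (rule alm_mono) (use g(3) in auto)
    then show "\<exists>g. adm g \<and> alm (\<lambda>j. sat M ((\<lambda>k. v k j)(i := g j)) \<phi>)" using ga by blast
  qed
  finally show ?case .
qed

lemma sat_los_list:
  assumes "\<phi> \<in> forms L (length gs)" "\<And>g. g \<in> set gs \<Longrightarrow> adm g"
  shows "sat N (nth (map cls gs)) \<phi> \<longleftrightarrow> alm (\<lambda>j. sat M (nth (map (\<lambda>g. g j) gs)) \<phi>)"
proof -
  obtain u where u: "u \<in> univ M" using M unfolding is_struct_def by blast
  \<comment> \<open>Positions beyond the list receive a constant function, so that every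
    \<open>v i\<close> is admissible as \<open>sat_los\<close> requires.\<close>
  define v where "v i = (if i < length gs then gs ! i else (\<lambda>_. u))" for i
  have v: "adm (v i)" for i using assms(2) u by (auto simp: v_def adm_def fin_dep_const)
  have fv: "i < length gs" if "i \<in> fv \<phi>" for i using assms(1) that by (auto simp: forms_def)
  have "sat N (nth (map cls gs)) \<phi> = sat N (\<lambda>i. cls (v i)) \<phi>"
    by (rule sat_cong) (simp add: v_def fv)
  moreover have "sat M (nth (map (\<lambda>g. g j) gs)) \<phi> = sat M (\<lambda>i. v i j) \<phi>" for j
    by (rule sat_cong) (simp add: v_def fv)
  ultimately show ?thesis using sat_los[OF _ v, of \<phi>] assms(1) by (simp add: forms_def)
qed

lemma N_struct: "is_struct L N"
  unfolding is_struct_def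
proof (intro conjI ballI allI impI)
  obtain u where u: "u \<in> univ M" using M unfolding is_struct_def by blast
  then have "adm (\<lambda>_. u)" by (auto simp: adm_def fin_dep_const)
  then show "univ N \<noteq> {}" by (auto simp: N_def)
  fix f xs assume f: "f \<in> funs L" "length xs = far L f \<and> set xs \<subseteq> univ N"
  then have "adm (\<lambda>j. ifun M f (map (\<lambda>x. rep x j) xs))"
    using rep_adm by (intro adm_ifun) (auto simp: N_def)
  then show "ifun N f xs \<in> univ N" by (auto simp: N_def)
qed

lemma N_elem: "elem_emb L M N (\<lambda>a. cls (\<lambda>_. a))"
  unfolding elem_emb_def
proof (intro conjI allI impI)
  have adm: "adm (\<lambda>_. a)" if "a \<in> univ M" for a using that by (auto simp: adm_def fin_dep_const)
  then show "(\<lambda>a. cls (\<lambda>_. a)) ` univ M \<subseteq> univ N" by (auto simp: N_def)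
  fix as \<phi> assume *: "set as \<subseteq> univ M \<and> \<phi> \<in> forms L (length as)"
  have "sat N (nth (map cls (map (\<lambda>a _. a) as))) \<phi> \<longleftrightarrow>
      alm (\<lambda>j. sat M (nth (map (\<lambda>g. g j) (map (\<lambda>a _. a) as))) \<phi>)"
    by (rule sat_los_list) (use * adm in auto)
  then show "sat M (nth as) \<phi> \<longleftrightarrow> sat N (nth (map (\<lambda>a. cls (\<lambda>_. a)) as)) \<phi>"
    by (simp add: comp_def alm_const)
qed

text \<open>Finitely many parameters depend on finitely many coordinates, so the next coordinate is
  free. At an index \<open>\<Delta>\<close> of that coordinate the sought element solves the finite
  part of the type listed in \<open>\<Delta>\<close>, if this is possible.\<close>

lemma N_saturated: "omega_saturated L N"
  unfolding omega_saturated_def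
proof (intro allI impI, elim conjE)
  fix ps \<Gamma>
  assume ps: "set ps \<subseteq> univ N" and \<Gamma>: "\<Gamma> \<subseteq> forms L (Suc (length ps))"
    and fs: "\<forall>\<Delta>\<subseteq>\<Gamma>. finite \<Delta> \<longrightarrow> (\<exists>a\<in>univ N. \<forall>\<phi>\<in>\<Delta>. sat N (nth (a # ps)) \<phi>)"
  define gs where "gs = map rep ps"
  have gs: "adm g" if "g \<in> set gs" for g using that ps rep_adm by (auto simp: gs_def N_def)
  have "cls (rep x) = x" if x: "x \<in> set ps" for x
  proof -
    obtain g where "adm g" "x = cls g" using x ps by (auto simp: N_def)
    then show ?thesis by (simp add: cls_rep)
  qed
  then have psgs: "ps = map cls gs" by (simp add: gs_def map_idI)
  obtain n where n: "\<forall>g\<in>set gs. dep n g" using fin_dep_common[of "set gs"] gs by (auto simp: adm_def)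
  have los: "sat N (nth (cls g # ps)) \<phi> \<longleftrightarrow> alm (\<lambda>j. sat M (nth (g j # map (\<lambda>g. g j) gs)) \<phi>)"
    if "adm g" "\<phi> \<in> \<Gamma>" for g \<phi>
    using sat_los_list[of \<phi> "g # gs"] that \<Gamma> gs by (auto simp: psgs)
  have map_gs: "map (\<lambda>g. g (j(n := x))) gs = map (\<lambda>g. g j) gs" for j x
    using n by (intro map_cong refl dep_upd) blast
  have dep_gs: "dep n (\<lambda>j. map (\<lambda>g. g j) gs)" using n unfolding dep_def by auto
  let ?A = "\<lambda>\<Delta> j a. \<forall>\<phi>\<in>set \<Delta> \<inter> \<Gamma>. sat M (nth (a # map (\<lambda>g. g j) gs)) \<phi>"
  \<comment> \<open>Coordinate \<open>n\<close>, on which the parameters do not depend, carries the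
    finite list to be realized; the element lives at stage \<open>Suc n\<close>.\<close>
  have "dep (Suc n) (\<lambda>j. ?A (j n) j)" unfolding dep_def
  proof (intro allI impI)
    fix j j' :: "('f, 'r) seqs" assume jj: "\<forall>i<Suc n. j i = j' i"
    then have "map (\<lambda>g. g j) gs = map (\<lambda>g. g j') gs" using dep_gs unfolding dep_def by auto
    moreover have "j n = j' n" using jj by simp
    ultimately show "?A (j n) j = ?A (j' n) j'" by (simp only:)
  qed
  from witness[OF this] obtain g where g: "dep (Suc n) g" "range g \<subseteq> univ M"
    and g3: "\<forall>j a. a \<in> univ M \<and> ?A (j n) j a \<longrightarrow> ?A (j n) j (g j)"
    by (elim exE conjE)
  have ga: "adm g" using g by (auto simp: adm_def fin_dep_def)
  have "sat N (nth (cls g # ps)) \<phi>" if \<phi>: "\<phi> \<in> \<Gamma>" for \<phi>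
  proof -
    let ?B = "\<lambda>j. sat M (nth (g j # map (\<lambda>g. g j) gs)) \<phi>"
    \<comment> \<open>Finite satisfiability in \<open>N\<close> yields, by Los's theorem, a solution
      in \<open>M\<close> of the part of the type in \<open>\<Delta>\<close> for almost all values
      of the earlier coordinates; there \<open>g\<close> solves it too.\<close>
    have "quantW n (\<lambda>j. ?B (j(n := \<Delta>)))" if \<Delta>: "\<phi> \<in> set \<Delta>" for \<Delta>
    proof -
      obtain a where a: "a \<in> univ N" "\<forall>\<psi>\<in>set \<Delta> \<inter> \<Gamma>. sat N (nth (a # ps)) \<psi>"
        using fs[rule_format, of "set \<Delta> \<inter> \<Gamma>"] by auto
      then obtain k where k: "adm k" "a = cls k" by (auto simp: N_def)
      have "alm (\<lambda>j. sat M (nth (k j # map (\<lambda>g. g j) gs)) \<psi>)" if "\<psi> \<in> set \<Delta> \<inter> \<Gamma>" for \<psi>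
        using a(2) k that los by blast
      moreover have "fin_dep (\<lambda>j. sat M (nth (k j # map (\<lambda>g. g j) gs)) \<psi>)" for \<psi>
        by (rule fin_dep_comb[of k "\<lambda>j. map (\<lambda>g. g j) gs" "\<lambda>a b. sat M (nth (a # b)) \<psi>"])
          (use k dep_gs in \<open>auto simp: adm_def fin_dep_def\<close>)
      ultimately have *: "alm (\<lambda>j. ?A \<Delta> j (k j))"
        using alm_ball[of "set \<Delta> \<inter> \<Gamma>" "\<lambda>\<psi> j. sat M (nth (k j # map (\<lambda>g. g j) gs)) \<psi>"] by blast
      have dE: "dep n (\<lambda>j. \<exists>a\<in>univ M. ?A \<Delta> j a)"
        using dep_fun[OF dep_gs, of "\<lambda>l. \<exists>a\<in>univ M. \<forall>\<phi>\<in>set \<Delta> \<inter> \<Gamma>. sat M (nth (a # l)) \<phi>"] .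
      have "alm (\<lambda>j. \<exists>a\<in>univ M. ?A \<Delta> j a)"
      proof (rule alm_mono[OF *])
        show "fin_dep (\<lambda>j. \<exists>a\<in>univ M. ?A \<Delta> j a)" unfolding fin_dep_def using dE by blast
        have "k j \<in> univ M" for j using k by (auto simp: adm_def)
        then show "\<exists>a\<in>univ M. ?A \<Delta> j a" if "?A \<Delta> j (k j)" for j using that by blast
      qed
      then have "quantW n (\<lambda>j. \<exists>a\<in>univ M. ?A \<Delta> j a)" using alm_iff[OF dE] by simp
      then show ?thesis
      proof (rule quant_mono)
        fix j assume "\<exists>a\<in>univ M. ?A \<Delta> j a"
        then obtain a where "a \<in> univ M" "?A \<Delta> (j(n := \<Delta>)) a" unfolding map_gs by blast
        then have "?A \<Delta> (j(n := \<Delta>)) (g (j(n := \<Delta>)))"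
          using mp[OF g3[THEN spec, THEN spec, of a "j(n := \<Delta>)"]] by (simp only: fun_upd_same simp_thms)
        then show "?B (j(n := \<Delta>))" using \<Delta> \<phi> by blast
      qed
    qed
    \<comment> \<open>The lists that contain \<open>\<phi>\<close> form a set of the ultrafilter, so
      the remaining indices do not matter.\<close>
    then have "quantW (Suc n) ?B" unfolding quant.simps
      by (intro W_mono[OF W_cofinal[of \<phi>]]) blast
    moreover have "dep (Suc n) ?B" unfolding dep_def
    proof (intro allI impI)
      fix j j' :: "('f, 'r) seqs" assume jj: "\<forall>i<Suc n. j i = j' i"
      then have "map (\<lambda>g. g j) gs = map (\<lambda>g. g j') gs" using dep_gs unfolding dep_def by auto
      moreover have "g j = g j'" using g(1) jj unfolding dep_def by blast
      ultimately show "?B j = ?B j'" by (simp only:)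
    qed
    ultimately have "alm ?B" by (simp only: alm_iff)
    then show ?thesis using los[OF ga \<phi>] by blast
  qed
  moreover have "cls g \<in> univ N" using ga by (simp add: N_def)
  ultimately show "\<exists>a\<in>univ N. \<forall>\<phi>\<in>\<Gamma>. sat N (nth (a # ps)) \<phi>" by blast
qed

end

theorem saturated_extension_exists:
  fixes L :: "('f, 'r) lang" and M :: "('f, 'r, 'm) fo_struct"
  assumes "is_struct L M"
  shows "\<exists>(N :: ('f, 'r, ('f, 'r, 'm) ext) fo_struct) h. is_struct L N \<and> omega_saturated L N \<and> elem_emb L M N h"
proof -
  let ?B = "range (\<lambda>\<phi> :: ('f, 'r) fm. {\<Delta>. \<phi> \<in> set \<Delta>})"
  have "\<Inter>S \<noteq> {}" if S: "finite S" "S \<subseteq> ?B" for S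
  proof -
    obtain F where "finite F" "S = (\<lambda>\<phi>. {\<Delta>. \<phi> \<in> set \<Delta>}) ` F"
      using finite_subset_image[OF S] by blast
    moreover obtain \<Delta> where "set \<Delta> = F" using \<open>finite F\<close> finite_list by blast
    ultimately have "\<Delta> \<in> \<Inter>S" by auto
    then show ?thesis by blast
  qed
  from ultra_exists[OF this] obtain W where W: "?B \<subseteq> W" "ultra W" by blast
  interpret limit_ultrapower W L M
    by unfold_locales (use W assms in auto)
  show ?thesis using N_struct N_saturated N_elem by blast
qed

section \<open>Closure properties of fiberability in a fixed structure\<close>

context fo_structure
begin

lemma dmap_id: "definable L M m X \<Longrightarrow> dmap m X m X (\<lambda>x. x)"
proof (rule dmapI)
  assume X: "definable L M m X"
  show "D (m + m) (\<lambda>z. take m z \<in> X \<and> take m z = drop m z)"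
    by (rule D_conj D_set[OF X] D_eq select_intros | simp)+
qed auto

lemma dmap_if:
  assumes "dmap m X n Z f" "dmap m Y n Z g"
  shows "dmap m (X \<union> Y) n Z (\<lambda>x. if x \<in> X then f x else g x)"
proof (rule dmapI)
  have X: "definable L M m X" and Y: "definable L M m Y" using assms by (auto dest: dmap_dom)
  show "definable L M m (X \<union> Y)" using X Y by (rule definable_Un)
  have "D (m + n) (\<lambda>z. (take m z \<in> X \<and> f (take m z) = drop m z) \<or>
      (\<not> take m z \<in> X \<and> (take m z \<in> Y \<and> g (take m z) = drop m z)))"
    by (rule D_map[OF assms(1)] D_map[OF assms(2)] D_conj D_disj D_neg D_set[OF X] select_intros | simp)+
  then show "D (m + n) (\<lambda>z. take m z \<in> X \<union> Y \<and> (if take m z \<in> X then f (take m z) else g (take m z)) = drop m z)"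
    by (rule D_cong) auto
qed (use assms in \<open>auto simp: dmap_def\<close>)

lemma dmap_prod:
  assumes "dmap m X n X' f" "dmap l Y k Y' g"
  shows "dmap (m + l) (tprod X Y) (n + k) (tprod X' Y') (\<lambda>z. f (take m z) @ g (drop m z))"
proof (rule dmapI)
  have X: "definable L M m X" "definable L M n X'" and Y: "definable L M l Y" "definable L M k Y'"
    using assms by (auto dest: dmap_dom dmap_cod)
  show "definable L M (m + l) (tprod X Y)" "definable L M (n + k) (tprod X' Y')"
    using X Y by (auto intro: definable_tprod)
  note tX = tprod_iff[OF definable_sub[OF X(1)]] and tX' = tprod_iff[OF definable_sub[OF X(2)]]
  have flen: "length (f x) = n" if "x \<in> X" for x
    using definable_in[OF X(2) dmap_maps[OF assms(1) that]] by (rule pow_length)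
  show "(\<lambda>z. f (take m z) @ g (drop m z)) ` tprod X Y \<subseteq> tprod X' Y'"
    using dmap_maps[OF assms(1)] dmap_maps[OF assms(2)] flen by (auto simp: tX tX')
  have "D (m + l + (n + k)) (\<lambda>z. (take m (take (m + l) z) \<in> X \<and> f (take m (take (m + l) z)) = take n (drop (m + l) z)) \<and>
      (drop m (take (m + l) z) \<in> Y \<and> g (drop m (take (m + l) z)) = drop n (drop (m + l) z)))"
    by (rule D_conj[OF D_map[OF assms(1)] D_map[OF assms(2)]] select_intros | simp del: take_take drop_drop)+
  then show "D (m + l + (n + k)) (\<lambda>z. take (m + l) z \<in> tprod X Y \<and>
      f (take m (take (m + l) z)) @ g (drop m (take (m + l) z)) = drop (m + l) z)"
  proof (rule D_cong)
    fix z :: "'m list"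
    let ?x = "take m (take (m + l) z)" and ?y = "drop m (take (m + l) z)" and ?w = "drop (m + l) z"
    have "?x \<in> X \<Longrightarrow> (f ?x @ g ?y = ?w) \<longleftrightarrow> f ?x = take n ?w \<and> g ?y = drop n ?w"
      using flen[of ?x] by (metis append_eq_conv_conj)
    then show "((?x \<in> X \<and> f ?x = take n ?w) \<and> (?y \<in> Y \<and> g ?y = drop n ?w)) =
        (take (m + l) z \<in> tprod X Y \<and> f ?x @ g ?y = ?w)"
      unfolding tX by blast
  qed
qed

lemma tprod_pow: "tprod (pow U m) (pow U n) = pow U (m + n)"
proof
  show "tprod (pow U m) (pow U n) \<subseteq> pow U (m + n)" by (rule tprod_sub) auto
  show "pow U (m + n) \<subseteq> tprod (pow U m) (pow U n)"
    by (auto simp: tprod_iff[OF order_refl] dest: pow_take pow_drop)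
qed

lemma fib_definable: "fib_sat L M C r m X \<Longrightarrow> definable L M m X"
  by (cases r) auto

lemma fib_0_iff:
  "fib_sat L M C 0 m X \<longleftrightarrow> (\<exists>n f. dmap m X n (pow U n) f \<and> inj_on f X \<and> f ` X \<subseteq> pow C n)"
  by (cases "definable L M m X") (auto simp: dmap_iff definable_pow dest: dmap_dom)

lemma fib_Suc_iff:
  "fib_sat L M C (Suc r) m X \<longleftrightarrow> (\<exists>n f. dmap m X n (pow U n) f \<and>
     fib_sat L M C r n (f ` X) \<and> (\<forall>y\<in>pow U n. fib_sat L M C r m (fiber X f y)))"
  by (cases "definable L M m X") (auto simp: dmap_iff definable_pow dest: dmap_dom)

declare fib_sat.simps [simp del]

lemma fib_sub:
  assumes "fib_sat L M C r m X" "definable L M m Y" "Y \<subseteq> X"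
  shows "fib_sat L M C r m Y"
  using assms
proof (induction r arbitrary: m X Y)
  case 0
  then obtain n f where f: "dmap m X n (pow U n) f" "inj_on f X" "f ` X \<subseteq> pow C n"
    unfolding fib_0_iff by blast
  have "dmap m Y n (pow U n) f"
    by (rule dmap_restrict[OF f(1) 0(2,3) definable_pow]) (use dmap_maps[OF f(1)] 0(3) in auto)
  moreover have "inj_on f Y" using f(2) 0(3) by (rule inj_on_subset)
  ultimately show ?case using f(3) 0(3) unfolding fib_0_iff by blast
next
  case (Suc r)
  then obtain n f where f: "dmap m X n (pow U n) f" "fib_sat L M C r n (f ` X)"
    "\<And>y. y\<in>pow U n \<Longrightarrow> fib_sat L M C r m (fiber X f y)"
    unfolding fib_Suc_iff by blast
  have fY: "dmap m Y n (pow U n) f"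
    by (rule dmap_restrict[OF f(1) Suc.prems(2,3) definable_pow]) (use dmap_maps[OF f(1)] Suc.prems(3) in auto)
  moreover have "fib_sat L M C r n (f ` Y)"
    by (rule Suc.IH[OF f(2) definable_image[OF fY]]) (use Suc.prems(3) in auto)
  moreover have "fib_sat L M C r m (fiber Y f y)" if "y \<in> pow U n" for y
    by (rule Suc.IH[OF f(3)[OF that] definable_fiber[OF fY]]) (use Suc.prems(3) in \<open>auto simp: fiber_def\<close>)
  ultimately show ?case unfolding fib_Suc_iff by blast
qed

lemma fib_subsingleton:
  assumes "definable L M m X" "\<And>x y. x \<in> X \<Longrightarrow> y \<in> X \<Longrightarrow> x = y"
  shows "fib_sat L M C r m X"
  using assms
proof (induction r arbitrary: m X)
  case 0
  then have "dmap m X 0 (pow U 0) (\<lambda>_. [])" by (intro dmap_const definable_pow) auto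
  moreover have "inj_on (\<lambda>_. []) X" using 0(2) by (auto intro: inj_onI)
  moreover have "(\<lambda>_. []) ` X \<subseteq> pow C 0" by auto
  ultimately show ?case unfolding fib_0_iff by blast
next
  case (Suc r)
  have d: "dmap m X 0 (pow U 0) (\<lambda>_. [])" using Suc by (intro dmap_const definable_pow) auto
  moreover have "fib_sat L M C r 0 ((\<lambda>_. []) ` X)" by (rule Suc.IH[OF definable_image[OF d]]) auto
  moreover have "fib_sat L M C r m (fiber X (\<lambda>_. []) y)" for y
    by (rule Suc.IH[OF definable_fiber[OF d]]) (use Suc.prems(2) in \<open>auto simp: fiber_def\<close>)
  ultimately show ?case unfolding fib_Suc_iff by blast
qed

text \<open>The map to a point has a point as image and \<open>X\<close> as its only nonempty
  fiber.\<close>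

lemma fib_Suc:
  assumes "fib_sat L M C r m X"
  shows "fib_sat L M C (Suc r) m X"
proof -
  have d: "dmap m X 0 (pow U 0) (\<lambda>_. [])"
    using fib_definable[OF assms] by (intro dmap_const definable_pow) auto
  moreover have "fib_sat L M C r 0 ((\<lambda>_. []) ` X)"
    by (rule fib_subsingleton[OF definable_image[OF d]]) auto
  moreover have "fib_sat L M C r m (fiber X (\<lambda>_. []) y)" for y
    by (rule fib_sub[OF assms definable_fiber[OF d]]) (auto simp: fiber_def)
  ultimately show ?thesis unfolding fib_Suc_iff by blast
qed

lemma fib_mono: "fib_sat L M C r m X \<Longrightarrow> r \<le> s \<Longrightarrow> fib_sat L M C s m X"
  by (induction s) (auto simp: le_Suc_eq intro: fib_Suc)

lemma fib_pow:
  assumes "definable L M n X" "X \<subseteq> pow C n"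
  shows "fib_sat L M C r n X"
proof -
  have "dmap n X n (pow U n) (\<lambda>x. x)"
    by (rule dmap_comp[OF dmap_id[OF assms(1)], of n "pow U n" "\<lambda>x. x"])
      (use assms(1) definable_in in \<open>auto intro!: dmap_restrict[OF dmap_id[OF definable_pow]] simp: definable_pow\<close>)
  then have "fib_sat L M C 0 n X" unfolding fib_0_iff using assms(2) by (intro exI[of _ n] exI[of _ "\<lambda>x. x"]) auto
  then show ?thesis by (rule fib_mono) simp
qed

text \<open>The product of the two maps has its image and fibers inside products of images and of
  fibers, so no step is added.\<close>

lemma fib_tprod:
  assumes "fib_sat L M C r m X" "fib_sat L M C r l Y"
  shows "fib_sat L M C r (m + l) (tprod X Y)"
  using assms
proof (induction r arbitrary: m X l Y)
  case 0
  obtain n f where f: "dmap m X n (pow U n) f" "inj_on f X" "f ` X \<subseteq> pow C n"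
    using 0(1) unfolding fib_0_iff by blast
  obtain k g where g: "dmap l Y k (pow U k) g" "inj_on g Y" "g ` Y \<subseteq> pow C k"
    using 0(2) unfolding fib_0_iff by blast
  note X = definable_sub[OF dmap_dom[OF f(1)]]
  let ?h = "\<lambda>z. f (take m z) @ g (drop m z)"
  have flen: "length (f x) = n" if "x \<in> X" for x using dmap_maps[OF f(1) that] by (rule pow_length)
  have "dmap (m + l) (tprod X Y) (n + k) (pow U (n + k)) ?h"
    using dmap_prod[OF f(1) g(1)] by (simp add: tprod_pow)
  moreover have "inj_on ?h (tprod X Y)"
  proof (rule inj_onI)
    fix z w assume *: "z \<in> tprod X Y" "w \<in> tprod X Y" "?h z = ?h w"
    then have "f (take m z) = f (take m w)" "g (drop m z) = g (drop m w)"
      using flen unfolding tprod_iff[OF X] by (metis append_eq_append_conv)+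
    then have "take m z = take m w" "drop m z = drop m w"
      using * f(2) g(2) unfolding tprod_iff[OF X] inj_on_def by blast+
    then show "z = w" by (metis append_take_drop_id)
  qed
  moreover have "?h ` tprod X Y \<subseteq> pow C (n + k)"
    using f(3) g(3) by (auto simp: tprod_iff[OF X] intro!: pow_append)
  ultimately show ?case unfolding fib_0_iff by (intro exI conjI)
next
  case (Suc r)
  obtain n f where f: "dmap m X n (pow U n) f" "fib_sat L M C r n (f ` X)"
    "\<And>y. y\<in>pow U n \<Longrightarrow> fib_sat L M C r m (fiber X f y)"
    using Suc.prems(1) unfolding fib_Suc_iff by blast
  obtain k g where g: "dmap l Y k (pow U k) g" "fib_sat L M C r k (g ` Y)"
    "\<And>y. y\<in>pow U k \<Longrightarrow> fib_sat L M C r l (fiber Y g y)"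
    using Suc.prems(2) unfolding fib_Suc_iff by blast
  note X = definable_sub[OF dmap_dom[OF f(1)]]
  let ?h = "\<lambda>z. f (take m z) @ g (drop m z)"
  have flen: "length (f x) = n" if "x \<in> X" for x using dmap_maps[OF f(1) that] by (rule pow_length)
  have h: "dmap (m + l) (tprod X Y) (n + k) (pow U (n + k)) ?h"
    using dmap_prod[OF f(1) g(1)] by (simp add: tprod_pow)
  moreover have "fib_sat L M C r (n + k) (?h ` tprod X Y)"
    by (rule fib_sub[OF Suc.IH[OF f(2) g(2)] definable_image[OF h]])
      (use tprod_iff[OF X] in \<open>fastforce simp: tprod_def[of "f ` X"]\<close>)
  moreover have "fib_sat L M C r (m + l) (fiber (tprod X Y) ?h y)" if "y \<in> pow U (n + k)" for y
  proof (rule fib_sub[OF Suc.IH[OF f(3)[OF pow_take[OF that]] g(3)[OF pow_drop[OF that]]] definable_fiber[OF h]])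
    show "fiber (tprod X Y) ?h y \<subseteq> tprod (fiber X f (take n y)) (fiber Y g (drop n y))"
    proof
      fix z assume "z \<in> fiber (tprod X Y) ?h y"
      then have z: "take m z \<in> X" "drop m z \<in> Y" "?h z = y" by (auto simp: fiber_def tprod_iff[OF X])
      have "fiber X f (take n y) \<subseteq> pow U m" using X by (auto simp: fiber_def)
      moreover have "take n y = f (take m z)" "drop n y = g (drop m z)" using z flen[OF z(1)] by auto
      ultimately show "z \<in> tprod (fiber X f (take n y)) (fiber Y g (drop n y))"
        using z by (simp add: tprod_iff) (simp add: fiber_def)
    qed
  qed
  ultimately show ?case unfolding fib_Suc_iff by blast
qed

text \<open>The place where \<open>C\<close> must have two points: they separate \<open>X\<close>
  from the rest of \<open>Y\<close>, at the cost of one step.\<close>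

lemma fib_Un:
  assumes "fib_sat L M C r m X" "fib_sat L M C r m Y" "C \<subseteq> U" "D 1 (\<lambda>z. z \<in> pow C 1)"
    and c: "c \<in> C" "d \<in> C" "c \<noteq> d"
  shows "fib_sat L M C (Suc r) m (X \<union> Y)"
proof -
  let ?f = "\<lambda>x. if x \<in> X then [c] else [d]"
  have cd: "[c] \<in> pow C 1" "[d] \<in> pow C 1" "pow C 1 \<subseteq> pow U 1"
    using c assms(3) by (auto simp: pow_def)
  have f: "dmap m (X \<union> Y) 1 (pow U 1) ?f"
    using assms(1,2) cd by (intro dmap_if dmap_const definable_pow) (auto dest: fib_definable)
  moreover have "fib_sat L M C r 1 (?f ` (X \<union> Y))"
    by (rule fib_pow[OF definable_image[OF f]]) (use cd in auto)
  moreover have "fib_sat L M C r m (fiber (X \<union> Y) ?f y)" for y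
  proof (cases "y = [c]")
    case True
    then show ?thesis
      by (intro fib_sub[OF assms(1) definable_fiber[OF f]]) (use c in \<open>auto simp: fiber_def split: if_splits\<close>)
  next
    case False
    then show ?thesis
      by (intro fib_sub[OF assms(2) definable_fiber[OF f]]) (auto simp: fiber_def split: if_splits)
  qed
  ultimately show ?thesis unfolding fib_Suc_iff by blast
qed

end

section \<open>Uniformity of fiberability in saturated structures\<close>

text \<open>Unlike in \<open>solset\<close>, the parameters come first, which fits families indexed
  by the leading coordinates.\<close>

definition fsol :: "('f, 'r, 'm) fo_struct \<Rightarrow> nat \<Rightarrow> ('f, 'r) fm \<Rightarrow> 'm list \<Rightarrow> 'm list set" where
  "fsol M m \<rho> p = {x \<in> pow (univ M) m. sat M (nth (p @ x)) \<rho>}"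

definition graph_of :: "('f, 'r, 'm) fo_struct \<Rightarrow> ('f, 'r) fm \<Rightarrow> 'm list \<Rightarrow> 'm list \<Rightarrow> 'm list \<Rightarrow> bool" where
  "graph_of M \<gamma> u x y \<longleftrightarrow> sat M (nth (u @ x @ y)) \<gamma>"

definition functional_on :: "('f, 'r, 'm) fo_struct \<Rightarrow> nat \<Rightarrow> 'm list set \<Rightarrow> ('m list \<Rightarrow> 'm list \<Rightarrow> bool) \<Rightarrow> bool" where
  "functional_on M n X G \<longleftrightarrow> (\<forall>x\<in>X. \<exists>y\<in>pow (univ M) n. G x y \<and> (\<forall>y'\<in>pow (univ M) n. G x y' \<longrightarrow> y' = y))"

definition inj_into :: "('f, 'r, 'm) fo_struct \<Rightarrow> 'm set \<Rightarrow> nat \<Rightarrow> 'm list set \<Rightarrow> ('m list \<Rightarrow> 'm list \<Rightarrow> bool) \<Rightarrow> bool" where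
  "inj_into M C n X G \<longleftrightarrow> (\<forall>x\<in>X. \<forall>y\<in>pow (univ M) n. G x y \<longrightarrow> y \<in> pow C n \<and> (\<forall>x'\<in>X. G x' y \<longrightarrow> x' = x))"

text \<open>That a formula defines the graph of a map is itself a first-order condition on its
  parameters, so it can be made part of a formula and be moved between the structures.\<close>

lemma functional_on_tr:
  assumes \<rho>: "\<rho> \<in> forms L (k + m)" and \<gamma>: "\<gamma> \<in> forms L (k + j + (m + n))"
  shows "tr L M N h {} (k + j) (\<lambda>u. functional_on M n (fsol M m \<rho> (take k u)) (graph_of M \<gamma> u))
    (\<lambda>u. functional_on N n (fsol N m \<rho> (take k u)) (graph_of N \<gamma> u))"
proof -
  have "tr L M N h {} (k + j)
    (\<lambda>u. \<forall>x\<in>pow (univ M) m. sat M (nth (take k u @ x)) \<rho> \<longrightarrow>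
     (\<exists>y\<in>pow (univ M) n. sat M (nth (u @ x @ y)) \<gamma> \<and> (\<forall>y'\<in>pow (univ M) n. sat M (nth (u @ x @ y')) \<gamma> \<longrightarrow> y' = y)))
    (\<lambda>u. \<forall>x\<in>pow (univ N) m. sat N (nth (take k u @ x)) \<rho> \<longrightarrow>
     (\<exists>y\<in>pow (univ N) n. sat N (nth (u @ x @ y)) \<gamma> \<and> (\<forall>y'\<in>pow (univ N) n. sat N (nth (u @ x @ y')) \<gamma> \<longrightarrow> y' = y)))"
    by (rule tr_sub0[OF \<rho>] tr_sub0[OF \<gamma>] tr_eq tr_logic sel_intros | simp del: take_take drop_drop)+
  then show ?thesis by (rule tr_cong) (auto simp: functional_on_def fsol_def graph_of_def)
qed

lemma inj_into_tr:
  assumes \<rho>: "\<rho> \<in> forms L (k + m)" and \<gamma>: "\<gamma> \<in> forms L (k + j + (m + n))"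
    and C: "tr L M N h {} 1 (\<lambda>z. z \<in> pow C 1) (\<lambda>z. z \<in> pow C' 1)"
  shows "tr L M N h {} (k + j) (\<lambda>u. inj_into M C n (fsol M m \<rho> (take k u)) (graph_of M \<gamma> u))
    (\<lambda>u. inj_into N C' n (fsol N m \<rho> (take k u)) (graph_of N \<gamma> u))"
proof -
  have C': "tr L M N h {} l (\<lambda>z. t z \<in> pow C n) (\<lambda>z. t' z \<in> pow C' n)" if "sel h {} l i t t'" "i = n" for l i t t'
    using tr_pow[OF C that(1) refl] that(2) by simp
  have "tr L M N h {} (k + j)
    (\<lambda>u. \<forall>x\<in>pow (univ M) m. sat M (nth (take k u @ x)) \<rho> \<longrightarrow> (\<forall>y\<in>pow (univ M) n. sat M (nth (u @ x @ y)) \<gamma> \<longrightarrow>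
      y \<in> pow C n \<and> (\<forall>x'\<in>pow (univ M) m. sat M (nth (take k u @ x')) \<rho> \<longrightarrow> sat M (nth (u @ x' @ y)) \<gamma> \<longrightarrow> x' = x)))
    (\<lambda>u. \<forall>x\<in>pow (univ N) m. sat N (nth (take k u @ x)) \<rho> \<longrightarrow> (\<forall>y\<in>pow (univ N) n. sat N (nth (u @ x @ y)) \<gamma> \<longrightarrow>
      y \<in> pow C' n \<and> (\<forall>x'\<in>pow (univ N) m. sat N (nth (take k u @ x')) \<rho> \<longrightarrow> sat N (nth (u @ x' @ y)) \<gamma> \<longrightarrow> x' = x)))"
    by (rule tr_sub0[OF \<rho>] tr_sub0[OF \<gamma>] C' tr_eq tr_logic sel_intros | simp del: take_take drop_drop)+
  then show ?thesis by (rule tr_cong) (auto simp: inj_into_def fsol_def graph_of_def)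
qed

text \<open>One formula serves both structures, so a statement on images obtained in
  \<open>N\<close> can be read for the corresponding images in \<open>M\<close>. The same holds for
  the fibers in \<open>fiber_formula\<close>.\<close>

lemma image_formula:
  fixes M :: "('f, 'r, 'm) fo_struct" and N :: "('f, 'r, 'n) fo_struct"
  assumes \<rho>: "\<rho> \<in> forms L (k + m)" and \<gamma>: "\<gamma> \<in> forms L (k + j + (m + n))"
  obtains \<iota> where "\<iota> \<in> forms L (k + j + n)"
    "\<And>u. u \<in> pow (univ M) (k + j) \<Longrightarrow> fsol M n \<iota> u = {y \<in> pow (univ M) n. \<exists>x\<in>fsol M m \<rho> (take k u). graph_of M \<gamma> u x y}"
    "\<And>u. u \<in> pow (univ N) (k + j) \<Longrightarrow> fsol N n \<iota> u = {y \<in> pow (univ N) n. \<exists>x\<in>fsol N m \<rho> (take k u). graph_of N \<gamma> u x y}"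
proof -
  \<comment> \<open>No embedding is given here; with parameters from \<open>{}\<close> any map
    serves.\<close>
  have "tr L M N undefined {} (k + j + n)
    (\<lambda>z. \<exists>x\<in>pow (univ M) m. sat M (nth (take k (take (k + j) z) @ x)) \<rho> \<and> sat M (nth (take (k + j) z @ x @ drop (k + j) z)) \<gamma>)
    (\<lambda>z. \<exists>x\<in>pow (univ N) m. sat N (nth (take k (take (k + j) z) @ x)) \<rho> \<and> sat N (nth (take (k + j) z @ x @ drop (k + j) z)) \<gamma>)"
    by (rule tr_sub0[OF \<rho>] tr_sub0[OF \<gamma>] tr_logic sel_intros | simp del: take_take drop_drop)+
  then obtain \<iota> where \<iota>: "\<iota> \<in> forms L (k + j + n)"
    "\<And>z. z \<in> pow (univ M) (k + j + n) \<Longrightarrow> (\<exists>x\<in>pow (univ M) m. sat M (nth (take k (take (k + j) z) @ x)) \<rho> \<and>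
       sat M (nth (take (k + j) z @ x @ drop (k + j) z)) \<gamma>) \<longleftrightarrow> sat M (nth z) \<iota>"
    "\<And>z. z \<in> pow (univ N) (k + j + n) \<Longrightarrow> (\<exists>x\<in>pow (univ N) m. sat N (nth (take k (take (k + j) z) @ x)) \<rho> \<and>
       sat N (nth (take (k + j) z @ x @ drop (k + j) z)) \<gamma>) \<longleftrightarrow> sat N (nth z) \<iota>"
    by (rule tr_formE) blast
  show ?thesis
  proof (rule that[OF \<iota>(1)])
    fix u assume u: "u \<in> pow (univ M) (k + j)"
    have "sat M (nth (u @ y)) \<iota> \<longleftrightarrow> (\<exists>x\<in>fsol M m \<rho> (take k u). graph_of M \<gamma> u x y)" if "y \<in> pow (univ M) n" for y
      using \<iota>(2)[OF pow_append[OF u that]] append_eq_conv_conj[of u y "u @ y"] pow_length[OF u]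
      by (auto simp: fsol_def graph_of_def)
    then show "fsol M n \<iota> u = {y \<in> pow (univ M) n. \<exists>x\<in>fsol M m \<rho> (take k u). graph_of M \<gamma> u x y}"
      by (auto simp: fsol_def[of _ n])
  next
    fix u assume u: "u \<in> pow (univ N) (k + j)"
    have "sat N (nth (u @ y)) \<iota> \<longleftrightarrow> (\<exists>x\<in>fsol N m \<rho> (take k u). graph_of N \<gamma> u x y)" if "y \<in> pow (univ N) n" for y
      using \<iota>(3)[OF pow_append[OF u that]] append_eq_conv_conj[of u y "u @ y"] pow_length[OF u]
      by (auto simp: fsol_def graph_of_def)
    then show "fsol N n \<iota> u = {y \<in> pow (univ N) n. \<exists>x\<in>fsol N m \<rho> (take k u). graph_of N \<gamma> u x y}"
      by (auto simp: fsol_def[of _ n])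
  qed
qed

lemma fiber_formula:
  fixes M :: "('f, 'r, 'm) fo_struct" and N :: "('f, 'r, 'n) fo_struct"
  assumes \<rho>: "\<rho> \<in> forms L (k + m)" and \<gamma>: "\<gamma> \<in> forms L (k + j + (m + n))"
  obtains \<kappa> where "\<kappa> \<in> forms L (k + j + n + m)"
    "\<And>u y. u \<in> pow (univ M) (k + j) \<Longrightarrow> y \<in> pow (univ M) n \<Longrightarrow>
       fsol M m \<kappa> (u @ y) = {x \<in> fsol M m \<rho> (take k u). graph_of M \<gamma> u x y}"
    "\<And>u y. u \<in> pow (univ N) (k + j) \<Longrightarrow> y \<in> pow (univ N) n \<Longrightarrow>
       fsol N m \<kappa> (u @ y) = {x \<in> fsol N m \<rho> (take k u). graph_of N \<gamma> u x y}"
proof -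
  have "tr L M N undefined {} (k + j + n + m)
    (\<lambda>z. sat M (nth (take k z @ drop (k + j + n) z)) \<rho> \<and>
       sat M (nth (take (k + j) z @ drop (k + j + n) z @ drop (k + j) (take (k + j + n) z))) \<gamma>)
    (\<lambda>z. sat N (nth (take k z @ drop (k + j + n) z)) \<rho> \<and>
       sat N (nth (take (k + j) z @ drop (k + j + n) z @ drop (k + j) (take (k + j + n) z))) \<gamma>)"
    by (rule tr_sub0[OF \<rho>] tr_sub0[OF \<gamma>] tr_logic sel_intros | simp del: take_take drop_drop)+
  then obtain \<kappa> where \<kappa>: "\<kappa> \<in> forms L (k + j + n + m)"
    "\<And>z. z \<in> pow (univ M) (k + j + n + m) \<Longrightarrow> (sat M (nth (take k z @ drop (k + j + n) z)) \<rho> \<and>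
       sat M (nth (take (k + j) z @ drop (k + j + n) z @ drop (k + j) (take (k + j + n) z))) \<gamma>) \<longleftrightarrow> sat M (nth z) \<kappa>"
    "\<And>z. z \<in> pow (univ N) (k + j + n + m) \<Longrightarrow> (sat N (nth (take k z @ drop (k + j + n) z)) \<rho> \<and>
       sat N (nth (take (k + j) z @ drop (k + j + n) z @ drop (k + j) (take (k + j + n) z))) \<gamma>) \<longleftrightarrow> sat N (nth z) \<kappa>"
    by (rule tr_formE) blast
  show ?thesis
  proof (rule that[OF \<kappa>(1)])
    fix u y assume u: "u \<in> pow (univ M) (k + j)" "y \<in> pow (univ M) n"
    have "sat M (nth ((u @ y) @ x)) \<kappa> \<longleftrightarrow> sat M (nth (take k u @ x)) \<rho> \<and> graph_of M \<gamma> u x y" if "x \<in> pow (univ M) m" for x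
      using \<kappa>(2)[OF pow_append[OF pow_append[OF u] that]] pow_length[OF u(1)] pow_length[OF u(2)] by (simp add: graph_of_def)
    then show "fsol M m \<kappa> (u @ y) = {x \<in> fsol M m \<rho> (take k u). graph_of M \<gamma> u x y}"
      by (auto simp: fsol_def)
  next
    fix u y assume u: "u \<in> pow (univ N) (k + j)" "y \<in> pow (univ N) n"
    have "sat N (nth ((u @ y) @ x)) \<kappa> \<longleftrightarrow> sat N (nth (take k u @ x)) \<rho> \<and> graph_of N \<gamma> u x y" if "x \<in> pow (univ N) m" for x
      using \<kappa>(3)[OF pow_append[OF pow_append[OF u] that]] pow_length[OF u(1)] pow_length[OF u(2)] by (simp add: graph_of_def)
    then show "fsol N m \<kappa> (u @ y) = {x \<in> fsol N m \<rho> (take k u). graph_of N \<gamma> u x y}"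
      by (auto simp: fsol_def)
  qed
qed

section \<open>Fiberability expressed through graphs\<close>

context fo_structure
begin

text \<open>The clauses of \<open>fib_sat\<close> with a relation in place of the map: a formula
  with varying parameters defines a relation, and its being functional is a separate
  condition.\<close>

definition fib_graph :: "'m set \<Rightarrow> nat \<Rightarrow> nat \<Rightarrow> nat \<Rightarrow> 'm list set \<Rightarrow> ('m list \<Rightarrow> 'm list \<Rightarrow> bool) \<Rightarrow> bool" where
  "fib_graph C r m n X G = (case r of
     0 \<Rightarrow> inj_into M C n X G
   | Suc s \<Rightarrow> fib_sat L M C s n {y \<in> pow U n. \<exists>x\<in>X. G x y} \<and>
       (\<forall>y\<in>pow U n. fib_sat L M C s m {x \<in> X. G x y}))"

lemma functional_on_dmap:
  assumes "definable L M m X" "D (m + n) (\<lambda>z. G (take m z) (drop m z))" "functional_on M n X G"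
  obtains f where "dmap m X n (pow U n) f" "\<And>x y. x \<in> X \<Longrightarrow> y \<in> pow U n \<Longrightarrow> f x = y \<longleftrightarrow> G x y"
proof -
  obtain f where f: "\<And>x. x \<in> X \<Longrightarrow> f x \<in> pow U n \<and> G x (f x) \<and> (\<forall>y'\<in>pow U n. G x y' \<longrightarrow> y' = f x)"
    using assms(3) unfolding functional_on_def by metis
  then have fG: "f x = y \<longleftrightarrow> G x y" if "x \<in> X" "y \<in> pow U n" for x y using that by blast
  have "dmap m X n (pow U n) f"
  proof (rule dmapI[OF assms(1) definable_pow])
    have "D (m + n) (\<lambda>z. take m z \<in> X \<and> G (take m z) (drop m z))"
      by (intro D_conj assms(2)) (rule D_set[OF assms(1)] select_intros | simp)+
    then show "D (m + n) (\<lambda>z. take m z \<in> X \<and> f (take m z) = drop m z)"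
      by (rule D_cong) (use fG pow_drop in blast)
  qed (use f in blast)
  then show ?thesis using fG that by blast
qed

lemma fib_rel:
  "fib_sat L M C r m X \<longleftrightarrow> definable L M m X \<and>
     (\<exists>n G. D (m + n) (\<lambda>z. G (take m z) (drop m z)) \<and> functional_on M n X G \<and> fib_graph C r m n X G)"
proof
  assume fib: "fib_sat L M C r m X"
  have X: "definable L M m X" by (rule fib_definable[OF fib])
  have graph_of: "D (m + n) (\<lambda>z. take m z \<in> X \<and> f (take m z) = drop m z)" "functional_on M n X (\<lambda>x y. x \<in> X \<and> f x = y)"
    if "dmap m X n (pow U n) f" for n f
    using that dmap_maps[OF that] by (auto simp: dmap_def functional_on_def)
  have "\<exists>n f. dmap m X n (pow U n) f \<and> fib_graph C r m n X (\<lambda>x y. x \<in> X \<and> f x = y)"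
  proof (cases r)
    case 0
    then obtain n f where f: "dmap m X n (pow U n) f" "inj_on f X" "f ` X \<subseteq> pow C n"
      using fib unfolding 0 fib_0_iff by blast
    then have "fib_graph C r m n X (\<lambda>x y. x \<in> X \<and> f x = y)"
      using 0 unfolding fib_graph_def inj_into_def inj_on_def by auto
    then show ?thesis using f(1) by blast
  next
    case (Suc s)
    then obtain n f where f: "dmap m X n (pow U n) f" "fib_sat L M C s n (f ` X)"
      "\<forall>y\<in>pow U n. fib_sat L M C s m (fiber X f y)"
      using fib unfolding Suc fib_Suc_iff by blast
    moreover have "{y \<in> pow U n. \<exists>x\<in>X. x \<in> X \<and> f x = y} = f ` X" using dmap_maps[OF f(1)] by auto
    moreover have "{x \<in> X. x \<in> X \<and> f x = y} = fiber X f y" for y by (auto simp: fiber_def)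
    ultimately have "fib_graph C r m n X (\<lambda>x y. x \<in> X \<and> f x = y)"
      using Suc unfolding fib_graph_def by auto
    then show ?thesis using f(1) by blast
  qed
  then obtain n f where "dmap m X n (pow U n) f" "fib_graph C r m n X (\<lambda>x y. x \<in> X \<and> f x = y)" by blast
  then show "definable L M m X \<and> (\<exists>n G. D (m + n) (\<lambda>z. G (take m z) (drop m z)) \<and> functional_on M n X G \<and> fib_graph C r m n X G)"
    using graph_of X by (intro conjI exI[of _ n] exI[of _ "\<lambda>x y. x \<in> X \<and> f x = y"])
next
  assume "definable L M m X \<and> (\<exists>n G. D (m + n) (\<lambda>z. G (take m z) (drop m z)) \<and> functional_on M n X G \<and> fib_graph C r m n X G)"
  then obtain n G where *: "definable L M m X" "D (m + n) (\<lambda>z. G (take m z) (drop m z))" "functional_on M n X G" "fib_graph C r m n X G"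
    by blast
  obtain f where f: "dmap m X n (pow U n) f" "\<And>x y. x \<in> X \<Longrightarrow> y \<in> pow U n \<Longrightarrow> f x = y \<longleftrightarrow> G x y"
    by (rule functional_on_dmap[OF *(1-3)]) blast
  note fm = dmap_maps[OF f(1)]
  show "fib_sat L M C r m X"
  proof (cases r)
    case 0
    then have inj: "f x \<in> pow C n \<and> (\<forall>x'\<in>X. f x' = f x \<longrightarrow> x' = x)" if "x \<in> X" for x
    proof -
      have "G x (f x)" using f(2)[OF that fm[OF that]] by simp
      then show ?thesis
        using *(4) 0 f(2)[OF _ fm[OF that]] fm[OF that] that unfolding fib_graph_def inj_into_def by auto
    qed
    then have "inj_on f X" by (auto intro: inj_onI)
    moreover have "f ` X \<subseteq> pow C n" using inj by blast
    ultimately show ?thesis using f(1) unfolding 0 fib_0_iff by blast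
  next
    case (Suc s)
    have "{y \<in> pow U n. \<exists>x\<in>X. G x y} = f ` X" using fm f(2) by blast
    moreover have "{x \<in> X. G x y} = fiber X f y" if "y \<in> pow U n" for y using f(2) that by (auto simp: fiber_def)
    ultimately have "fib_sat L M C s n (f ` X)" "\<forall>y\<in>pow U n. fib_sat L M C s m (fiber X f y)"
      using *(4) Suc unfolding fib_graph_def by auto
    then show ?thesis using f(1) Suc fib_Suc_iff by blast
  qed
qed

end

text \<open>A datum \<open>(j, n, \<gamma>, \<theta>)\<close> describes fibrations uniformly: \<open>\<theta>\<close> is a condition on parameters \<open>p\<close> and
  auxiliary parameters \<open>q\<close> of length \<open>j\<close>, and \<open>\<gamma>\<close> defines the graph of a map to \<open>n\<close>-tuples.\<close>

type_synonym ('f, 'r) datum = "nat \<times> nat \<times> ('f, 'r) fm \<times> ('f, 'r) fm"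

fun holds :: "('f, 'r, 'm) fo_struct \<Rightarrow> ('f, 'r) datum \<Rightarrow> 'm list \<Rightarrow> bool" where
  "holds M (j, n, \<gamma>, \<theta>) p \<longleftrightarrow> (\<exists>q\<in>pow (univ M) j. sat M (nth (p @ q)) \<theta>)"

section \<open>Compactness and openness of fiberability\<close>

locale saturated_structure = fo_structure L M for L :: "('f, 'r) lang" and M :: "('f, 'r, 'm) fo_struct" +
  fixes C :: "'m set"
  assumes saturated: "omega_saturated L M"
    and C_def: "tr L M M id {} 1 (\<lambda>z. z \<in> pow C 1) (\<lambda>z. z \<in> pow C 1)"
begin

definition D0 :: "nat \<Rightarrow> ('m list \<Rightarrow> bool) \<Rightarrow> bool" where
  "D0 n P \<longleftrightarrow> tr L M M id {} n P P"

text \<open>Saturation concerns a single variable, so a tuple is realized one coordinate at a time.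
  The last \<open>n\<close> coordinates are found first, as a realization of the statements that
  each finite part of the type admits a value of the leading coordinate.\<close>

lemma compactness:
  assumes "\<And>T. T \<in> \<T> \<Longrightarrow> D0 (n + l) T" "ps \<in> pow U l"
    "\<And>\<S>. finite \<S> \<Longrightarrow> \<S> \<subseteq> \<T> \<Longrightarrow> \<exists>y\<in>pow U n. \<forall>T\<in>\<S>. T (y @ ps)"
  shows "\<exists>y\<in>pow U n. \<forall>T\<in>\<T>. T (y @ ps)"
  using assms
proof (induction n arbitrary: \<T>)
  case 0
  have "T ps" if "T \<in> \<T>" for T using 0(3)[of "{T}"] that by auto
  then show ?case by auto
next
  case (Suc n)
  \<comment> \<open>The inner condition is a finite conjunction, written through negations so that
    \<open>tr_fin_ex\<close> applies.\<close>
  define ex where "ex \<S> w \<longleftrightarrow> (\<exists>a\<in>pow U 1. \<not> (\<exists>T\<in>\<S>. \<not> T (a @ w)))" for \<S> and w :: "'m list"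
  have "\<exists>y\<in>pow U n. \<forall>T\<in>ex ` {\<S>. finite \<S> \<and> \<S> \<subseteq> \<T>}. T (y @ ps)"
  proof (rule Suc.IH[OF _ Suc.prems(2)])
    fix T assume "T \<in> ex ` {\<S>. finite \<S> \<and> \<S> \<subseteq> \<T>}"
    then obtain \<S> where S: "finite \<S>" "\<S> \<subseteq> \<T>" "T = ex \<S>" by blast
    have DT: "tr L M M id {} (Suc n + l) T T" if "T \<in> \<S>" for T
      using Suc.prems(1) S(2) that unfolding D0_def by blast
    have "tr L M M id {} (n + l) (\<lambda>w. \<exists>a\<in>pow U 1. \<not> (\<exists>T\<in>\<S>. \<not> T (a @ w))) (\<lambda>w. \<exists>a\<in>pow U 1. \<not> (\<exists>T\<in>\<S>. \<not> T (a @ w)))"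
    proof (rule tr_ex, rule tr_neg, rule tr_fin_ex[OF S(1)], rule tr_neg)
      fix T assume T: "T \<in> \<S>"
      show "tr L M M id {} (n + l + 1) (\<lambda>w. T (drop (n + l) w @ take (n + l) w)) (\<lambda>w. T (drop (n + l) w @ take (n + l) w))"
        by (rule tr_sub[OF DT[OF T]] sel_intros | simp)+
    qed
    then show "D0 (n + l) T" unfolding D0_def S(3) ex_def .
  next
    fix \<S> assume "finite \<S>" "\<S> \<subseteq> ex ` {\<S>. finite \<S> \<and> \<S> \<subseteq> \<T>}"
    then obtain \<F> where F: "finite \<F>" "\<F> \<subseteq> {\<S>. finite \<S> \<and> \<S> \<subseteq> \<T>}" "\<S> = ex ` \<F>"
      using finite_subset_image by meson
    then have "finite (\<Union>\<F>)" "\<Union>\<F> \<subseteq> \<T>" by auto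
    then obtain y where y: "y \<in> pow U (Suc n)" "\<forall>T\<in>\<Union>\<F>. T (y @ ps)" using Suc.prems(3) by meson
    then obtain a y' where ay: "a \<in> pow U 1" "y' \<in> pow U n" "y = a @ y'"
      by (metis pow_splitE plus_1_eq_Suc)
    then have "\<forall>T\<in>\<S>. T (y' @ ps)" using y(2) F(3) by (auto simp: ex_def)
    then show "\<exists>y\<in>pow U n. \<forall>T\<in>\<S>. T (y @ ps)" using ay(2) by blast
  qed
  then obtain y where y: "y \<in> pow U n" "\<And>\<S>. finite \<S> \<Longrightarrow> \<S> \<subseteq> \<T> \<Longrightarrow> ex \<S> (y @ ps)" by blast
  define \<Gamma> where "\<Gamma> = {\<phi> \<in> forms L (Suc n + l). \<exists>T\<in>\<T>. \<forall>z\<in>pow U (Suc n + l). T z \<longleftrightarrow> sat M (nth z) \<phi>}"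
  have yps: "y @ ps \<in> pow U (n + l)" using y(1) Suc.prems(2) by (rule pow_append)
  have cons: "a # y @ ps \<in> pow U (Suc n + l)" if "a \<in> U" for a using yps that by (auto simp: pow_def)
  have "\<exists>a\<in>U. \<forall>\<phi>\<in>\<Gamma>. sat M (nth (a # y @ ps)) \<phi>"
  proof (rule saturated[unfolded omega_saturated_def, rule_format], intro conjI allI impI)
    show "set (y @ ps) \<subseteq> U" "\<Gamma> \<subseteq> forms L (Suc (length (y @ ps)))"
      using yps by (auto simp: pow_def \<Gamma>_def)
    fix \<Delta> assume \<Delta>: "\<Delta> \<subseteq> \<Gamma>" "finite \<Delta>"
    then have "\<forall>\<phi>\<in>\<Delta>. \<exists>T. T \<in> \<T> \<and> (\<forall>z\<in>pow U (Suc n + l). T z \<longleftrightarrow> sat M (nth z) \<phi>)"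
      unfolding \<Gamma>_def by blast
    then obtain t where t: "\<forall>\<phi>\<in>\<Delta>. t \<phi> \<in> \<T> \<and> (\<forall>z\<in>pow U (Suc n + l). t \<phi> z \<longleftrightarrow> sat M (nth z) \<phi>)"
      by metis
    have "ex (t ` \<Delta>) (y @ ps)" by (rule y(2)) (use \<Delta> t in auto)
    then obtain a where a: "a \<in> pow U 1" "\<forall>\<phi>\<in>\<Delta>. t \<phi> (a @ y @ ps)" unfolding ex_def by blast
    then obtain b where b: "a = [b]" "b \<in> U" by (auto simp: pow_def length_Suc_conv)
    have "\<forall>\<phi>\<in>\<Delta>. sat M (nth (b # y @ ps)) \<phi>" using a(2) t cons[OF b(2)] b(1) by simp
    then show "\<exists>a\<in>U. \<forall>\<phi>\<in>\<Delta>. sat M (nth (a # y @ ps)) \<phi>" using b(2) by blast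
  qed
  then obtain a where a: "a \<in> U" "\<forall>\<phi>\<in>\<Gamma>. sat M (nth (a # y @ ps)) \<phi>" by blast
  have "T (a # y @ ps)" if T: "T \<in> \<T>" for T
  proof -
    obtain \<rho> where "\<rho> \<in> forms L (Suc n + l)" "\<And>z. z \<in> pow U (Suc n + l) \<Longrightarrow> T z \<longleftrightarrow> sat M (nth z) \<rho>"
      using Suc.prems(1)[OF T] unfolding D0_def by (rule tr_formE) blast
    then show ?thesis using a(2) T cons[OF a(1)] unfolding \<Gamma>_def by blast
  qed
  moreover have "a # y \<in> pow U (Suc n)" using a(1) y(1) by (auto simp: pow_def)
  ultimately show ?case by (metis append_Cons)
qed

fun valid :: "nat \<Rightarrow> nat \<Rightarrow> nat \<Rightarrow> ('f, 'r) fm \<Rightarrow> ('f, 'r) datum \<Rightarrow> bool" where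
  "valid r k m \<rho> (j, n, \<gamma>, \<theta>) \<longleftrightarrow> \<gamma> \<in> forms L (k + j + (m + n)) \<and> \<theta> \<in> forms L (k + j) \<and>
     (\<forall>p\<in>pow U k. \<forall>q\<in>pow U j. sat M (nth (p @ q)) \<theta> \<longrightarrow>
        functional_on M n (fsol M m \<rho> p) (graph_of M \<gamma> (p @ q)) \<and> fib_graph C r m n (fsol M m \<rho> p) (graph_of M \<gamma> (p @ q)))"

lemma D_graph_of:
  assumes "\<gamma> \<in> forms L (k + (m + n))" "u \<in> pow U k"
  shows "D (m + n) (\<lambda>z. graph_of M \<gamma> u (take m z) (drop m z))"
proof -
  have \<gamma>: "D (k + (m + n)) (\<lambda>z. sat M (nth z) \<gamma>)"
    unfolding D_def by (rule tr_mono[OF tr_form[OF assms(1)]]) simp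
  have "D (m + n) (\<lambda>z. sat M (nth (u @ z)) \<gamma>)"
    by (rule D_pred[OF \<gamma>] select_const[OF assms(2)] select_intros | simp)+
  then show ?thesis by (simp add: graph_of_def)
qed

lemma fsol_definable:
  assumes "\<rho> \<in> forms L (k + m)" "p \<in> pow U k"
  shows "definable L M m (fsol M m \<rho> p)"
proof -
  have \<rho>: "D (k + m) (\<lambda>z. sat M (nth z) \<rho>)"
    unfolding D_def by (rule tr_mono[OF tr_form[OF assms(1)]]) simp
  show ?thesis unfolding fsol_def
    by (rule definable_Collect D_pred[OF \<rho>] select_const[OF assms(2)] select_intros | simp)+
qed

text \<open>The parameters \<open>q\<close> of a fibration of one member become auxiliary variables.
  It remains to find a formula true of \<open>p @ q\<close> that forces the same
  \<open>\<gamma>\<close> to fiber the members at all other parameters satisfying it. Openness for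
  fewer steps provides such formulas for the image and for each fiber; compactness reduces those for
  the fibers to finitely many.\<close>

lemma local_step:
  assumes open_IH: "\<And>s k m \<rho> p. r = Suc s \<Longrightarrow> \<rho> \<in> forms L (k + m) \<Longrightarrow> p \<in> pow U k \<Longrightarrow>
      fib_sat L M C s m (fsol M m \<rho> p) \<Longrightarrow>
      \<exists>\<theta>\<in>forms L k. sat M (nth p) \<theta> \<and> (\<forall>p'\<in>pow U k. sat M (nth p') \<theta> \<longrightarrow> fib_sat L M C s m (fsol M m \<rho> p'))"
    and \<rho>: "\<rho> \<in> forms L (k + m)" and p: "p \<in> pow U k" and fib: "fib_sat L M C r m (fsol M m \<rho> p)"
  shows "\<exists>d. valid r k m \<rho> d \<and> holds M d p"
proof -
  from fib obtain n G where G: "D (m + n) (\<lambda>z. G (take m z) (drop m z))" "functional_on M n (fsol M m \<rho> p) G"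
    "fib_graph C r m n (fsol M m \<rho> p) G"
    unfolding fib_rel[of C r m "fsol M m \<rho> p"] by blast
  from G(1)[unfolded D_def] obtain j q \<gamma>0 where q: "q \<in> pow U j" "\<gamma>0 \<in> forms L (m + n + j)"
    "\<And>z. z \<in> pow U (m + n) \<Longrightarrow> G (take m z) (drop m z) \<longleftrightarrow> sat M (nth (z @ q)) \<gamma>0"
    by (rule tr_paramE) (use that in blast)
  \<comment> \<open>In \<open>\<gamma>0\<close> the parameters \<open>q\<close> come last; they are
    moved in front of the graph variables, directly behind \<open>p\<close>.\<close>
  have "tr L M M id {} (k + j + (m + n)) (\<lambda>z. sat M (nth (drop (k + j) z @ drop k (take (k + j) z))) \<gamma>0)
      (\<lambda>z. sat M (nth (drop (k + j) z @ drop k (take (k + j) z))) \<gamma>0)"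
    by (rule tr_sub0[OF q(2)] sel_intros | simp)+
  then obtain \<gamma> where \<gamma>: "\<gamma> \<in> forms L (k + j + (m + n))"
    "\<And>z. z \<in> pow U (k + j + (m + n)) \<Longrightarrow> sat M (nth (drop (k + j) z @ drop k (take (k + j) z))) \<gamma>0 \<longleftrightarrow> sat M (nth z) \<gamma>"
    by (rule tr_formE) blast
  let ?u = "p @ q"
  have u: "?u \<in> pow U (k + j)" using p q(1) by (rule pow_append)
  have Ggr: "G x y \<longleftrightarrow> graph_of M \<gamma> ?u x y" if "x \<in> pow U m" "y \<in> pow U n" for x y
    using \<gamma>(2)[OF pow_append[OF u pow_append[OF that]]] q(3)[OF pow_append[OF that]] that p q(1)
    by (simp add: graph_of_def pow_length)
  have Xsub: "fsol M m \<rho> p' \<subseteq> pow U m" for p' by (auto simp: fsol_def)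
  have fn: "functional_on M n (fsol M m \<rho> p) (graph_of M \<gamma> ?u)"
    unfolding functional_on_def
  proof
    fix x assume x: "x \<in> fsol M m \<rho> p"
    then have xm: "x \<in> pow U m" using Xsub by blast
    from G(2) x obtain y where y: "y \<in> pow U n" "G x y" "\<forall>y'\<in>pow U n. G x y' \<longrightarrow> y' = y"
      unfolding functional_on_def by blast
    have "graph_of M \<gamma> ?u x y" using Ggr[OF xm y(1)] y(2) by (rule iffD1)
    moreover have "y' = y" if "y' \<in> pow U n" "graph_of M \<gamma> ?u x y'" for y'
      by (rule mp[OF bspec[OF y(3) that(1)]]) (rule iffD2[OF Ggr[OF xm that(1)] that(2)])
    ultimately show "\<exists>y\<in>pow U n. graph_of M \<gamma> ?u x y \<and> (\<forall>y'\<in>pow U n. graph_of M \<gamma> ?u x y' \<longrightarrow> y' = y)"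
      using y(1) by blast
  qed
  have fg: "fib_graph C r m n (fsol M m \<rho> p) (graph_of M \<gamma> ?u)"
  proof -
    have "{y \<in> pow U n. \<exists>x\<in>fsol M m \<rho> p. G x y} = {y \<in> pow U n. \<exists>x\<in>fsol M m \<rho> p. graph_of M \<gamma> ?u x y}"
      using Ggr Xsub by blast
    moreover have "{x \<in> fsol M m \<rho> p. G x y} = {x \<in> fsol M m \<rho> p. graph_of M \<gamma> ?u x y}" if "y \<in> pow U n" for y
      using Ggr Xsub that by blast
    ultimately show ?thesis using G(3) Ggr[OF subsetD[OF Xsub[of p]]] unfolding fib_graph_def inj_into_def
      by (cases r) auto
  qed
  have tk: "take k (p' @ q') = p'" if "p' \<in> pow U k" for p' q'
    using that by (simp add: pow_length)
  let ?Fn = "\<lambda>u. functional_on M n (fsol M m \<rho> (take k u)) (graph_of M \<gamma> u)"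
  have "\<exists>P. tr L M M id {} (k + j) P P \<and> P ?u \<and>
      (\<forall>p'\<in>pow U k. \<forall>q'\<in>pow U j. P (p' @ q') \<longrightarrow> fib_graph C r m n (fsol M m \<rho> p') (graph_of M \<gamma> (p' @ q')))"
  proof (cases r)
    case 0
    then show ?thesis
      using inj_into_tr[OF \<rho> \<gamma>(1) C_def] fg tk p
      by (intro exI[of _ "\<lambda>u. inj_into M C n (fsol M m \<rho> (take k u)) (graph_of M \<gamma> u)"])
        (simp add: fib_graph_def)
  next
    case (Suc s)
    obtain \<iota> where \<iota>: "\<iota> \<in> forms L (k + j + n)"
      "\<And>u. u \<in> pow U (k + j) \<Longrightarrow> fsol M n \<iota> u = {y \<in> pow U n. \<exists>x\<in>fsol M m \<rho> (take k u). graph_of M \<gamma> u x y}"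
      by (rule image_formula[OF \<rho> \<gamma>(1), of M M]) blast
    obtain \<kappa> where \<kappa>: "\<kappa> \<in> forms L (k + j + n + m)"
      "\<And>u y. u \<in> pow U (k + j) \<Longrightarrow> y \<in> pow U n \<Longrightarrow>
         fsol M m \<kappa> (u @ y) = {x \<in> fsol M m \<rho> (take k u). graph_of M \<gamma> u x y}"
      by (rule fiber_formula[OF \<rho> \<gamma>(1), of M M]) blast
    have im: "fsol M n \<iota> (p' @ q') = {y \<in> pow U n. \<exists>x\<in>fsol M m \<rho> p'. graph_of M \<gamma> (p' @ q') x y}"
      if "p' \<in> pow U k" "q' \<in> pow U j" for p' q'
      using \<iota>(2)[OF pow_append[OF that]] tk[OF that(1)] by simp
    have fb: "fsol M m \<kappa> ((p' @ q') @ y) = {x \<in> fsol M m \<rho> p'. graph_of M \<gamma> (p' @ q') x y}"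
      if "p' \<in> pow U k" "q' \<in> pow U j" "y \<in> pow U n" for p' q' y
      using \<kappa>(2)[OF pow_append[OF that(1,2)] that(3)] tk[OF that(1)] by simp
    have "fib_sat L M C s n (fsol M n \<iota> ?u)" using fg Suc im[OF p q(1)] by (simp add: fib_graph_def)
    from open_IH[OF Suc \<iota>(1) u this] obtain \<theta>1 where \<theta>1: "\<theta>1 \<in> forms L (k + j)" "sat M (nth ?u) \<theta>1"
      "\<forall>p'\<in>pow U (k + j). sat M (nth p') \<theta>1 \<longrightarrow> fib_sat L M C s n (fsol M n \<iota> p')"
      by blast
    \<comment> \<open>Formulas that certify \<open>s\<close>-step fiberability of the fibers; by
      openness, every fiber of the given map has such a certificate.\<close>
    define \<Theta> where "\<Theta> = {\<theta> \<in> forms L (k + j + n). \<forall>v\<in>pow U (k + j + n). sat M (nth v) \<theta> \<longrightarrow> fib_sat L M C s m (fsol M m \<kappa> v)}"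
    have cover: "\<exists>\<theta>\<in>\<Theta>. sat M (nth (?u @ y)) \<theta>" if "y \<in> pow U n" for y
    proof -
      have "fib_sat L M C s m (fsol M m \<kappa> (?u @ y))" using fg Suc fb[OF p q(1) that] that by (simp add: fib_graph_def)
      from open_IH[OF Suc \<kappa>(1) pow_append[OF u that] this] show ?thesis unfolding \<Theta>_def by blast
    qed
    let ?T = "\<lambda>\<theta> z. \<not> sat M (nth (drop n z @ take n z)) \<theta>"
    \<comment> \<open>If no finite set of certificates sufficed, saturation would produce a
      \<open>y\<close> to which none applies.\<close>
    have "\<exists>\<S>\<subseteq>\<Theta>. finite \<S> \<and> (\<forall>y\<in>pow U n. \<exists>\<theta>\<in>\<S>. sat M (nth (?u @ y)) \<theta>)" (is ?cov)
    proof (rule ccontr)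
      assume neg: "\<not> ?cov"
      have "\<exists>y\<in>pow U n. \<forall>T\<in>?T ` \<Theta>. T (y @ ?u)"
      proof (rule compactness[OF _ u])
        fix T assume "T \<in> ?T ` \<Theta>"
        then obtain \<theta> where \<theta>: "\<theta> \<in> forms L (k + j + n)" "T = ?T \<theta>" unfolding \<Theta>_def by blast
        show "D0 (n + (k + j)) T" unfolding D0_def \<theta>(2)
          by (rule tr_neg tr_sub0[OF \<theta>(1)] sel_intros | simp)+
      next
        fix \<S> assume "finite \<S>" "\<S> \<subseteq> ?T ` \<Theta>"
        then obtain \<F> where F: "\<F> \<subseteq> \<Theta>" "finite \<F>" "\<S> = ?T ` \<F>" using finite_subset_image by meson
        have "\<not> (\<forall>y\<in>pow U n. \<exists>\<theta>\<in>\<F>. sat M (nth (?u @ y)) \<theta>)"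
        proof
          assume "\<forall>y\<in>pow U n. \<exists>\<theta>\<in>\<F>. sat M (nth (?u @ y)) \<theta>"
          with F(1,2) have ?cov by (intro exI[of _ \<F>] conjI)
          with neg show False ..
        qed
        then obtain y where "y \<in> pow U n" "\<forall>\<theta>\<in>\<F>. \<not> sat M (nth (?u @ y)) \<theta>" by blast
        then show "\<exists>y\<in>pow U n. \<forall>T\<in>\<S>. T (y @ ?u)" using F(3) by (intro bexI[of _ y]) (auto simp: pow_length)
      qed
      then show False using cover by (auto simp: pow_length)
    qed
    then obtain \<S> where S: "\<S> \<subseteq> \<Theta>" "finite \<S>" "\<forall>y\<in>pow U n. \<exists>\<theta>\<in>\<S>. sat M (nth (?u @ y)) \<theta>" by blast
    \<comment> \<open>That these finitely many certificates reach all \<open>y\<close> is a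
      first-order condition on \<open>u\<close>, and it guarantees fiberable fibers wherever it
      holds.\<close>
    let ?P = "\<lambda>u. sat M (nth u) \<theta>1 \<and> (\<forall>y\<in>pow U n. \<exists>\<theta>\<in>\<S>. sat M (nth (u @ y)) \<theta>)"
    have "tr L M M id {} (k + j) ?P ?P"
    proof (rule tr_conj[OF tr_form[OF \<theta>1(1)]], rule tr_all, rule tr_fin_ex[OF S(2)])
      fix \<theta> assume "\<theta> \<in> \<S>"
      then have \<theta>: "\<theta> \<in> forms L (k + j + n)" using S(1) unfolding \<Theta>_def by blast
      show "tr L M M id {} (k + j + n) (\<lambda>w. sat M (nth (take (k + j) w @ drop (k + j) w)) \<theta>)
          (\<lambda>w. sat M (nth (take (k + j) w @ drop (k + j) w)) \<theta>)"
        by (rule tr_sub0[OF \<theta>] sel_intros | simp)+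
    qed
    moreover have "?P ?u" using \<theta>1(2) S(3) by blast
    moreover have "fib_graph C r m n (fsol M m \<rho> p') (graph_of M \<gamma> (p' @ q'))"
      if "p' \<in> pow U k" "q' \<in> pow U j" "?P (p' @ q')" for p' q'
    proof -
      have u': "p' @ q' \<in> pow U (k + j)" using that by (auto intro: pow_append)
      have "fib_sat L M C s n (fsol M n \<iota> (p' @ q'))" using \<theta>1(3) u' that(3) by blast
      moreover have "fib_sat L M C s m (fsol M m \<kappa> ((p' @ q') @ y))" if "y \<in> pow U n" for y
        using \<open>?P (p' @ q')\<close> that S(1) pow_append[OF u' that] unfolding \<Theta>_def by blast
      ultimately show ?thesis using Suc im[OF that(1,2)] fb[OF that(1,2)] by (simp add: fib_graph_def)
    qed
    ultimately show ?thesis by blast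
  qed
  then obtain P where P: "tr L M M id {} (k + j) P P" "P ?u"
      "\<forall>p'\<in>pow U k. \<forall>q'\<in>pow U j. P (p' @ q') \<longrightarrow> fib_graph C r m n (fsol M m \<rho> p') (graph_of M \<gamma> (p' @ q'))"
    by blast
  obtain \<theta> where \<theta>: "\<theta> \<in> forms L (k + j)" "\<And>z. z \<in> pow U (k + j) \<Longrightarrow> (?Fn z \<and> P z) \<longleftrightarrow> sat M (nth z) \<theta>"
    by (rule tr_formE[OF tr_conj[OF functional_on_tr[OF \<rho> \<gamma>(1)] P(1)]]) (use that in blast)
  have "valid r k m \<rho> (j, n, \<gamma>, \<theta>)"
    unfolding valid.simps
  proof (intro conjI ballI impI \<gamma>(1) \<theta>(1))
    fix p' q' assume pq: "p' \<in> pow U k" "q' \<in> pow U j" "sat M (nth (p' @ q')) \<theta>"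
    then have *: "?Fn (p' @ q')" "P (p' @ q')" using \<theta>(2)[OF pow_append[OF pq(1,2)]] by blast+
    show "functional_on M n (fsol M m \<rho> p') (graph_of M \<gamma> (p' @ q'))" using *(1) tk[OF pq(1)] by simp
    show "fib_graph C r m n (fsol M m \<rho> p') (graph_of M \<gamma> (p' @ q'))" using P(3) *(2) pq by blast
  qed
  moreover have "holds M (j, n, \<gamma>, \<theta>) p"
    unfolding holds.simps using q(1) \<theta>(2)[OF u] P(2) fn tk[OF p] by auto
  ultimately show ?thesis by blast
qed

lemma valid_fib:
  assumes "\<rho> \<in> forms L (k + m)" "valid r k m \<rho> d" "p \<in> pow U k" "holds M d p"
  shows "fib_sat L M C r m (fsol M m \<rho> p)"
proof -
  obtain j n \<gamma> \<theta> where d: "d = (j, n, \<gamma>, \<theta>)" by (cases d)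
  obtain q where q: "q \<in> pow U j" "sat M (nth (p @ q)) \<theta>" using assms(4) d by auto
  have "D (m + n) (\<lambda>z. graph_of M \<gamma> (p @ q) (take m z) (drop m z))"
    by (rule D_graph_of[of _ "k + j"]) (use assms d q in \<open>auto intro: pow_append\<close>)
  then show ?thesis
    unfolding fib_rel[of C r m "fsol M m \<rho> p"] using fsol_definable[OF assms(1,3)] assms(2,3) q d by auto
qed

text \<open>Openness in the space of types: membership in the fiberable part is decided by one
  parameter-free formula true of \<open>p\<close>. \<open>fib_sat\<close> itself is no first-order
  condition, and this is what makes compactness applicable to it.\<close>

theorem fiberability_open:
  assumes "\<rho> \<in> forms L (k + m)" "p \<in> pow U k" "fib_sat L M C r m (fsol M m \<rho> p)"
  shows "\<exists>\<theta>\<in>forms L k. sat M (nth p) \<theta> \<and> (\<forall>p'\<in>pow U k. sat M (nth p') \<theta> \<longrightarrow> fib_sat L M C r m (fsol M m \<rho> p'))"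
  using assms
proof (induction r arbitrary: k m \<rho> p rule: less_induct)
  case (less r)
  have "\<exists>d. valid r k m \<rho> d \<and> holds M d p"
    by (rule local_step[OF _ less.prems]) (use less.IH in blast)
  then obtain j n \<gamma> \<theta>0 where d: "valid r k m \<rho> (j, n, \<gamma>, \<theta>0)" "holds M (j, n, \<gamma>, \<theta>0) p" by (metis prod_cases4)
  then have \<theta>0: "\<theta>0 \<in> forms L (k + j)" by simp
  have "tr L M M id {} k (\<lambda>p. \<exists>q\<in>pow U j. sat M (nth (p @ q)) \<theta>0) (\<lambda>p. \<exists>q\<in>pow U j. sat M (nth (p @ q)) \<theta>0)"
    by (rule tr_ex tr_sub0[OF \<theta>0] sel_intros | simp)+
  then obtain \<theta> where \<theta>: "\<theta> \<in> forms L k"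
    "\<And>z. z \<in> pow U k \<Longrightarrow> (\<exists>q\<in>pow U j. sat M (nth (z @ q)) \<theta>0) \<longleftrightarrow> sat M (nth z) \<theta>"
    by (rule tr_formE) blast
  show ?case
    by (rule bexI[OF _ \<theta>(1)]) (use \<theta>(2) d(2) less.prems(2) valid_fib[OF less.prems(1) d(1)] in auto)
qed

lemma ex_valid:
  assumes "\<rho> \<in> forms L (k + m)" "p \<in> pow U k" "fib_sat L M C r m (fsol M m \<rho> p)"
  shows "\<exists>d. valid r k m \<rho> d \<and> holds M d p"
  by (rule local_step[OF fiberability_open assms])

end

section \<open>Independence of the saturated extension\<close>

definition same_type ::
  "('f, 'r) lang \<Rightarrow> ('f, 'r, 'm) fo_struct \<Rightarrow> ('f, 'r, 'n) fo_struct \<Rightarrow> nat \<Rightarrow> 'm list \<Rightarrow> 'n list \<Rightarrow> bool" where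
  "same_type L M N k a b \<longleftrightarrow> a \<in> pow (univ M) k \<and> b \<in> pow (univ N) k \<and>
     (\<forall>\<phi>\<in>forms L k. sat M (nth a) \<phi> \<longleftrightarrow> sat N (nth b) \<phi>)"

lemma same_type_sym: "same_type L M N k a b \<Longrightarrow> same_type L N M k b a"
  by (auto simp: same_type_def)

lemma same_type_tr: "same_type L M N k a b \<Longrightarrow> tr L M N h {} k P P' \<Longrightarrow> P a \<longleftrightarrow> P' b"
  by (erule tr_formE) (auto simp: same_type_def)

text \<open>The single step of the back-and-forth: the type of \<open>q\<close> over
  \<open>a\<close>, read over \<open>b\<close>, is finitely satisfiable because \<open>a\<close> and
  \<open>b\<close> have the same type.\<close>

lemma same_type_extend:
  assumes N: "saturated_structure L N C" and ab: "same_type L M N k a b" and q: "q \<in> pow (univ M) j"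
  obtains q' where "q' \<in> pow (univ N) j" "same_type L M N (k + j) (a @ q) (b @ q')"
proof -
  interpret N: saturated_structure L N C by (rule N)
  have a: "a \<in> pow (univ M) k" and b: "b \<in> pow (univ N) k" using ab by (auto simp: same_type_def)
  let ?F = "{\<phi> \<in> forms L (k + j). sat M (nth (a @ q)) \<phi>}"
  let ?T = "\<lambda>\<phi> z. sat N (nth (drop j z @ take j z)) \<phi>"
  have "\<exists>y\<in>pow (univ N) j. \<forall>T\<in>?T ` ?F. T (y @ b)"
  proof (rule N.compactness[OF _ b])
    fix T assume "T \<in> ?T ` ?F"
    then obtain \<phi> where \<phi>: "\<phi> \<in> forms L (k + j)" "T = ?T \<phi>" by blast
    show "N.D0 (j + k) T" unfolding N.D0_def \<phi>(2)
      by (rule tr_sub0[OF \<phi>(1)] sel_intros | simp)+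
  next
    fix \<S> assume "finite \<S>" "\<S> \<subseteq> ?T ` ?F"
    then obtain \<F> where F: "\<F> \<subseteq> ?F" "finite \<F>" "\<S> = ?T ` \<F>" using finite_subset_image by meson
    have "tr L M N undefined {} k (\<lambda>a. \<exists>y\<in>pow (univ M) j. \<not> (\<exists>\<phi>\<in>\<F>. \<not> sat M (nth (a @ y)) \<phi>))
        (\<lambda>a. \<exists>y\<in>pow (univ N) j. \<not> (\<exists>\<phi>\<in>\<F>. \<not> sat N (nth (a @ y)) \<phi>))"
    proof (rule tr_ex, rule tr_neg, rule tr_fin_ex[OF F(2)], rule tr_neg)
      fix \<phi> assume "\<phi> \<in> \<F>"
      then have \<phi>: "\<phi> \<in> forms L (k + j)" using F(1) by blast
      show "tr L M N undefined {} (k + j) (\<lambda>w. sat M (nth (take k w @ drop k w)) \<phi>) (\<lambda>w. sat N (nth (take k w @ drop k w)) \<phi>)"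
        by (rule tr_sub0[OF \<phi>] sel_intros | simp)+
    qed
    from same_type_tr[OF ab this] have "\<exists>y\<in>pow (univ N) j. \<not> (\<exists>\<phi>\<in>\<F>. \<not> sat N (nth (b @ y)) \<phi>)"
      using q F(1) by blast
    then obtain y where "y \<in> pow (univ N) j" "\<forall>\<phi>\<in>\<F>. sat N (nth (b @ y)) \<phi>" by blast
    then show "\<exists>y\<in>pow (univ N) j. \<forall>T\<in>\<S>. T (y @ b)"
      using F(3) by (intro bexI[of _ y]) (auto simp: pow_length)
  qed
  then obtain q' where q': "q' \<in> pow (univ N) j" "\<And>\<phi>. \<phi> \<in> ?F \<Longrightarrow> sat N (nth (b @ q')) \<phi>"
    by (auto simp: pow_length)
  have "sat M (nth (a @ q)) \<phi> \<longleftrightarrow> sat N (nth (b @ q')) \<phi>" if "\<phi> \<in> forms L (k + j)" for \<phi>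
  proof -
    \<comment> \<open>\<open>?F\<close> also contains the negations of the formulas that fail at
      \<open>a @ q\<close>, so realizing it gives both directions.\<close>
    have "Neg \<phi> \<in> forms L (k + j)" using that by (simp add: forms_def)
    then show ?thesis using q'(2)[of \<phi>] q'(2)[of "Neg \<phi>"] that by auto
  qed
  then have "same_type L M N (k + j) (a @ q) (b @ q')"
    using a b q q'(1) by (simp add: same_type_def pow_append)
  then show ?thesis using that q'(1) by blast
qed

text \<open>Going forth carries the parameters of a fibration from \<open>M\<close> to
  \<open>N\<close>. Going back is required for the fibers: each \<open>y'\<close> in
  \<open>N\<close> is matched by a \<open>y\<close> in \<open>M\<close>, whose fiber is known to be
  fiberable in fewer steps.\<close>

theorem fib_same_type:
  assumes M: "saturated_structure L M C" and N: "saturated_structure L N C'"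
    and C: "tr L M N h {} 1 (\<lambda>z. z \<in> pow C 1) (\<lambda>z. z \<in> pow C' 1)"
    and "same_type L M N k a b" "\<rho> \<in> forms L (k + m)" "fib_sat L M C r m (fsol M m \<rho> a)"
  shows "fib_sat L N C' r m (fsol N m \<rho> b)"
  using assms(4-6)
proof (induction r arbitrary: k a b m \<rho> rule: less_induct)
  case (less r)
  note ab = less.prems(1) and \<rho> = less.prems(2)
  interpret M: saturated_structure L M C by (rule M)
  interpret N: saturated_structure L N C' by (rule N)
  have a: "a \<in> pow (univ M) k" and b: "b \<in> pow (univ N) k" using ab by (auto simp: same_type_def)
  obtain d where d: "M.valid r k m \<rho> d" "holds M d a" using M.ex_valid[OF \<rho> a less.prems(3)] by blast
  obtain j n \<gamma> \<theta> where deq: "d = (j, n, \<gamma>, \<theta>)" by (cases d)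
  then obtain q where q: "q \<in> pow (univ M) j" "sat M (nth (a @ q)) \<theta>" using d by auto
  have \<gamma>: "\<gamma> \<in> forms L (k + j + (m + n))" and fn: "functional_on M n (fsol M m \<rho> a) (graph_of M \<gamma> (a @ q))"
    and fg: "M.fib_graph C r m n (fsol M m \<rho> a) (graph_of M \<gamma> (a @ q))"
    using d(1) deq a q by auto
  obtain q' where q': "q' \<in> pow (univ N) j" "same_type L M N (k + j) (a @ q) (b @ q')"
    by (rule same_type_extend[OF N ab q(1)])
  have tk: "take k (a @ q) = a" "take k (b @ q') = b" using a b by (auto simp: pow_length)
  have u: "a @ q \<in> pow (univ M) (k + j)" "b @ q' \<in> pow (univ N) (k + j)"
    using a b q q' by (auto intro: pow_append)
  have fnN: "functional_on N n (fsol N m \<rho> b) (graph_of N \<gamma> (b @ q'))"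
    using same_type_tr[OF q'(2) functional_on_tr[OF \<rho> \<gamma>, of M N h]] fn tk by simp
  have fgN: "N.fib_graph C' r m n (fsol N m \<rho> b) (graph_of N \<gamma> (b @ q'))"
  proof (cases r)
    case 0
    then show ?thesis
      using same_type_tr[OF q'(2) inj_into_tr[OF \<rho> \<gamma> C]] fg tk
      by (simp add: N.fib_graph_def M.fib_graph_def)
  next
    case (Suc s)
    obtain \<iota> where \<iota>: "\<iota> \<in> forms L (k + j + n)"
      "\<And>u. u \<in> pow (univ M) (k + j) \<Longrightarrow> fsol M n \<iota> u = {y \<in> pow (univ M) n. \<exists>x\<in>fsol M m \<rho> (take k u). graph_of M \<gamma> u x y}"
      "\<And>u. u \<in> pow (univ N) (k + j) \<Longrightarrow> fsol N n \<iota> u = {y \<in> pow (univ N) n. \<exists>x\<in>fsol N m \<rho> (take k u). graph_of N \<gamma> u x y}"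
      by (rule image_formula[OF \<rho> \<gamma>, of M N]) blast
    obtain \<kappa> where \<kappa>: "\<kappa> \<in> forms L (k + j + n + m)"
      "\<And>u y. u \<in> pow (univ M) (k + j) \<Longrightarrow> y \<in> pow (univ M) n \<Longrightarrow>
         fsol M m \<kappa> (u @ y) = {x \<in> fsol M m \<rho> (take k u). graph_of M \<gamma> u x y}"
      "\<And>u y. u \<in> pow (univ N) (k + j) \<Longrightarrow> y \<in> pow (univ N) n \<Longrightarrow>
         fsol N m \<kappa> (u @ y) = {x \<in> fsol N m \<rho> (take k u). graph_of N \<gamma> u x y}"
      by (rule fiber_formula[OF \<rho> \<gamma>, of M N]) blast
    have s: "s < r" using Suc by simp
    have "fib_sat L M C s n (fsol M n \<iota> (a @ q))"
      using fg Suc \<iota>(2)[OF u(1)] tk by (simp add: M.fib_graph_def)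
    then have "fib_sat L N C' s n (fsol N n \<iota> (b @ q'))"
      by (rule less.IH[OF s q'(2) \<iota>(1)])
    moreover have "fib_sat L N C' s m (fsol N m \<kappa> ((b @ q') @ y'))" if y': "y' \<in> pow (univ N) n" for y'
    proof -
      obtain y where y: "y \<in> pow (univ M) n" "same_type L N M (k + j + n) ((b @ q') @ y') ((a @ q) @ y)"
        by (rule same_type_extend[OF M same_type_sym[OF q'(2)] y'])
      have "fib_sat L M C s m (fsol M m \<kappa> ((a @ q) @ y))"
        using fg Suc \<kappa>(2)[OF u(1) y(1)] y(1) tk by (simp add: M.fib_graph_def)
      then show ?thesis by (rule less.IH[OF s same_type_sym[OF y(2)] \<kappa>(1)])
    qed
    ultimately show ?thesis
      using Suc \<iota>(3)[OF u(2)] \<kappa>(3)[OF u(2)] tk by (simp add: N.fib_graph_def)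
  qed
  have "N.D (m + n) (\<lambda>z. graph_of N \<gamma> (b @ q') (take m z) (drop m z))"
    by (rule N.D_graph_of[OF \<gamma> u(2)])
  then show ?case
    unfolding N.fib_rel[of C' r m "fsol N m \<rho> b"] using N.fsol_definable[OF \<rho> b] fnN fgN by blast
qed

section \<open>Uniformly fiberable families\<close>

locale saturated_extension = fo_structure L M + N: saturated_structure L N C'
  for L :: "('f, 'r) lang" and M :: "('f, 'r, 'm) fo_struct" and N :: "('f, 'r, 'n) fo_struct" and C' +
  fixes h :: "'m \<Rightarrow> 'n" and C :: "'m set"
  assumes emb: "elem_emb L M N h"
    and C_star: "tr L M N h {} 1 (\<lambda>z. z \<in> pow C 1) (\<lambda>z. z \<in> pow C' 1)"
begin

lemma hU: "h ` U \<subseteq> univ N"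
  using emb by (simp add: elem_emb_def)

text \<open>The family version of \<open>transfer\<close>: \<open>F'\<close> is the family defined
  over \<open>N\<close> by a formula for \<open>F\<close>.\<close>

definition star :: "nat \<Rightarrow> nat \<Rightarrow> ('m list \<Rightarrow> 'm list set) \<Rightarrow> ('n list \<Rightarrow> 'n list set) \<Rightarrow> bool" where
  "star k m F F' \<longleftrightarrow> tr L M N h U (k + m) (\<lambda>z. drop k z \<in> F (take k z)) (\<lambda>z. drop k z \<in> F' (take k z)) \<and>
     (\<forall>p\<in>pow U k. F p \<subseteq> pow U m) \<and> (\<forall>p\<in>pow (univ N) k. F' p \<subseteq> pow (univ N) m)"

lemma tr_star:
  assumes "star k m F F'" "sel h U n k' s s'" "sel h U n m' t t'" "k' = k" "m' = m"
  shows "tr L M N h U n (\<lambda>z. t z \<in> F (s z)) (\<lambda>z. t' z \<in> F' (s' z))"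
  by (rule tr_fam[OF _ assms(2-5) order_refl hU]) (use assms(1) in \<open>simp add: star_def\<close>)

lemma star_dfam: "star k m F F' \<Longrightarrow> dfam k m F" and star_dfamN: "star k m F F' \<Longrightarrow> N.dfam k m F'"
  using tr_left tr_right[OF _ hU] unfolding star_def dfam_def N.dfam_def D_def N.D_def by blast+

lemma star_exists:
  assumes "dfam k m F"
  obtains F' where "star k m F F'"
proof -
  from assms have "tr L M M id U (k + m) (\<lambda>z. drop k z \<in> F (take k z)) (\<lambda>z. drop k z \<in> F (take k z))"
    by (simp add: dfam_def D_def)
  then obtain P' where P': "tr L M N h U (k + m) (\<lambda>z. drop k z \<in> F (take k z)) P'" by (rule tr_extend)
  have "star k m F (\<lambda>p. {x \<in> pow (univ N) m. P' (p @ x)})"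
    unfolding star_def
  proof (intro conjI)
    show "tr L M N h U (k + m) (\<lambda>z. drop k z \<in> F (take k z)) (\<lambda>z. drop k z \<in> {x \<in> pow (univ N) m. P' (take k z @ x)})"
      by (rule tr_cong[OF P']) (auto dest: pow_drop)
  qed (use assms in \<open>auto simp: dfam_def\<close>)
  then show ?thesis using that by blast
qed

lemma sentence: "tr L M N h U 0 (\<lambda>_. P) (\<lambda>_. P') \<Longrightarrow> P \<longleftrightarrow> P'"
  using tr_elementary[OF emb order_refl, of 0 "\<lambda>_. P" "\<lambda>_. P'" "[]"] by simp

text \<open>All parameters over \<open>N\<close> are included. Knowing only that the members over
  \<open>M\<close> are fiberable would not give compactness in \<open>N\<close> the covering that it
  reduces to finitely many fibrations.\<close>

definition Kf :: "nat \<Rightarrow> nat \<Rightarrow> nat \<Rightarrow> ('m list \<Rightarrow> 'm list set) \<Rightarrow> bool" where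
  "Kf r k m F \<longleftrightarrow> (\<exists>F'. star k m F F' \<and> (\<forall>p\<in>pow (univ N) k. fib_sat L N C' r m (F' p)))"

lemma Kf_dfam: "Kf r k m F \<Longrightarrow> dfam k m F"
  unfolding Kf_def using star_dfam by blast

text \<open>That every \<open>G q\<close> lies in some \<open>F p\<close> is a first-order sentence
  with parameters from \<open>M\<close>, so the starred families inherit it, including members at
  parameters outside the image of \<open>h\<close>.\<close>

lemma Kf_sub:
  assumes "Kf r k m F" "dfam l m G" "\<And>q. q \<in> pow U l \<Longrightarrow> \<exists>p\<in>pow U k. G q \<subseteq> F p"
  shows "Kf r l m G"
proof -
  obtain F' where F': "star k m F F'" "\<And>p. p\<in>pow (univ N) k \<Longrightarrow> fib_sat L N C' r m (F' p)"
    using assms(1) unfolding Kf_def by blast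
  obtain G' where G': "star l m G G'" using star_exists[OF assms(2)] .
  have tr: "tr L M N h U 0 (\<lambda>_. \<forall>q\<in>pow U l. \<exists>p\<in>pow U k. \<forall>x\<in>pow U m. x \<in> G q \<longrightarrow> x \<in> F p)
     (\<lambda>_. \<forall>q\<in>pow (univ N) l. \<exists>p\<in>pow (univ N) k. \<forall>x\<in>pow (univ N) m. x \<in> G' q \<longrightarrow> x \<in> F' p)"
    by (rule tr_star[OF F'(1)] tr_star[OF G'] tr_all tr_ex tr_imp sel_intros | simp del: take_take drop_drop)+
  have "\<forall>q\<in>pow U l. \<exists>p\<in>pow U k. \<forall>x\<in>pow U m. x \<in> G q \<longrightarrow> x \<in> F p" using assms(3) by blast
  then have sub: "\<forall>q\<in>pow (univ N) l. \<exists>p\<in>pow (univ N) k. \<forall>x\<in>pow (univ N) m. x \<in> G' q \<longrightarrow> x \<in> F' p"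
    using sentence[OF tr] by blast
  have "fib_sat L N C' r m (G' q)" if q: "q \<in> pow (univ N) l" for q
  proof -
    obtain p where p: "p \<in> pow (univ N) k" "\<forall>x\<in>pow (univ N) m. x \<in> G' q \<longrightarrow> x \<in> F' p" using sub q by blast
    have def: "definable L N m (G' q)" by (rule N.dfam_inst[OF star_dfamN[OF G'] q])
    then have "G' q \<subseteq> F' p" using p(2) N.definable_in[OF def] by blast
    then show ?thesis by (rule N.fib_sub[OF F'(2)[OF p(1)] def])
  qed
  then show ?thesis using G' unfolding Kf_def by blast
qed

lemma Kf_cong: "Kf r k m F \<Longrightarrow> (\<And>p. p \<in> pow U k \<Longrightarrow> F p = G p) \<Longrightarrow> Kf r k m G"
  by (rule Kf_sub[of r k m F k G]) (auto intro: dfam_cong[OF Kf_dfam])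

lemma Kf_prod:
  assumes "Kf r 0 m (\<lambda>_. X)" "Kf r 0 n (\<lambda>_. Y)"
  shows "Kf r 0 (m + n) (\<lambda>_. tprod X Y)"
proof -
  obtain X' where X': "star 0 m (\<lambda>_. X) X'" "fib_sat L N C' r m (X' [])" using assms(1) unfolding Kf_def by auto
  obtain Y' where Y': "star 0 n (\<lambda>_. Y) Y'" "fib_sat L N C' r n (Y' [])" using assms(2) unfolding Kf_def by auto
  have sub: "X \<subseteq> pow U m" "X' [] \<subseteq> pow (univ N) m" "Y \<subseteq> pow U n" "Y' [] \<subseteq> pow (univ N) n"
    using X'(1) Y'(1) by (auto simp: star_def)
  have nil: "sel h U l 0 (\<lambda>_. []) (\<lambda>_. [])" for l by (rule sel_const) auto
  have "tr L M N h U (0 + (m + n)) (\<lambda>z. take m z \<in> X \<and> drop m z \<in> Y) (\<lambda>z. take m z \<in> X' [] \<and> drop m z \<in> Y' [])"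
    by (rule tr_conj tr_star[OF X'(1) nil] tr_star[OF Y'(1) nil] sel_intros | simp)+
  then have "star 0 (m + n) (\<lambda>_. tprod X Y) (\<lambda>_. tprod (X' []) (Y' []))"
    using tprod_sub[OF sub(1,3)] N.tprod_sub[OF sub(2,4)]
    by (simp add: star_def tprod_iff[OF sub(1)] N.tprod_iff[OF sub(2)])
  then show ?thesis using N.fib_tprod[OF X'(2) Y'(2)] unfolding Kf_def by blast
qed

lemma Kf_single:
  assumes "x \<in> pow U m"
  shows "Kf r 0 m (\<lambda>_. {x})"
proof -
  have hx: "map h x \<in> pow (univ N) m" using assms hU by (rule pow_map)
  have "tr L M N h U (0 + m) (\<lambda>z. z = x) (\<lambda>z. z = map h x)"
    by (rule tr_eq sel_const[OF assms refl] sel_intros | simp)+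
  then have "star 0 m (\<lambda>_. {x}) (\<lambda>_. {map h x})" using assms hx by (simp add: star_def)
  moreover have "fib_sat L N C' r m {map h x}"
    by (rule N.fib_subsingleton[OF N.definable_single[OF hx]]) auto
  ultimately show ?thesis unfolding Kf_def by blast
qed

lemma Kf_category: "family_category L M (Kf r)"
  by unfold_locales (fact Kf_dfam Kf_sub Kf_prod Kf_single)+

lemma Kf_Suc: "Kf r k m F \<Longrightarrow> Kf (Suc r) k m F"
  unfolding Kf_def using N.fib_Suc by blast

lemma Kf_le: "Kf r k m F \<Longrightarrow> r \<le> s \<Longrightarrow> Kf s k m F"
  unfolding Kf_def using N.fib_mono by blast

text \<open>Fiberability over \<open>N\<close> is known only where \<open>\<theta>\<close> holds.
  The condition is built into the family, which makes all other members empty and hence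
  fiberable.\<close>

lemma Kf_formula:
  assumes w: "sel h U b a w w'" and \<theta>: "\<theta> \<in> forms L a" and \<iota>: "\<iota> \<in> forms L (a + n)"
    and fib: "\<And>v. v \<in> pow (univ N) a \<Longrightarrow> sat N (nth v) \<theta> \<Longrightarrow> fib_sat L N C' r n (fsol N n \<iota> v)"
  shows "Kf r b n (\<lambda>u. {y \<in> fsol M n \<iota> (w u). sat M (nth (w u)) \<theta>})"
proof -
  have tb: "sel h U (b + n) b (take b) (take b)" using sel_take_id[of h U "b + n" b] by simp
  have T: "tr L M N h U (b + n) (\<lambda>z. sat M (nth (t z)) \<phi>) (\<lambda>z. sat N (nth (t' z)) \<phi>)"
    if "\<phi> \<in> forms L i" "sel h U (b + n) j t t'" "j = i" for \<phi> i j t t'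
    by (rule tr_sub[OF tr_mono[OF tr_form[OF that(1)]] that(2,3)]) (use hU in auto)
  have "tr L M N h U (b + n)
      (\<lambda>z. sat M (nth (w (take b z) @ drop b z)) \<iota> \<and> sat M (nth (w (take b z))) \<theta>)
      (\<lambda>z. sat N (nth (w' (take b z) @ drop b z)) \<iota> \<and> sat N (nth (w' (take b z))) \<theta>)"
    by (rule tr_conj T[OF \<iota>] T[OF \<theta>] sel_append sel_comp[OF w tb] sel_intros | simp)+
  then have "tr L M N h U (b + n) (\<lambda>z. drop b z \<in> {y \<in> fsol M n \<iota> (w (take b z)). sat M (nth (w (take b z))) \<theta>})
      (\<lambda>z. drop b z \<in> {y \<in> fsol N n \<iota> (w' (take b z)). sat N (nth (w' (take b z))) \<theta>})"
    by (rule tr_cong) (auto simp: fsol_def dest: pow_drop)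
  then have "star b n (\<lambda>u. {y \<in> fsol M n \<iota> (w u). sat M (nth (w u)) \<theta>})
      (\<lambda>u. {y \<in> fsol N n \<iota> (w' u). sat N (nth (w' u)) \<theta>})"
    by (auto simp: star_def fsol_def)
  moreover have "fib_sat L N C' r n {y \<in> fsol N n \<iota> (w' u). sat N (nth (w' u)) \<theta>}"
    if u: "u \<in> pow (univ N) b" for u
  proof (cases "sat N (nth (w' u)) \<theta>")
    case True
    then show ?thesis using fib[OF sel_in'[OF w hU u]] by simp
  next
    case False
    then show ?thesis using N.fib_subsingleton[OF N.definable_empty] by simp
  qed
  ultimately show ?thesis unfolding Kf_def by blast
qed

text \<open>The parameters \<open>ps\<close> become explicit variables between the index and the
  point, so that the results on parameter-free formulas apply.\<close>

lemma Kf_formulaE: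
  assumes "Kf r k m F"
  obtains l ps \<rho> where "ps \<in> pow U l" "\<rho> \<in> forms L (k + l + m)" "\<And>p. p \<in> pow U k \<Longrightarrow> F p = fsol M m \<rho> (p @ ps)"
    "\<And>p. p \<in> pow (univ N) k \<Longrightarrow> fib_sat L N C' r m (fsol N m \<rho> (p @ map h ps))"
proof -
  obtain F' where F': "star k m F F'" "\<And>p. p \<in> pow (univ N) k \<Longrightarrow> fib_sat L N C' r m (F' p)"
    using assms unfolding Kf_def by blast
  then have sub: "p \<in> pow U k \<Longrightarrow> F p \<subseteq> pow U m" "p' \<in> pow (univ N) k \<Longrightarrow> F' p' \<subseteq> pow (univ N) m" for p p'
    by (auto simp: star_def)
  from F'(1) have "tr L M N h U (k + m) (\<lambda>z. drop k z \<in> F (take k z)) (\<lambda>z. drop k z \<in> F' (take k z))"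
    by (simp add: star_def)
  then obtain l ps \<phi> where ps: "ps \<in> pow U l" and \<phi>: "\<phi> \<in> forms L (k + m + l)"
    "\<And>z. z \<in> pow U (k + m) \<Longrightarrow> drop k z \<in> F (take k z) \<longleftrightarrow> sat M (nth (z @ ps)) \<phi>"
    "\<And>z. z \<in> pow (univ N) (k + m) \<Longrightarrow> drop k z \<in> F' (take k z) \<longleftrightarrow> sat N (nth (z @ map h ps)) \<phi>"
    by (rule tr_paramE) blast
  have "tr L M N h {} (k + l + m)
      (\<lambda>z. sat M (nth (take k z @ drop (k + l) z @ drop k (take (k + l) z))) \<phi>)
      (\<lambda>z. sat N (nth (take k z @ drop (k + l) z @ drop k (take (k + l) z))) \<phi>)"
    by (rule tr_sub0[OF \<phi>(1)] sel_intros | simp)+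
  then obtain \<rho> where \<rho>: "\<rho> \<in> forms L (k + l + m)"
    "\<And>z. z \<in> pow U (k + l + m) \<Longrightarrow> sat M (nth (take k z @ drop (k + l) z @ drop k (take (k + l) z))) \<phi> \<longleftrightarrow> sat M (nth z) \<rho>"
    "\<And>z. z \<in> pow (univ N) (k + l + m) \<Longrightarrow> sat N (nth (take k z @ drop (k + l) z @ drop k (take (k + l) z))) \<phi> \<longleftrightarrow> sat N (nth z) \<rho>"
    by (rule tr_formE) blast
  have hps: "map h ps \<in> pow (univ N) l" using ps hU by (rule pow_map)
  have "F p = fsol M m \<rho> (p @ ps)" if p: "p \<in> pow U k" for p
  proof -
    have "x \<in> F p \<longleftrightarrow> sat M (nth ((p @ ps) @ x)) \<rho>" if x: "x \<in> pow U m" for x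
      using \<rho>(2)[OF pow_append[OF pow_append[OF p ps] x]] \<phi>(2)[OF pow_append[OF p x]] pow_length[OF p] pow_length[OF ps]
      by simp
    then show ?thesis using sub(1)[OF p] by (auto simp: fsol_def)
  qed
  moreover have "F' p = fsol N m \<rho> (p @ map h ps)" if p: "p \<in> pow (univ N) k" for p
  proof -
    have "x \<in> F' p \<longleftrightarrow> sat N (nth ((p @ map h ps) @ x)) \<rho>" if x: "x \<in> pow (univ N) m" for x
      using \<rho>(3)[OF pow_append[OF pow_append[OF p hps] x]] \<phi>(3)[OF pow_append[OF p x]] pow_length[OF p] pow_length[OF hps]
      by simp
    then show ?thesis using sub(2)[OF p] by (auto simp: fsol_def)
  qed
  ultimately show ?thesis using that[OF ps \<rho>(1)] F'(2) by metis
qed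

text \<open>A parameter in \<open>N\<close> to which no valid datum applies is excluded by
  \<open>ex_valid\<close>, so finitely many data suffice by compactness. For a fixed finite set of
  data this is a sentence, and it descends to \<open>M\<close>.\<close>

lemma finite_cover:
  assumes ps: "ps \<in> pow U l" and \<rho>: "\<rho> \<in> forms L (k + l + m)"
    and fib: "\<And>p. p \<in> pow (univ N) k \<Longrightarrow> fib_sat L N C' r m (fsol N m \<rho> (p @ map h ps))"
  obtains S where "finite S" "\<And>d. d \<in> S \<Longrightarrow> N.valid r (k + l) m \<rho> d"
    "\<And>p. p \<in> pow U k \<Longrightarrow> \<exists>d\<in>S. holds M d (p @ ps)"
proof -
  have hps: "map h ps \<in> pow (univ N) l" using ps hU by (rule pow_map)
  let ?V = "{d. N.valid r (k + l) m \<rho> d}"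
  have holds_tr: "tr L M N h {} (k + l) (holds M d) (holds N d)" if d: "d \<in> ?V" for d
  proof -
    obtain j n \<gamma> \<theta> where deq: "d = (j, n, \<gamma>, \<theta>)" by (cases d)
    then have \<theta>: "\<theta> \<in> forms L (k + l + j)" using d by simp
    have "tr L M N h {} (k + l) (\<lambda>p. \<exists>q\<in>pow U j. sat M (nth (p @ q)) \<theta>) (\<lambda>p. \<exists>q\<in>pow (univ N) j. sat N (nth (p @ q)) \<theta>)"
      by (rule tr_ex tr_sub0[OF \<theta>] sel_intros | simp)+
    then show ?thesis by (rule tr_cong) (simp_all add: deq)
  qed
  have "\<exists>S. finite S \<and> S \<subseteq> ?V \<and> (\<forall>p\<in>pow (univ N) k. \<exists>d\<in>S. holds N d (p @ map h ps))" (is ?cov)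
  proof (rule ccontr)
    assume neg: "\<not> ?cov"
    have "\<exists>p\<in>pow (univ N) k. \<forall>T\<in>(\<lambda>d z. \<not> holds N d z) ` ?V. T (p @ map h ps)"
    proof (rule N.compactness[OF _ hps])
      fix T assume "T \<in> (\<lambda>d z. \<not> holds N d z) ` ?V"
      then obtain d where d: "d \<in> ?V" "T = (\<lambda>z. \<not> holds N d z)" by blast
      have "tr L N N id {} (k + l) (holds N d) (holds N d)"
        using holds_tr[OF d(1)] by (rule tr_right0)
      then show "N.D0 (k + l) T" unfolding N.D0_def d(2) by (rule tr_neg)
    next
      fix \<S> assume "finite \<S>" "\<S> \<subseteq> (\<lambda>d z. \<not> holds N d z) ` ?V"
      then obtain S where S: "S \<subseteq> ?V" "finite S" "\<S> = (\<lambda>d z. \<not> holds N d z) ` S" using finite_subset_image by meson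
      have "\<not> (\<forall>p\<in>pow (univ N) k. \<exists>d\<in>S. holds N d (p @ map h ps))"
      proof
        assume "\<forall>p\<in>pow (univ N) k. \<exists>d\<in>S. holds N d (p @ map h ps)"
        with S(1,2) have ?cov by (intro exI[of _ S] conjI)
        with neg show False ..
      qed
      then show "\<exists>p\<in>pow (univ N) k. \<forall>T\<in>\<S>. T (p @ map h ps)" using S(3) by auto
    qed
    then obtain p where p: "p \<in> pow (univ N) k" "\<And>d. N.valid r (k + l) m \<rho> d \<Longrightarrow> \<not> holds N d (p @ map h ps)" by auto
    then show False using N.ex_valid[OF \<rho> pow_append[OF p(1) hps] fib[OF p(1)]] by blast
  qed
  then obtain S where S: "finite S" "S \<subseteq> ?V" "\<forall>p\<in>pow (univ N) k. \<exists>d\<in>S. holds N d (p @ map h ps)" by blast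
  have "tr L M N h U 0 (\<lambda>_. \<forall>p\<in>pow U k. \<exists>d\<in>S. holds M d (p @ ps)) (\<lambda>_. \<forall>p\<in>pow (univ N) k. \<exists>d\<in>S. holds N d (p @ map h ps))"
  proof (rule tr_all, rule tr_fin_ex[OF S(1)])
    fix d assume "d \<in> S"
    then have d: "d \<in> ?V" using S(2) by blast
    show "tr L M N h U (0 + k) (\<lambda>w. holds M d (drop 0 w @ ps)) (\<lambda>w. holds N d (drop 0 w @ map h ps))"
      by (rule tr_sub[OF tr_mono[OF holds_tr[OF d]], of U])
        (rule sel_const[OF ps refl] sel_intros | simp add: hU)+
  qed
  from sentence[OF this] S show ?thesis using that[of S] by blast
qed

text \<open>Functionality and injectivity are first-order, and hence descend from \<open>N\<close>
  to \<open>M\<close> by elementarity. For image and fibers, fiberability over all of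
  \<open>N\<close> is what \<open>Kf\<close> asks for, so validity in \<open>N\<close> is used
  directly through \<open>Kf_formula\<close>.\<close>

lemma datum_step:
  assumes ps: "ps \<in> pow U l" and \<rho>: "\<rho> \<in> forms L (k + l + m)"
    and F: "\<And>p. p \<in> pow U k \<Longrightarrow> F p = fsol M m \<rho> (p @ ps)"
    and d: "N.valid r (k + l) m \<rho> (j, n, \<gamma>, \<theta>)"
    and Q: "Q = (\<lambda>u. sat M (nth (take k u @ ps @ drop k u)) \<theta>)"
    and G: "G = (\<lambda>u. graph_of M \<gamma> (take k u @ ps @ drop k u))"
  shows "D (k + j) Q"
    and "D (k + j + (m + n)) (\<lambda>z. G (take (k + j) z) (take m (drop (k + j) z)) (drop m (drop (k + j) z)))"
    and "\<And>p q. p \<in> pow U k \<Longrightarrow> q \<in> pow U j \<Longrightarrow> Q (p @ q) \<Longrightarrow> functional_on M n (F p) (G (p @ q))"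
    and "\<And>p q. r = 0 \<Longrightarrow> p \<in> pow U k \<Longrightarrow> q \<in> pow U j \<Longrightarrow> Q (p @ q) \<Longrightarrow> inj_into M C n (F p) (G (p @ q))"
    and "\<And>s. r = Suc s \<Longrightarrow> Kf s (k + j) n (\<lambda>u. {y \<in> pow U n. Q u \<and> (\<exists>x\<in>F (take k u). G u x y)})"
    and "\<And>s. r = Suc s \<Longrightarrow> Kf s (k + j + n) m (\<lambda>u. {x \<in> F (take k u). Q (take (k + j) u) \<and> G (take (k + j) u) x (drop (k + j) u)})"
proof -
  have \<gamma>: "\<gamma> \<in> forms L (k + l + j + (m + n))" and \<theta>: "\<theta> \<in> forms L (k + l + j)" using d by auto
  have T: "tr L M N h U i (\<lambda>z. sat M (nth (t z)) \<phi>) (\<lambda>z. sat N (nth (t' z)) \<phi>)"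
    if "\<phi> \<in> forms L a" "sel h U i b t t'" "b = a" for \<phi> a b i t t'
    by (rule tr_sub[OF tr_mono[OF tr_form[OF that(1)]] that(2,3)]) (use hU in auto)
  have TD: "D i (\<lambda>z. sat M (nth (t z)) \<phi>)" if "\<phi> \<in> forms L a" "select i b t" "b = a" for \<phi> a b i t
    unfolding D_def by (rule tr_sub[OF tr_mono[OF tr_form[OF that(1)]] that(2)[unfolded select_def] that(3)]) auto
  show "D (k + j) Q" unfolding Q
    by (rule TD[OF \<theta>] select_const[OF ps] select_intros | simp)+
  show "D (k + j + (m + n)) (\<lambda>z. G (take (k + j) z) (take m (drop (k + j) z)) (drop m (drop (k + j) z)))"
    unfolding G graph_of_def by (rule TD[OF \<gamma>] select_const[OF ps] select_intros | simp del: take_take drop_drop)+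
  have validN: "functional_on N n (fsol N m \<rho> (take (k + l) v)) (graph_of N \<gamma> v) \<and> N.fib_graph C' r m n (fsol N m \<rho> (take (k + l) v)) (graph_of N \<gamma> v)"
    if v: "v \<in> pow (univ N) (k + l + j)" "sat N (nth v) \<theta>" for v
  proof -
    from v(1) obtain p q where "p \<in> pow (univ N) (k + l)" "q \<in> pow (univ N) j" "v = p @ q" by (rule pow_splitE)
    then show ?thesis using d v(2) by (simp add: pow_length)
  qed
  have S0: "tr L M N h {} (k + l + j) (\<lambda>v. sat M (nth v) \<theta> \<longrightarrow> functional_on M n (fsol M m \<rho> (take (k + l) v)) (graph_of M \<gamma> v))
     (\<lambda>v. sat N (nth v) \<theta> \<longrightarrow> functional_on N n (fsol N m \<rho> (take (k + l) v)) (graph_of N \<gamma> v))"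
    by (rule tr_imp[OF tr_form[OF \<theta>] functional_on_tr[OF \<rho> \<gamma>]])
  have S1: "tr L M N h {} (k + l + j) (\<lambda>v. sat M (nth v) \<theta> \<longrightarrow> inj_into M C n (fsol M m \<rho> (take (k + l) v)) (graph_of M \<gamma> v))
     (\<lambda>v. sat N (nth v) \<theta> \<longrightarrow> inj_into N C' n (fsol N m \<rho> (take (k + l) v)) (graph_of N \<gamma> v))"
    by (rule tr_imp[OF tr_form[OF \<theta>] inj_into_tr[OF \<rho> \<gamma> C_star]])
  have into: "P v" if "tr L M N h {} i P P'" "\<And>v. v \<in> pow (univ N) i \<Longrightarrow> P' v" "v \<in> pow U i" for P P' i v
    using tr_elementary[OF emb _ that(1,3)] that(2)[OF pow_map[OF that(3) hU]] by simp
  have w: "take k (p @ q) @ ps @ drop k (p @ q) = (p @ ps) @ q" "(p @ ps) @ q \<in> pow U (k + l + j)"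
    "take (k + l) ((p @ ps) @ q) = p @ ps"
    if "p \<in> pow U k" "q \<in> pow U j" for p q
    using that ps by (auto simp: pow_length add.assoc intro!: pow_append)
  show "functional_on M n (F p) (G (p @ q))" if "p \<in> pow U k" "q \<in> pow U j" "Q (p @ q)" for p q
    using into[OF S0 _ w(2)[OF that(1,2)]] validN that F[OF that(1)] w(1,3)[OF that(1,2)]
    unfolding Q G by simp
  show "inj_into M C n (F p) (G (p @ q))" if "r = 0" "p \<in> pow U k" "q \<in> pow U j" "Q (p @ q)" for p q
    using into[OF S1 _ w(2)[OF that(2,3)]] validN that F[OF that(2)] w(1,3)[OF that(2,3)]
    unfolding Q G by (simp add: N.fib_graph_def)
  fix s assume s: "r = Suc s"
  obtain \<iota> where \<iota>: "\<iota> \<in> forms L (k + l + j + n)"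
    "\<And>u. u \<in> pow U (k + l + j) \<Longrightarrow> fsol M n \<iota> u = {y \<in> pow U n. \<exists>x\<in>fsol M m \<rho> (take (k + l) u). graph_of M \<gamma> u x y}"
    "\<And>u. u \<in> pow (univ N) (k + l + j) \<Longrightarrow> fsol N n \<iota> u = {y \<in> pow (univ N) n. \<exists>x\<in>fsol N m \<rho> (take (k + l) u). graph_of N \<gamma> u x y}"
    by (rule image_formula[OF \<rho> \<gamma>, of M N]) blast
  obtain \<kappa> where \<kappa>: "\<kappa> \<in> forms L (k + l + j + n + m)"
    "\<And>u y. u \<in> pow U (k + l + j) \<Longrightarrow> y \<in> pow U n \<Longrightarrow>
       fsol M m \<kappa> (u @ y) = {x \<in> fsol M m \<rho> (take (k + l) u). graph_of M \<gamma> u x y}"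
    "\<And>u y. u \<in> pow (univ N) (k + l + j) \<Longrightarrow> y \<in> pow (univ N) n \<Longrightarrow>
       fsol N m \<kappa> (u @ y) = {x \<in> fsol N m \<rho> (take (k + l) u). graph_of N \<gamma> u x y}"
    by (rule fiber_formula[OF \<rho> \<gamma>, of M N]) blast
  \<comment> \<open>\<open>\<theta>\<close> is reread with \<open>n\<close> further variables, since
    the family of fibers has the additional index \<open>y\<close>.\<close>
  have \<theta>n: "\<theta> \<in> forms L (k + l + j + n)" using \<theta> by (auto simp: forms_def)
  have \<theta>s: "sat Z (nth (v @ y)) \<theta> \<longleftrightarrow> sat Z (nth v) \<theta>" if "length v = k + l + j" for Z :: "('f, 'r, 'z) fo_struct" and v y
    using \<theta> that by (intro sat_nth_append) (auto simp: forms_def)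
  have "Kf s (k + j) n (\<lambda>u. {y \<in> fsol M n \<iota> (take k u @ ps @ drop k u). sat M (nth (take k u @ ps @ drop k u)) \<theta>})"
  proof (rule Kf_formula[OF _ \<theta> \<iota>(1)])
    have "sel h U (k + j) (k + (l + j)) (\<lambda>u. take k u @ ps @ drop k u) (\<lambda>u. take k u @ map h ps @ drop k u)"
      using sel_append[OF sel_take_id sel_append[OF sel_const[OF ps refl] sel_drop_id], of h "k + j" k k] by simp
    then show "sel h U (k + j) (k + l + j) (\<lambda>u. take k u @ ps @ drop k u) (\<lambda>u. take k u @ map h ps @ drop k u)"
      by (simp add: add.assoc)
    fix v assume v: "v \<in> pow (univ N) (k + l + j)" "sat N (nth v) \<theta>"
    show "fib_sat L N C' s n (fsol N n \<iota> v)"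
      using validN[OF v] s \<iota>(3)[OF v(1)] by (simp add: N.fib_graph_def)
  qed
  then show "Kf s (k + j) n (\<lambda>u. {y \<in> pow U n. Q u \<and> (\<exists>x\<in>F (take k u). G u x y)})"
  proof (rule Kf_cong)
    fix u assume "u \<in> pow U (k + j)"
    then obtain p q where pq: "p \<in> pow U k" "q \<in> pow U j" "u = p @ q" by (rule pow_splitE)
    have tk: "take k u = p" "drop k u = q" using pq by (simp_all add: pow_length)
    have w': "p @ ps @ q \<in> pow U (k + l + j)" "take (k + l) (p @ ps @ q) = p @ ps"
      using w[OF pq(1,2)] by (auto simp: pow_length)
    show "{y \<in> fsol M n \<iota> (take k u @ ps @ drop k u). sat M (nth (take k u @ ps @ drop k u)) \<theta>} =
        {y \<in> pow U n. Q u \<and> (\<exists>x\<in>F (take k u). G u x y)}"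
      unfolding Q G tk F[OF pq(1)] \<iota>(2)[OF w'(1)] w'(2) by auto
  qed
  have "Kf s (k + j + n) m (\<lambda>u. {x \<in> fsol M m \<kappa> ((take k u @ ps @ drop k (take (k + j) u)) @ drop (k + j) u).
      sat M (nth ((take k u @ ps @ drop k (take (k + j) u)) @ drop (k + j) u)) \<theta>})"
  proof (rule Kf_formula[OF _ \<theta>n \<kappa>(1)])
    have "sel h U (k + j + n) (k + l + j + n) (\<lambda>u. (take k u @ ps @ drop k (take (k + j) u)) @ drop (k + j) u)
       (\<lambda>u. (take k u @ map h ps @ drop k (take (k + j) u)) @ drop (k + j) u)"
      by (rule sel_eq_length, (rule sel_const[OF ps refl] sel_intros)+, simp)
    then show "sel h U (k + j + n) (k + l + j + n) (\<lambda>u. (take k u @ ps @ drop k (take (k + j) u)) @ drop (k + j) u)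
       (\<lambda>u. (take k u @ map h ps @ drop k (take (k + j) u)) @ drop (k + j) u)" .
    fix v assume v: "v \<in> pow (univ N) (k + l + j + n)" "sat N (nth v) \<theta>"
    then obtain u y where uy: "u \<in> pow (univ N) (k + l + j)" "y \<in> pow (univ N) n" "v = u @ y" by (meson pow_splitE)
    then have "sat N (nth u) \<theta>" using v(2) \<theta>s[of u N y] by (simp add: pow_length)
    from validN[OF uy(1) this] show "fib_sat L N C' s m (fsol N m \<kappa> v)"
      using s \<kappa>(3)[OF uy(1,2)] uy by (simp add: N.fib_graph_def)
  qed
  then show "Kf s (k + j + n) m (\<lambda>u. {x \<in> F (take k u). Q (take (k + j) u) \<and> G (take (k + j) u) x (drop (k + j) u)})"
  proof (rule Kf_cong)
    fix u assume "u \<in> pow U (k + j + n)"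
    then obtain u' y where u': "u' \<in> pow U (k + j)" "y \<in> pow U n" "u = u' @ y" by (rule pow_splitE)
    from u'(1) obtain p q where pq: "p \<in> pow U k" "q \<in> pow U j" "u' = p @ q" by (rule pow_splitE)
    have tk: "take k u = p" "take (k + j) u = p @ q" "drop (k + j) u = y" "drop k (p @ q) = q" "take k (p @ q) = p"
      using pq u' by (auto simp: pow_length)
    have w': "p @ ps @ q \<in> pow U (k + l + j)" "length (p @ ps @ q) = k + l + j" "take (k + l) (p @ ps @ q) = p @ ps"
      using w[OF pq(1,2)] pow_length[OF w(2)[OF pq(1,2)]] by simp_all
    show "{x \<in> fsol M m \<kappa> ((take k u @ ps @ drop k (take (k + j) u)) @ drop (k + j) u).
      sat M (nth ((take k u @ ps @ drop k (take (k + j) u)) @ drop (k + j) u)) \<theta>} =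
      {x \<in> F (take k u). Q (take (k + j) u) \<and> G (take (k + j) u) x (drop (k + j) u)}"
      unfolding Q G tk F[OF pq(1)] \<kappa>(2)[OF w'(1) u'(2)] \<theta>s[OF w'(2)] w'(3) by auto
  qed
qed

end

section \<open>Reduction of a family by one fibration step\<close>

context saturated_extension
begin

text \<open>Combines embeddings into powers of \<open>C\<close> for \<open>r = 0\<close> with
  fibrations over \<open>Kf s\<close> for \<open>r = Suc s\<close>, so that one compactness argument
  serves both.\<close>

fun good_step :: "nat \<Rightarrow> nat \<Rightarrow> nat \<Rightarrow> ('m list \<Rightarrow> 'm list set) \<Rightarrow> 'm step \<Rightarrow> bool" where
  "good_step r k m F (j, n, Q, G) \<longleftrightarrow> D (k + j) Q \<and>
     D (k + j + (m + n)) (\<lambda>z. G (take (k + j) z) (take m (drop (k + j) z)) (drop m (drop (k + j) z))) \<and>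
     (\<forall>p\<in>pow U k. \<forall>q\<in>pow U j. Q (p @ q) \<longrightarrow> functional_on M n (F p) (G (p @ q))) \<and>
     (r = 0 \<longrightarrow> (\<forall>p\<in>pow U k. \<forall>q\<in>pow U j. Q (p @ q) \<longrightarrow> inj_into M C n (F p) (G (p @ q)))) \<and>
     (\<forall>s. r = Suc s \<longrightarrow> Kf s (k + j) n (\<lambda>u. {y \<in> pow U n. Q u \<and> (\<exists>x\<in>F (take k u). G u x y)}) \<and>
        Kf s (k + j + n) m (\<lambda>u. {x \<in> F (take k u). Q (take (k + j) u) \<and> G (take (k + j) u) x (drop (k + j) u)}))"

lemma Kf_steps:
  assumes "Kf r k m F"
  shows "\<exists>S. finite S \<and> (\<forall>d\<in>S. good_step r k m F d) \<and> (\<forall>p\<in>pow U k. \<exists>d\<in>S. applies U d p)"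
proof -
  obtain l ps \<rho> where ps: "ps \<in> pow U l" and \<rho>: "\<rho> \<in> forms L (k + l + m)"
    and F: "\<And>p. p \<in> pow U k \<Longrightarrow> F p = fsol M m \<rho> (p @ ps)"
    and fib: "\<And>p. p \<in> pow (univ N) k \<Longrightarrow> fib_sat L N C' r m (fsol N m \<rho> (p @ map h ps))"
    by (rule Kf_formulaE[OF assms]) blast
  obtain S0 where S0: "finite S0" "\<And>d. d \<in> S0 \<Longrightarrow> N.valid r (k + l) m \<rho> d"
    "\<And>p. p \<in> pow U k \<Longrightarrow> \<exists>d\<in>S0. holds M d (p @ ps)"
    by (rule finite_cover[OF ps \<rho> fib]) blast+
  define mk :: "('f, 'r) datum \<Rightarrow> 'm step" where "mk = (\<lambda>(j, n, \<gamma>, \<theta>).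
    (j, n, \<lambda>u. sat M (nth (take k u @ ps @ drop k u)) \<theta>, \<lambda>u. graph_of M \<gamma> (take k u @ ps @ drop k u)))"
  have "good_step r k m F (mk d)" if d: "d \<in> S0" for d
  proof -
    obtain j n \<gamma> \<theta> where deq: "d = (j, n, \<gamma>, \<theta>)" by (cases d)
    have v: "N.valid r (k + l) m \<rho> (j, n, \<gamma>, \<theta>)" using S0(2)[OF d] deq by simp
    note step = datum_step[OF ps \<rho> F v refl refl]
    show ?thesis unfolding deq mk_def prod.case good_step.simps
      by (intro conjI ballI impI allI step; assumption)
  qed
  moreover have "\<exists>d\<in>mk ` S0. applies U d p" if p: "p \<in> pow U k" for p
  proof -
    from S0(3)[OF p] obtain d where d: "d \<in> S0" "holds M d (p @ ps)" by blast
    obtain j n \<gamma> \<theta> where deq: "d = (j, n, \<gamma>, \<theta>)" by (cases d)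
    have "applies U (mk d) p" using d(2) p by (auto simp: deq mk_def pow_length)
    then show ?thesis using d(1) by blast
  qed
  ultimately show ?thesis using S0(1) by (intro exI[of _ "mk ` S0"]) simp
qed

lemma Kf_extension: "family_extension L M (Kf r) (Kf (Suc r))"
proof -
  interpret K: family_category L M "Kf r" by (rule Kf_category)
  interpret K': family_category L M "Kf (Suc r)" by (rule Kf_category)
  have step_ok: "K.step_case k m F d" if "good_step (Suc r) k m F d" for k m F d
  proof -
    obtain j n Q G where deq: "d = (j, n, Q, G)" by (cases d)
    note g = that[unfolded deq good_step.simps]
    have "\<exists>!y. y \<in> pow U n \<and> G (p @ q) x y"
      if "p \<in> pow U k" "q \<in> pow U j" "Q (p @ q)" and x: "x \<in> F p" for p q x
    proof -
      have "functional_on M n (F p) (G (p @ q))" using g that(1-3) by simp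
      from bspec[OF this[unfolded functional_on_def] x]
      obtain y where "y \<in> pow U n" "G (p @ q) x y" "\<forall>y'\<in>pow U n. G (p @ q) x y' \<longrightarrow> y' = y" by blast
      then show ?thesis by blast
    qed
    then show ?thesis unfolding deq K.step_case.simps using g by simp
  qed
  show ?thesis
  proof
    show "Kf (Suc r) k m F" if "Kf r k m F" for k m F using that by (rule Kf_Suc)
    fix k m F assume "Kf (Suc r) k m F"
    from Kf_steps[OF this] obtain S where "finite S" "\<forall>d\<in>S. good_step (Suc r) k m F d"
      "\<forall>p\<in>pow U k. \<exists>d\<in>S. applies U d p" by blast
    then show "\<exists>S. finite S \<and> (\<forall>d\<in>S. K.step_case k m F d) \<and> (\<forall>p\<in>pow U k. \<exists>d\<in>S. applies U d p)"
      using step_ok by (intro exI[of _ S]) simp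
  qed
qed

end

section \<open>The measure on sets that embed into powers of \<open>C\<close>\<close>

context fo_structure
begin

lemma fubini_measureD:
  assumes "fubini_measure L M Ob \<rho>"
  shows "(m, X) \<in> Ob \<Longrightarrow> definable L M m X"
    and "(m, X) \<in> Ob \<Longrightarrow> definable L M m Y \<Longrightarrow> Y \<subseteq> X \<Longrightarrow> (m, Y) \<in> Ob"
    and "(m, {}) \<in> Ob \<Longrightarrow> \<rho> (m, {}) = 0"
    and "(m, {x}) \<in> Ob \<Longrightarrow> \<rho> (m, {x}) = 1"
    and "(m, X) \<in> Ob \<Longrightarrow> (m, Y) \<in> Ob \<Longrightarrow> X \<inter> Y = {} \<Longrightarrow> \<rho> (m, X \<union> Y) = \<rho> (m, X) + \<rho> (m, Y)"
proof -
  have adm: "admissible L M Ob" using assms by (simp add: fubini_measure_def)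
  have "Ob \<subseteq> Def_objs L M" using adm by (simp add: admissible_def)
  moreover have "\<And>m X Y. (m, X) \<in> Ob \<Longrightarrow> Y \<subseteq> X \<Longrightarrow> definable L M m Y \<Longrightarrow> (m, Y) \<in> Ob"
    by (rule adm[unfolded admissible_def, THEN conjunct2, THEN conjunct2, THEN conjunct1, rule_format]) blast
  ultimately show "(m, X) \<in> Ob \<Longrightarrow> definable L M m X" "(m, X) \<in> Ob \<Longrightarrow> definable L M m Y \<Longrightarrow> Y \<subseteq> X \<Longrightarrow> (m, Y) \<in> Ob"
    by (auto simp: Def_objs_def)
  show "(m, {}) \<in> Ob \<Longrightarrow> \<rho> (m, {}) = 0" "(m, {x}) \<in> Ob \<Longrightarrow> \<rho> (m, {x}) = 1"
    "(m, X) \<in> Ob \<Longrightarrow> (m, Y) \<in> Ob \<Longrightarrow> X \<inter> Y = {} \<Longrightarrow> \<rho> (m, X \<union> Y) = \<rho> (m, X) + \<rho> (m, Y)"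
    using assms unfolding fubini_measure_def by simp_all
qed

lemma fubini_measure_map:
  assumes "fubini_measure L M Ob \<rho>" "(m, X) \<in> Ob" "(n, Y) \<in> Ob" "dmap m X n Y f"
  shows "finite ((\<lambda>y. \<rho> (m, fiber X f y)) ` Y)" "definable L M n {y \<in> Y. \<rho> (m, fiber X f y) = a}"
    "(\<And>y. y \<in> Y \<Longrightarrow> \<rho> (m, fiber X f y) = a) \<Longrightarrow> \<rho> (m, X) = a * \<rho> (n, Y)"
proof -
  have "definable_map L M (m, X) (n, Y) f"
    using assms(4) dmap_iff[OF dmap_dom[OF assms(4)] dmap_cod[OF assms(4)]] by blast
  with assms(2,3) have "finite {\<rho> (m, fiber X f y) | y. y \<in> Y} \<and>
      (\<forall>a. definable L M n {y \<in> Y. \<rho> (m, fiber X f y) = a}) \<and>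
      (\<forall>a. (\<forall>y\<in>Y. \<rho> (m, fiber X f y) = a) \<longrightarrow> \<rho> (m, X) = a * \<rho> (n, Y))"
    using assms(1) unfolding fubini_measure_def by (elim conjE) simp
  then show "finite ((\<lambda>y. \<rho> (m, fiber X f y)) ` Y)" "definable L M n {y \<in> Y. \<rho> (m, fiber X f y) = a}"
    "(\<And>y. y \<in> Y \<Longrightarrow> \<rho> (m, fiber X f y) = a) \<Longrightarrow> \<rho> (m, X) = a * \<rho> (n, Y)"
    by (simp_all add: image_def Collect_conj_eq conj_commute Bex_def cong: conj_cong)
qed

lemma D_rel:
  assumes "D (a + (m + n)) (\<lambda>z. G (take a z) (take m (drop a z)) (drop m (drop a z)))"
    "select i a' u" "select i m' s" "select i n' t" "a' = a" "m' = m" "n' = n"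
  shows "D i (\<lambda>z. G (u z) (s z) (t z))"
proof -
  have 1: "D i (\<lambda>z. (\<lambda>z. G (take a z) (take m (drop a z)) (drop m (drop a z))) (u z @ s z @ t z))"
    by (rule D_pred[OF assms(1)], rule select_append[OF assms(2) select_append[OF assms(3,4)]]) (use assms in simp)
  show ?thesis
    by (rule D_cong[OF 1]) (use assms select_length[OF assms(2)] select_length[OF assms(3)] in \<open>simp add: pow_length\<close>)
qed

text \<open>Transports \<open>g\<close> along the injection \<open>f\<close>. The graph is defined
  by quantifying over the preimage, so the chosen inverse is a definable map.\<close>

lemma dmap_image:
  assumes "dmap m X n Y f" "inj_on f X" "dmap m X l Z g"
  shows "dmap n (f ` X) l Z (\<lambda>y. g (inv_into X f y))"
proof (rule dmapI[OF definable_image[OF assms(1)] dmap_cod[OF assms(3)]])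
  have inv: "inv_into X f (f x) = x" if "x \<in> X" for x using assms(2) that by (rule inv_into_f_f)
  show "(\<lambda>y. g (inv_into X f y)) ` f ` X \<subseteq> Z" using dmap_maps[OF assms(3)] inv by auto
  have "D (n + l) (\<lambda>z. \<exists>x\<in>pow U m. (x \<in> X \<and> f x = take n z) \<and> (x \<in> X \<and> g x = drop n z))"
    by (rule D_ex D_conj[OF D_map[OF assms(1)] D_map[OF assms(3)]] select_intros | simp del: take_take drop_drop)+
  then show "D (n + l) (\<lambda>z. take n z \<in> f ` X \<and> g (inv_into X f (take n z)) = drop n z)"
  proof (rule D_cong)
    fix z
    show "(\<exists>x\<in>pow U m. (x \<in> X \<and> f x = take n z) \<and> (x \<in> X \<and> g x = drop n z)) \<longleftrightarrow>
      (take n z \<in> f ` X \<and> g (inv_into X f (take n z)) = drop n z)"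
    proof
      assume "\<exists>x\<in>pow U m. (x \<in> X \<and> f x = take n z) \<and> (x \<in> X \<and> g x = drop n z)"
      then obtain x where x: "x \<in> X" "f x = take n z" "g x = drop n z" by blast
      then have "inv_into X f (take n z) = x" using inv by metis
      then show "take n z \<in> f ` X \<and> g (inv_into X f (take n z)) = drop n z" using x by force
    next
      assume a: "take n z \<in> f ` X \<and> g (inv_into X f (take n z)) = drop n z"
      then obtain x where x: "x \<in> X" "f x = take n z" by force
      then have "g x = drop n z" using a inv by metis
      then show "\<exists>x\<in>pow U m. (x \<in> X \<and> f x = take n z) \<and> (x \<in> X \<and> g x = drop n z)"
        using x definable_in[OF dmap_dom[OF assms(1)]] by blast
    qed
  qed
qed

end

locale base_measure = saturated_extension L M N C' h C
  for L :: "('f, 'r) lang" and M :: "('f, 'r, 'm) fo_struct" and N :: "('f, 'r, 'n) fo_struct" and C' h C +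
  fixes \<mu> :: "'m obj \<Rightarrow> 'a::{comm_semiring_0, comm_monoid_mult}"
  assumes C_U: "C \<subseteq> U" and stable: "stably_embedded L M C" and mu: "fubini_measure L M (Def_sub L M C) \<mu>"
begin

lemma C_D: "D 1 (\<lambda>z. z \<in> pow C 1)"
  unfolding D_def by (rule tr_mono[OF tr_left[OF C_star]]) simp

lemma definable_pow_C: "definable L M n (pow C n)"
  unfolding definable_iff D_def
  using tr_pow[OF C_D[unfolded D_def] sel_id refl, of n] pow_mono[OF C_U] by simp

lemma Def_sub_iff: "(n, X) \<in> Def_sub L M C \<longleftrightarrow> definable L M n X \<and> X \<subseteq> pow C n"
  by (simp add: Def_sub_def)

lemma mu_empty: "\<mu> (m, {}) = 0"
  by (rule fubini_measureD(3)[OF mu]) (simp add: Def_sub_iff definable_empty)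

lemma mu_single: "x \<in> pow C m \<Longrightarrow> \<mu> (m, {x}) = 1"
  by (rule fubini_measureD(4)[OF mu])
    (use pow_mono[OF C_U] in \<open>auto simp: Def_sub_iff intro!: definable_single\<close>)

lemma mu_add:
  assumes "definable L M m X" "X \<subseteq> pow C m" "definable L M m Y" "Y \<subseteq> pow C m" "X \<inter> Y = {}"
  shows "\<mu> (m, X \<union> Y) = \<mu> (m, X) + \<mu> (m, Y)"
  by (rule fubini_measureD(5)[OF mu]) (use assms in \<open>simp_all add: Def_sub_iff\<close>)

lemma mu_map:
  assumes "dmap m X n Y f" "X \<subseteq> pow C m" "Y \<subseteq> pow C n"
  shows "finite ((\<lambda>y. \<mu> (m, fiber X f y)) ` Y)" "definable L M n {y \<in> Y. \<mu> (m, fiber X f y) = a}"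
    "(\<And>y. y \<in> Y \<Longrightarrow> \<mu> (m, fiber X f y) = a) \<Longrightarrow> \<mu> (m, X) = a * \<mu> (n, Y)"
proof -
  have "(m, X) \<in> Def_sub L M C" "(n, Y) \<in> Def_sub L M C"
    using assms by (auto simp: Def_sub_iff dmap_def)
  note map = fubini_measure_map[OF mu this assms(1)]
  show "finite ((\<lambda>y. \<mu> (m, fiber X f y)) ` Y)" "definable L M n {y \<in> Y. \<mu> (m, fiber X f y) = a}"
    by (rule map(1), rule map(2))
  show "(\<And>y. y \<in> Y \<Longrightarrow> \<mu> (m, fiber X f y) = a) \<Longrightarrow> \<mu> (m, X) = a * \<mu> (n, Y)" by (rule map(3))
qed

lemma mu_bij:
  assumes "dmap m X n Y f" "X \<subseteq> pow C m" "Y \<subseteq> pow C n" "bij_betw f X Y"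
  shows "\<mu> (m, X) = \<mu> (n, Y)"
proof -
  have "\<mu> (m, X) = 1 * \<mu> (n, Y)"
  proof (rule mu_map(3)[OF assms(1-3)])
    fix y assume "y \<in> Y"
    then obtain x where x: "x \<in> X" "f x = y" using assms(4) by (auto simp: bij_betw_def)
    then have "fiber X f y = {x}" using assms(4) by (auto simp: fiber_def bij_betw_def inj_on_def)
    then show "\<mu> (m, fiber X f y) = 1" using mu_single x(1) assms(2) by auto
  qed
  then show ?thesis by simp
qed

text \<open>Stable embeddedness parametrizes every definable family of subsets of \<open>C\<^sup>n\<close> by a power of \<open>C\<close>,
  where \<open>\<mu>\<close> is available.\<close>

lemma mu_simple:
  assumes E: "dfam l n E" and sub: "\<And>u. u \<in> pow U l \<Longrightarrow> E u \<subseteq> pow C n"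
  shows "simple l (\<lambda>u. \<mu> (n, E u))"
proof -
  have "tr L M M id U (l + n) (\<lambda>z. drop l z \<in> E (take l z)) (\<lambda>z. drop l z \<in> E (take l z))"
    using E by (simp add: dfam_def D_def)
  then obtain i ps \<phi> where ps: "ps \<in> pow U i" and \<phi>: "\<phi> \<in> forms L (l + n + i)"
    "\<And>z. z \<in> pow U (l + n) \<Longrightarrow> drop l z \<in> E (take l z) \<longleftrightarrow> sat M (nth (z @ ps)) \<phi>"
    by (rule tr_paramE) blast
  \<comment> \<open>Stable embeddedness speaks of 0-definable sets, so the parameters
    \<open>ps\<close> of the family become part of the index.\<close>
  have "tr L M M id {} (l + i + n)
      (\<lambda>z. sat M (nth (take l z @ drop (l + i) z @ drop l (take (l + i) z))) \<phi>)
      (\<lambda>z. sat M (nth (take l z @ drop (l + i) z @ drop l (take (l + i) z))) \<phi>)"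
    by (rule tr_sub0[OF \<phi>(1)] sel_intros | simp)+
  then obtain \<rho> where \<rho>: "\<rho> \<in> forms L (l + i + n)"
    "\<And>z. z \<in> pow U (l + i + n) \<Longrightarrow> sat M (nth (take l z @ drop (l + i) z @ drop l (take (l + i) z))) \<phi> \<longleftrightarrow> sat M (nth z) \<rho>"
    by (rule tr_formE) blast
  have E_iff: "y \<in> E u \<longleftrightarrow> (u @ ps) @ y \<in> solset M (l + i + n) \<rho> []" if "u \<in> pow U l" "y \<in> pow U n" for u y
    using \<rho>(2)[OF pow_append[OF pow_append[OF that(1) ps] that(2)]] \<phi>(2)[OF pow_append[OF that]]
      pow_append[OF pow_append[OF that(1) ps] that(2)] pow_length[OF that(1)] pow_length[OF ps]
    by (simp add: solset_def)
  have "definable0 L M (l + i + n) (solset M (l + i + n) \<rho> [])" using \<rho>(1) unfolding definable0_def by blast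
  then have "\<exists>k T. definable0 L M (k + n) T \<and> (\<forall>p\<in>pow U (l + i). \<exists>c\<in>pow C k.
      {q. p @ q \<in> solset M (l + i + n) \<rho> []} \<inter> pow C n = {q. c @ q \<in> T} \<inter> pow C n)"
    by (rule stable[unfolded stably_embedded_def, rule_format])
  then obtain k T where T: "definable0 L M (k + n) T"
    "\<And>p. p\<in>pow U (l + i) \<Longrightarrow> \<exists>c\<in>pow C k. {q. p @ q \<in> solset M (l + i + n) \<rho> []} \<inter> pow C n = {q. c @ q \<in> T} \<inter> pow C n"
    by blast
  have T_def: "definable L M (k + n) T"
    using T(1) unfolding definable0_def definable_def by (metis add.right_neutral empty_set empty_subsetI list.size(3))
  \<comment> \<open>Cut down to a power of \<open>C\<close>, so that it is an object on which
    \<open>\<mu>\<close> is defined.\<close>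
  define T' where "T' = T \<inter> pow C (k + n)"
  have T': "definable L M (k + n) T'" "T' \<subseteq> pow C (k + n)"
    unfolding T'_def using T_def definable_pow_C by (auto intro: definable_Int)
  have tk: "dmap (k + n) T' k (pow C k) (take k)"
    by (rule dmap_take[OF T'(1) definable_pow_C]) (use T'(2) in \<open>auto dest: pow_take\<close>)
  \<comment> \<open>The measures of the fibers of the projection of \<open>T'\<close> to
    \<open>C^k\<close>; (F1) and (F2) for this one map control all members of the family.\<close>
  define w where "w c = \<mu> (k + n, fiber T' (take k) c)" for c
  have eq: "\<mu> (n, E u) = w c" if u: "u \<in> pow U l" and c: "c \<in> pow C k"
    and Ec: "\<And>y. y \<in> pow U n \<Longrightarrow> y \<in> E u \<longleftrightarrow> c @ y \<in> T'" for u c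
    unfolding w_def
  proof (rule mu_bij[symmetric])
    have Eu: "definable L M n (E u)" by (rule dfam_inst[OF E u])
    have yU: "y \<in> pow U n" if "y \<in> E u" for y using definable_in[OF Eu that] .
    have lc: "length c = k" using c by (rule pow_length)
    show "fiber T' (take k) c \<subseteq> pow C (k + n)" using T'(2) by (auto simp: fiber_def)
    show "E u \<subseteq> pow C n" by (rule sub[OF u])
    have fib: "z \<in> fiber T' (take k) c \<longleftrightarrow> (\<exists>y\<in>E u. z = c @ y)" for z
    proof
      assume "z \<in> fiber T' (take k) c"
      then have z: "z \<in> T'" "take k z = c" by (auto simp: fiber_def)
      then have "z = c @ drop k z" by (metis append_take_drop_id)
      moreover have "drop k z \<in> pow U n" using z(1) T'(2) pow_mono[OF C_U] pow_drop by blast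
      ultimately show "\<exists>y\<in>E u. z = c @ y" using Ec z(1) by metis
    next
      assume "\<exists>y\<in>E u. z = c @ y"
      then show "z \<in> fiber T' (take k) c" using Ec yU lc by (auto simp: fiber_def)
    qed
    show "dmap (k + n) (fiber T' (take k) c) n (E u) (drop k)"
      by (rule dmap_drop[OF definable_fiber[OF tk] Eu]) (use fib lc in auto)
    show "bij_betw (drop k) (fiber T' (take k) c) (E u)"
      by (rule bij_betwI[of _ _ _ "\<lambda>y. c @ y"]) (use fib lc in auto)
  qed
  have ex: "\<exists>c\<in>pow C k. \<forall>y\<in>pow U n. y \<in> E u \<longleftrightarrow> c @ y \<in> T'" if u: "u \<in> pow U l" for u
  proof -
    obtain c where c: "c \<in> pow C k" "{q. (u @ ps) @ q \<in> solset M (l + i + n) \<rho> []} \<inter> pow C n = {q. c @ q \<in> T} \<inter> pow C n"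
      using T(2)[OF pow_append[OF u ps]] by blast
    have "y \<in> E u \<longleftrightarrow> c @ y \<in> T'" if y: "y \<in> pow U n" for y
    proof -
      have "y \<in> E u \<longleftrightarrow> y \<in> {q. (u @ ps) @ q \<in> solset M (l + i + n) \<rho> []} \<inter> pow C n"
        using E_iff[OF u y] sub[OF u] by blast
      also have "\<dots> \<longleftrightarrow> c @ y \<in> T \<and> y \<in> pow C n" unfolding c(2) by blast
      also have "\<dots> \<longleftrightarrow> c @ y \<in> T'" using c(1) unfolding T'_def by (auto simp: pow_def)
      finally show ?thesis .
    qed
    then show ?thesis using c(1) by blast
  qed
  show ?thesis unfolding simple_def
  proof
    have "(\<lambda>u. \<mu> (n, E u)) ` pow U l \<subseteq> w ` pow C k" using ex eq by fastforce
    moreover have "finite (w ` pow C k)"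
      unfolding w_def by (rule mu_map(1)[OF tk T'(2) order_refl])
    ultimately show "finite ((\<lambda>u. \<mu> (n, E u)) ` pow U l)" by (rule finite_subset)
    show "\<forall>a. D l (\<lambda>u. \<mu> (n, E u) = a)"
    proof
      fix a
      have Z: "definable L M k {c \<in> pow C k. w c = a}"
        unfolding w_def by (rule mu_map(2)[OF tk T'(2) order_refl])
      \<comment> \<open>The index \<open>c\<close> describing a given \<open>E u\<close> is neither
        unique nor chosen definably; any such \<open>c\<close> gives the same measure, so it may be
        quantified.\<close>
      have "D l (\<lambda>u. \<exists>c\<in>pow U k. c \<in> {c \<in> pow C k. w c = a} \<and> (\<forall>y\<in>pow U n. y \<in> E u \<longleftrightarrow> c @ y \<in> T'))"
        by (rule D_ex D_conj D_all D_iff D_set[OF Z] D_fam[OF E] D_set[OF T'(1)] select_intros | simp del: take_take drop_drop mem_Collect_eq)+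
      then show "D l (\<lambda>u. \<mu> (n, E u) = a)"
      proof (rule D_cong)
        fix u assume u: "u \<in> pow U l"
        show "(\<exists>c\<in>pow U k. c \<in> {c \<in> pow C k. w c = a} \<and> (\<forall>y\<in>pow U n. y \<in> E u \<longleftrightarrow> c @ y \<in> T')) \<longleftrightarrow> \<mu> (n, E u) = a"
        proof
          assume "\<exists>c\<in>pow U k. c \<in> {c \<in> pow C k. w c = a} \<and> (\<forall>y\<in>pow U n. y \<in> E u \<longleftrightarrow> c @ y \<in> T')"
          then obtain c where "c \<in> pow C k" "w c = a" "\<And>y. y \<in> pow U n \<Longrightarrow> y \<in> E u \<longleftrightarrow> c @ y \<in> T'" by blast
          then show "\<mu> (n, E u) = a" using eq[OF u] by simp
        next
          assume a: "\<mu> (n, E u) = a"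
          obtain c where c: "c \<in> pow C k" "\<And>y. y \<in> pow U n \<Longrightarrow> y \<in> E u \<longleftrightarrow> c @ y \<in> T'" using ex[OF u] by blast
          then have "w c = a" using eq[OF u] a by simp
          moreover have "c \<in> pow U k" using c(1) pow_mono[OF C_U] by blast
          ultimately show "\<exists>c\<in>pow U k. c \<in> {c \<in> pow C k. w c = a} \<and> (\<forall>y\<in>pow U n. y \<in> E u \<longleftrightarrow> c @ y \<in> T')"
            using c by (intro bexI[of _ c]) simp_all
        qed
      qed
    qed
  qed
qed

section \<open>Sets that embed into powers of \<open>C\<close>\<close>

definition embeds :: "nat \<Rightarrow> 'm list set \<Rightarrow> nat \<Rightarrow> ('m list \<Rightarrow> 'm list) \<Rightarrow> bool" where
  "embeds m X n f \<longleftrightarrow> dmap m X n (pow U n) f \<and> inj_on f X \<and> f ` X \<subseteq> pow C n"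

lemma embeds_map:
  assumes "embeds m X n f"
  shows "definable L M m X" "definable L M n (f ` X)" "f ` X \<subseteq> pow C n" "inj_on f X" "dmap m X n (f ` X) f"
proof -
  have f: "dmap m X n (pow U n) f" using assms by (simp add: embeds_def)
  show "definable L M m X" using f by (rule dmap_dom)
  then show "dmap m X n (f ` X) f"
    by (intro dmap_restrict[OF f] definable_image[OF f]) auto
  show "definable L M n (f ` X)" by (rule definable_image[OF f])
  show "f ` X \<subseteq> pow C n" "inj_on f X" using assms by (auto simp: embeds_def)
qed

lemma embeds_restrict:
  assumes "embeds m X n f" "definable L M m Y" "Y \<subseteq> X"
  shows "embeds m Y n f"
  using assms dmap_restrict[of m X n "pow U n" f Y "pow U n"] inj_on_subset[of f X Y] definable_pow dmap_maps[of m X n "pow U n" f]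
  unfolding embeds_def by blast

text \<open>The inverse of \<open>f\<close> followed by \<open>g\<close> is a definable bijection
  between subsets of powers of \<open>C\<close>.\<close>

lemma embeds_mu_unique:
  assumes "embeds m X n f" "embeds m X l g"
  shows "\<mu> (n, f ` X) = \<mu> (l, g ` X)"
proof (rule mu_bij)
  note f = embeds_map[OF assms(1)] and g = embeds_map[OF assms(2)]
  show "dmap n (f ` X) l (g ` X) (\<lambda>y. g (inv_into X f y))"
    by (rule dmap_image[OF f(5,4) g(5)])
  show "f ` X \<subseteq> pow C n" "g ` X \<subseteq> pow C l" by (rule f g)+
  have "bij_betw (g \<circ> inv_into X f) (f ` X) (g ` X)"
    by (rule bij_betw_trans[of _ _ X]) (use f(4) g(4) in \<open>auto intro: bij_betw_inv_into inj_on_imp_bij_betw\<close>)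
  then show "bij_betw (\<lambda>y. g (inv_into X f y)) (f ` X) (g ` X)" by (simp add: comp_def)
qed

definition nu0 :: "nat \<Rightarrow> 'm list set \<Rightarrow> 'a" where
  "nu0 m X = (THE a. \<exists>n f. embeds m X n f \<and> a = \<mu> (n, f ` X))"

lemma nu0_eq: "embeds m X n f \<Longrightarrow> nu0 m X = \<mu> (n, f ` X)"
  unfolding nu0_def using embeds_mu_unique by (intro the_equality) blast+

lemma nu0_mu:
  assumes "definable L M n X" "X \<subseteq> pow C n"
  shows "nu0 n X = \<mu> (n, X)"
proof -
  have "dmap n X n (pow U n) (\<lambda>x. x)"
    by (rule dmap_restrict[OF dmap_id[OF definable_pow] assms(1) _ definable_pow]) (use assms(1) definable_in in auto)
  then have "embeds n X n (\<lambda>x. x)" using assms(2) by (simp add: embeds_def)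
  from nu0_eq[OF this] show ?thesis by simp
qed

lemma step_embeds:
  assumes F: "definable L M m (X)" and u: "u \<in> pow U a"
    and G: "D (a + (m + n)) (\<lambda>z. G (take a z) (take m (drop a z)) (drop m (drop a z)))"
    and fn: "functional_on M n (X) (G u)" and inj: "inj_into M C n (X) (G u)"
  obtains f where "embeds m (X) n f" "f ` X = {y \<in> pow U n. \<exists>x\<in>X. G u x y}"
proof -
  have "D (m + n) (\<lambda>z. G u (take m z) (drop m z))"
    by (rule D_rel[OF G] select_const[OF u] select_intros | simp)+
  then obtain f where f: "dmap m (X) n (pow U n) f" "\<And>x y. x \<in> X \<Longrightarrow> y \<in> pow U n \<Longrightarrow> f x = y \<longleftrightarrow> G u x y"
    by (rule functional_on_dmap[OF F _ fn]) blast
  note fm = dmap_maps[OF f(1)]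
  have fx: "f x \<in> pow C n \<and> (\<forall>x'\<in>X. f x' = f x \<longrightarrow> x' = x)" if "x \<in> X" for x
  proof -
    have "G u x (f x)" using f(2)[OF that fm[OF that]] by simp
    then show ?thesis using inj f(2)[OF _ fm[OF that]] fm[OF that] that unfolding inj_into_def by auto
  qed
  have "inj_on f (X)" using fx by (auto intro: inj_onI)
  then have "embeds m (X) n f" using f(1) fx unfolding embeds_def by blast
  moreover have "f ` X = {y \<in> pow U n. \<exists>x\<in>X. G u x y}" using fm f(2) by blast
  ultimately show ?thesis using that by blast
qed

text \<open>In each case the images \<open>E d u\<close> form a definable family of subsets of a
  power of \<open>C\<close>, to which \<open>mu_simple\<close> applies; \<open>simple_cases\<close>
  then removes the auxiliary parameters of the embeddings.\<close>

lemma nu0_simple_embeds: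
  assumes K: "Kf 0 k m F"
  shows "simple k (\<lambda>p. nu0 m (F p)) \<and> (\<forall>p\<in>pow U k. \<exists>n f. embeds m (F p) n f)"
proof -
  obtain S where S: "finite S" "\<And>p. p \<in> pow U k \<Longrightarrow> \<exists>d\<in>S. applies U d p"
    and good: "\<And>d. d \<in> S \<Longrightarrow> good_step 0 k m F d"
    using Kf_steps[OF K] by (elim exE conjE) simp
  have S3: "D (k + j) Q"
    and S4: "D (k + j + (m + n)) (\<lambda>z. G (take (k + j) z) (take m (drop (k + j) z)) (drop m (drop (k + j) z)))"
    and S5: "p \<in> pow U k \<Longrightarrow> q \<in> pow U j \<Longrightarrow> Q (p @ q) \<Longrightarrow> functional_on M n (F p) (G (p @ q))"
    and S6: "p \<in> pow U k \<Longrightarrow> q \<in> pow U j \<Longrightarrow> Q (p @ q) \<Longrightarrow> inj_into M C n (F p) (G (p @ q))"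
    if "(j, n, Q, G) \<in> S" for j n Q G p q
    using good[OF that] by auto
  have F: "dfam k m F" by (rule Kf_dfam[OF K])
  define E :: "'m step \<Rightarrow> 'm list \<Rightarrow> 'm list set" where "E = (\<lambda>(j, n, Q, G) u. {y \<in> pow U n. Q u \<and> (\<exists>x\<in>F (take k u). G u x y)})"
  have emb: "\<exists>f. embeds m (F p) n f \<and> f ` F p = E (j, n, Q, G) (p @ q)"
    if d: "(j, n, Q, G) \<in> S" and pq: "p \<in> pow U k" "q \<in> pow U j" "Q (p @ q)" for j n Q G p q
  proof -
    obtain f where "embeds m (F p) n f" "f ` F p = {y \<in> pow U n. \<exists>x\<in>F p. G (p @ q) x y}"
      by (rule step_embeds[of m "F p" "p @ q" "k + j" n G, OF dfam_inst[OF F pq(1)] pow_append[OF pq(1,2)] S4[OF d] S5[OF d pq] S6[OF d pq]])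
    moreover have "take k (p @ q) = p" using pq by (simp add: pow_length)
    ultimately show ?thesis using pq(3) by (auto simp: E_def)
  qed
  define V where "V d u = \<mu> (fst (snd d), E d u)" for d u
  have Vsf: "simple (k + fst d) (V d)" if d: "d \<in> S" for d
  proof -
    obtain j n Q G where deq: "d = (j, n, Q, G)" by (cases d)
    note d' = d[unfolded deq]
    have "D (k + j + n) (\<lambda>z. Q (take (k + j) z) \<and> (\<exists>x\<in>pow U m. x \<in> F (take k (take (k + j) z)) \<and> G (take (k + j) z) x (drop (k + j) z)))"
      by (rule D_conj D_pred[OF S3[OF d']] D_ex D_fam[OF F] D_rel[OF S4[OF d']] select_intros | simp del: take_take drop_drop)+
    from dfam_Collect[OF this] have "dfam (k + j) n (\<lambda>u. {y \<in> pow U n. Q u \<and> (\<exists>x\<in>pow U m. x \<in> F (take k u) \<and> G u x y)})" .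
    then have "dfam (k + j) n (E d)"
      by (rule dfam_cong) (use dfam_in[OF F pow_take] in \<open>auto simp: E_def deq\<close>)
    moreover have "E d u \<subseteq> pow C n" if u: "u \<in> pow U (k + j)" for u
    proof (cases "Q u")
      case True
      from u obtain p q where pq: "p \<in> pow U k" "q \<in> pow U j" "u = p @ q" by (rule pow_splitE)
      then obtain f where "embeds m (F p) n f" "f ` F p = E d u" using emb[OF d' pq(1,2)] True deq by auto
      then show ?thesis by (simp add: embeds_def)
    qed (simp add: E_def deq)
    ultimately have "simple (k + j) (\<lambda>u. \<mu> (n, E d u))" by (rule mu_simple)
    then show ?thesis by (simp add: V_def[abs_def] deq)
  qed
  have V: "nu0 m (F p) = V (j, n, Q, G) (p @ q)"
    if d: "(j, n, Q, G) \<in> S" and pq: "p \<in> pow U k" "q \<in> pow U j" "Q (p @ q)" for j n Q G p q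
  proof -
    obtain f where f: "embeds m (F p) n f" "f ` F p = E (j, n, Q, G) (p @ q)" using emb[OF d pq] by blast
    show ?thesis using nu0_eq[OF f(1)] f(2) by (simp add: V_def)
  qed
  have "simple k (\<lambda>p. nu0 m (F p))"
  proof (rule simple_cases[OF S(1,2)])
    show "D (k + fst d) (fst (snd (snd d)))" if "d \<in> S" for d using S3 that by (cases d) auto
    show "simple (k + fst d) (V d)" if "d \<in> S" for d using Vsf that .
    show "nu0 m (F p) = V d (p @ q)" if "d \<in> S" "p \<in> pow U k" "q \<in> pow U (fst d)" "fst (snd (snd d)) (p @ q)" for d p q
      using V that by (cases d) auto
  qed
  moreover have "\<exists>n f. embeds m (F p) n f" if p: "p \<in> pow U k" for p
  proof -
    from S(2)[OF p] obtain d where d: "d \<in> S" "applies U d p" by blast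
    obtain j n Q G where deq: "d = (j, n, Q, G)" by (cases d)
    then obtain q where "q \<in> pow U j" "Q (p @ q)" using d(2) by auto
    then show ?thesis using emb[OF d(1)[unfolded deq] p] by blast
  qed
  ultimately show ?thesis by blast
qed

text \<open>Transported to the images of the embeddings, \<open>e\<close> becomes a map between
  objects of \<open>Def(C)\<close>, where (F3) is available.\<close>

lemma nu0_fub:
  assumes "embeds m X n f" "embeds l Y k g" "dmap m X l Y e" "\<And>y. y \<in> Y \<Longrightarrow> nu0 m (fiber X e y) = a"
  shows "nu0 m X = a * nu0 l Y"
proof -
  note f = embeds_map[OF assms(1)] and g = embeds_map[OF assms(2)]
  let ?e = "\<lambda>y. g (e (inv_into X f y))"
  have inv: "inv_into X f (f x) = x" if "x \<in> X" for x using f(4) that by (rule inv_into_f_f)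
  have d: "dmap n (f ` X) k (g ` Y) ?e"
    by (rule dmap_image[OF f(5,4) dmap_comp[OF assms(3) g(5)]])
  have "\<mu> (n, f ` X) = a * \<mu> (k, g ` Y)"
  proof (rule mu_map(3)[OF d f(3) g(3)])
    fix w assume "w \<in> g ` Y"
    then obtain y where y: "y \<in> Y" "w = g y" by blast
    have "g (e x) = g y \<longleftrightarrow> e x = y" if "x \<in> X" for x
      using g(4) y(1) dmap_maps[OF assms(3) that] by (auto simp: inj_on_def)
    then have "fiber (f ` X) ?e w = f ` fiber X e y" using y(2) inv by (auto simp: fiber_def)
    moreover have "embeds m (fiber X e y) n f"
      by (rule embeds_restrict[OF assms(1) definable_fiber[OF assms(3)]]) (auto simp: fiber_def)
    ultimately show "\<mu> (n, fiber (f ` X) ?e w) = a" using nu0_eq assms(4)[OF y(1)] by metis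
  qed
  then show ?thesis using nu0_eq[OF assms(1)] nu0_eq[OF assms(2)] by simp
qed

theorem base_category: "measured_category L M (Kf 0) nu0"
proof -
  interpret K: family_category L M "Kf 0" by (rule Kf_category)
  have emb: "\<exists>n f. embeds m X n f" if "Kf 0 0 m (\<lambda>_. X)" for m X
    using nu0_simple_embeds[OF that] by simp
  \<comment> \<open>A point of \<open>M^m\<close> need not lie in a power of \<open>C\<close>; it is
    sent to the empty tuple, the only element of \<open>C^0\<close>.\<close>
  have nil: "nu0 m X = \<mu> (0, (\<lambda>_. []) ` X)" if "definable L M m X" "\<And>x y. x \<in> X \<Longrightarrow> y \<in> X \<Longrightarrow> x = y" for m X
  proof (rule nu0_eq)
    have "dmap m X 0 (pow U 0) (\<lambda>_. [])" by (rule dmap_const[OF that(1) definable_pow]) simp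
    then show "embeds m X 0 (\<lambda>_. [])" using that(2) by (auto simp: embeds_def intro: inj_onI)
  qed
  show ?thesis
  proof
    show "simple k (\<lambda>p. nu0 m (F p))" if "Kf 0 k m F" for k m F using nu0_simple_embeds[OF that] by blast
    show "nu0 m {} = 0" for m using nil[OF definable_empty, of m] mu_empty by simp
    show "nu0 m {x} = 1" if "x \<in> pow U m" for m x
      using nil[OF definable_single[OF that]] mu_single[of "[]" 0] by simp
  next
    fix m X Y assume *: "Kf 0 0 m (\<lambda>_. X \<union> Y)" "definable L M m X" "definable L M m Y" "X \<inter> Y = {}"
    obtain n f where f: "embeds m (X \<union> Y) n f" using emb[OF *(1)] by blast
    have fX: "embeds m X n f" and fY: "embeds m Y n f" using embeds_restrict[OF f] *(2,3) by auto
    have "f ` X \<inter> f ` Y = {}" using embeds_map(4)[OF f] *(4) by (auto simp: inj_on_def)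
    then show "nu0 m (X \<union> Y) = nu0 m X + nu0 m Y"
      unfolding nu0_eq[OF f] nu0_eq[OF fX] nu0_eq[OF fY] image_Un
      using embeds_map[OF fX] embeds_map[OF fY] by (intro mu_add)
  next
    fix m X n Y f a
    assume *: "Kf 0 0 m (\<lambda>_. X)" "Kf 0 0 n (\<lambda>_. Y)" "dmap m X n Y f" "\<And>y. y \<in> Y \<Longrightarrow> nu0 m (fiber X f y) = a"
    then show "nu0 m X = a * nu0 n Y" using emb[OF *(1)] emb[OF *(2)] nu0_fub by blast
  qed
qed

end

section \<open>The measure on fiberable sets\<close>

context fo_structure
begin

lemma definable_vimage:
  assumes "dmap m X n Y f" "definable L M n Z"
  shows "definable L M m {x \<in> X. f x \<in> Z}"
proof -
  have "D m (\<lambda>x. \<exists>y\<in>pow U n. (x \<in> X \<and> f x = y) \<and> y \<in> Z)"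
    by (rule D_ex D_conj[OF D_map[OF assms(1)] D_set[OF assms(2)]] select_intros | simp)+
  then have "D m (\<lambda>x. x \<in> {x \<in> X. f x \<in> Z})"
    by (rule D_cong) (use definable_in[OF assms(2)] in auto)
  then show ?thesis using definable_sub[OF dmap_dom[OF assms(1)]] by (auto simp: definable_iff)
qed

lemma fubini_measure_UN:
  assumes "fubini_measure L M Ob \<rho>" "finite I" "(m, X) \<in> Ob" "\<And>i. i \<in> I \<Longrightarrow> definable L M m (Y i)"
    "(\<Union>i\<in>I. Y i) \<subseteq> X" "\<And>i j. i \<in> I \<Longrightarrow> j \<in> I \<Longrightarrow> i \<noteq> j \<Longrightarrow> Y i \<inter> Y j = {}"
  shows "\<rho> (m, \<Union>i\<in>I. Y i) = (\<Sum>i\<in>I. \<rho> (m, Y i)) \<and> (m, \<Union>i\<in>I. Y i) \<in> Ob"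
  using assms(2,4-6)
proof (induction I rule: finite_induct)
  case empty
  have "(m, {}) \<in> Ob" using fubini_measureD(2)[OF assms(1,3) definable_empty] by simp
  then show ?case using fubini_measureD(3)[OF assms(1)] by simp
next
  case (insert i I)
  have IH: "\<rho> (m, \<Union>i\<in>I. Y i) = (\<Sum>i\<in>I. \<rho> (m, Y i)) \<and> (m, \<Union>i\<in>I. Y i) \<in> Ob"
    by (rule insert.IH) (use insert.prems in auto)
  have Yi: "(m, Y i) \<in> Ob" using fubini_measureD(2)[OF assms(1,3)] insert.prems by auto
  have "Y i \<inter> (\<Union>i\<in>I. Y i) = {}" using insert.prems(3) insert.hyps by blast
  from fubini_measureD(5)[OF assms(1) Yi conjunct2[OF IH] this]
  have "\<rho> (m, \<Union>i\<in>insert i I. Y i) = (\<Sum>i\<in>insert i I. \<rho> (m, Y i))" using IH insert.hyps by simp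
  moreover have "definable L M m (\<Union>i\<in>insert i I. Y i)"
    using definable_Un[OF insert.prems(1)[of i] fubini_measureD(1)[OF assms(1) conjunct2[OF IH]]] by simp
  ultimately show ?case using fubini_measureD(2)[OF assms(1,3)] insert.prems(2) by blast
qed

text \<open>For any Fubini measure, a map determines the measure of its domain from measures of
  fibers and of subsets of the base. Uniqueness rests on this.\<close>

lemma fubini_measure_sum:
  assumes \<rho>: "fubini_measure L M Ob \<rho>" and X: "(m, X) \<in> Ob" and Y: "(n, Y) \<in> Ob" and f: "dmap m X n Y f"
  shows "\<rho> (m, X) = (\<Sum>a\<in>(\<lambda>y. \<rho> (m, fiber X f y)) ` Y. a * \<rho> (n, {y \<in> Y. \<rho> (m, fiber X f y) = a}))"
proof -
  let ?w = "\<lambda>y. \<rho> (m, fiber X f y)"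
  let ?Y = "\<lambda>a. {y \<in> Y. ?w y = a}"
  let ?X = "\<lambda>a. {x \<in> X. f x \<in> ?Y a}"
  note map = fubini_measure_map[OF \<rho> X Y f]
  have dX: "definable L M m (?X a)" for a by (rule definable_vimage[OF f map(2)])
  have XU: "X = (\<Union>a\<in>?w ` Y. ?X a)" using dmap_maps[OF f] by auto
  have "\<rho> (m, \<Union>a\<in>?w ` Y. ?X a) = (\<Sum>a\<in>?w ` Y. \<rho> (m, ?X a))"
    by (rule fubini_measure_UN[OF \<rho> map(1) X, THEN conjunct1]) (use dX in auto)
  also have "\<dots> = (\<Sum>a\<in>?w ` Y. a * \<rho> (n, ?Y a))"
  proof (rule sum.cong[OF refl])
    fix a
    have XO: "(m, ?X a) \<in> Ob" by (rule fubini_measureD(2)[OF \<rho> X dX]) auto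
    have YO: "(n, ?Y a) \<in> Ob" by (rule fubini_measureD(2)[OF \<rho> Y map(2)]) auto
    have d: "dmap m (?X a) n (?Y a) f" by (rule dmap_restrict[OF f dX _ map(2)]) auto
    show "\<rho> (m, ?X a) = a * \<rho> (n, ?Y a)"
    proof (rule fubini_measure_map(3)[OF \<rho> XO YO d])
      fix y assume y: "y \<in> ?Y a"
      then have "fiber (?X a) f y = fiber X f y" by (auto simp: fiber_def)
      then show "\<rho> (m, fiber (?X a) f y) = a" using y by simp
    qed
  qed
  finally show ?thesis using XU by simp
qed

end

section \<open>Starred sets and their independence of the defining formula\<close>

lemma transfer_iff:
  assumes "X \<subseteq> pow (univ M) m" "X' \<subseteq> pow (univ N) m"
  shows "transfer L M N h m X X' \<longleftrightarrow> tr L M N h (univ M) m (\<lambda>z. z \<in> X) (\<lambda>z. z \<in> X')"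
proof -
  have "X = solset M m \<phi> ps \<longleftrightarrow> (\<forall>z\<in>pow (univ M) m. z \<in> X \<longleftrightarrow> sat M (nth (z @ ps)) \<phi>)" for \<phi> ps
    using assms(1) by (auto simp: solset_def)
  moreover have "X' = solset N m \<phi> ps \<longleftrightarrow> (\<forall>z\<in>pow (univ N) m. z \<in> X' \<longleftrightarrow> sat N (nth (z @ ps)) \<phi>)" for \<phi> ps
    using assms(2) by (auto simp: solset_def)
  ultimately show ?thesis unfolding transfer_def tr_def by presburger
qed

lemma transfer_sub: "transfer L M N h m X X' \<Longrightarrow> X \<subseteq> pow (univ M) m \<and> X' \<subseteq> pow (univ N) m"
  by (auto simp: transfer_def solset_def)

lemma transfer_tr: "transfer L M N h m X X' \<Longrightarrow> tr L M N h (univ M) m (\<lambda>z. z \<in> X) (\<lambda>z. z \<in> X')"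
  using transfer_sub[of L M N h m X X'] transfer_iff[of X M m X' N L h] by simp

text \<open>Converts between the two conventions: parameters behind the point in
  \<open>solset\<close>, in front of it in \<open>fsol\<close>.\<close>

lemma swap_formula:
  assumes "\<phi> \<in> forms L (m + l)"
  shows "ren (\<lambda>i. if i < m then l + i else i - m) \<phi> \<in> forms L (l + m)"
    and "length x = m \<Longrightarrow> length ps = l \<Longrightarrow>
      sat M (nth (ps @ x)) (ren (\<lambda>i. if i < m then l + i else i - m) \<phi>) \<longleftrightarrow> sat M (nth (x @ ps)) \<phi>"
proof -
  have fv: "fv \<phi> \<subseteq> {..<m + l}" using assms by (simp add: forms_def)
  then show "ren (\<lambda>i. if i < m then l + i else i - m) \<phi> \<in> forms L (l + m)"
    using assms by (fastforce simp: forms_def)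
  assume len: "length x = m" "length ps = l"
  show "sat M (nth (ps @ x)) (ren (\<lambda>i. if i < m then l + i else i - m) \<phi>) \<longleftrightarrow> sat M (nth (x @ ps)) \<phi>"
    unfolding sat_ren
  proof (rule sat_cong)
    fix i assume "i \<in> fv \<phi>"
    then have "i < m + l" using fv by auto
    then show "(ps @ x) ! (if i < m then l + i else i - m) = (x @ ps) ! i"
      using len by (auto simp: nth_append)
  qed
qed

text \<open>That two formulas with parameters define the same predicate is a sentence over
  \<open>M\<close>, hence it also holds in \<open>N\<close>.\<close>

lemma star_unique:
  assumes "elem_emb L M N h" "tr L M N h (univ M) n P P'" "tr L M N h (univ M) n P Q'" "z \<in> pow (univ N) n"
  shows "P' z \<longleftrightarrow> Q' z"
proof -
  have "tr L M N h (univ M) (0 + n) (\<lambda>w. P (drop 0 w) \<longleftrightarrow> P (drop 0 w)) (\<lambda>w. P' (drop 0 w) \<longleftrightarrow> Q' (drop 0 w))"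
    using tr_iff[OF assms(2,3)] by simp
  then have "tr L M N h (univ M) 0 (\<lambda>_. \<forall>z\<in>pow (univ M) n. P z \<longleftrightarrow> P z) (\<lambda>_. \<forall>z\<in>pow (univ N) n. P' z \<longleftrightarrow> Q' z)"
    by (rule tr_all)
  from tr_elementary[OF assms(1) order_refl this, of "[]"] show ?thesis using assms(4) by simp
qed

section \<open>The union over the number of steps\<close>

context base_measure
begin

primrec nus :: "nat \<Rightarrow> nat \<Rightarrow> 'm list set \<Rightarrow> 'a" where
  "nus 0 = nu0"
| "nus (Suc r) = measured_category.nu_ext L M (Kf r) (nus r)"

lemma nus_measured: "measured_category L M (Kf r) (nus r)"
proof (induction r)
  case 0
  then show ?case using base_category by simp
next
  case (Suc r)
  have "measure_extension L M (Kf r) (Kf (Suc r)) (nus r)"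
    by (rule measure_extension.intro[OF Kf_extension Suc])
  then show ?case using measure_extension.measured_extension by simp
qed

lemma nus_Suc: "Kf r 0 m (\<lambda>_. X) \<Longrightarrow> nus (Suc r) m X = nus r m X"
  using measured_category.nu_ext_extends[OF nus_measured] by simp

lemma nus_le: "Kf r 0 m (\<lambda>_. X) \<Longrightarrow> r \<le> s \<Longrightarrow> nus s m X = nus r m X"
proof (induction s)
  case (Suc s)
  show ?case
  proof (cases "r = Suc s")
    case False
    then have "r \<le> s" using Suc.prems by simp
    then show ?thesis using Suc.IH[OF Suc.prems(1)] nus_Suc[OF Kf_le[OF Suc.prems(1)]] by metis
  qed simp
qed simp

definition Ob :: "'m obj set" where
  "Ob = {(m, X). \<exists>r. Kf r 0 m (\<lambda>_. X)}"

text \<open>Any number of steps that suffices gives the same value; the least one is merely a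
  definite choice. The restriction fixes the values off \<open>Ob\<close>, so uniqueness becomes an
  equality of functions.\<close>

definition nu :: "'m obj \<Rightarrow> 'a" where
  "nu = restrict (\<lambda>(m, X). nus (LEAST r. Kf r 0 m (\<lambda>_. X)) m X) Ob"

lemma nu_extensional: "nu \<in> extensional Ob"
  by (simp add: nu_def)

lemma nu_eq:
  assumes "Kf r 0 m (\<lambda>_. X)"
  shows "nu (m, X) = nus r m X"
proof -
  let ?s = "LEAST r. Kf r 0 m (\<lambda>_. X)"
  have "Kf ?s 0 m (\<lambda>_. X)" "?s \<le> r" using assms by (auto intro: LeastI Least_le)
  then have "nus r m X = nus ?s m X" by (rule nus_le)
  then show ?thesis using assms by (auto simp: nu_def Ob_def)
qed

lemma Kf_definable: "Kf r 0 m (\<lambda>_. X) \<Longrightarrow> definable L M m X"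
  using dfam_inst[OF Kf_dfam, of r 0 m "\<lambda>_. X" "[]"] by simp

lemma Kf_subset: "Kf r 0 m (\<lambda>_. X) \<Longrightarrow> definable L M m Y \<Longrightarrow> Y \<subseteq> X \<Longrightarrow> Kf r 0 m (\<lambda>_. Y)"
  by (rule Kf_sub[OF _ dfam_const]) auto

lemma Ob_common:
  assumes "(m, X) \<in> Ob" "(n, Y) \<in> Ob"
  obtains r where "Kf r 0 m (\<lambda>_. X)" "Kf r 0 n (\<lambda>_. Y)"
proof -
  obtain r s where "Kf r 0 m (\<lambda>_. X)" "Kf s 0 n (\<lambda>_. Y)" using assms by (auto simp: Ob_def)
  then show ?thesis using that[of "max r s"] Kf_le by (meson max.cobounded1 max.cobounded2)
qed

lemma Kf_Un:
  assumes X: "Kf r 0 m (\<lambda>_. X)" and Y: "Kf r 0 m (\<lambda>_. Y)" and C': "C' \<subseteq> univ N" and cd: "c \<in> C" "d \<in> C" "c \<noteq> d"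
  shows "Kf (Suc r) 0 m (\<lambda>_. X \<union> Y)"
proof -
  obtain X' where X': "star 0 m (\<lambda>_. X) X'" "fib_sat L N C' r m (X' [])" using X unfolding Kf_def by auto
  obtain Y' where Y': "star 0 m (\<lambda>_. Y) Y'" "fib_sat L N C' r m (Y' [])" using Y unfolding Kf_def by auto
  have nil: "sel h U l 0 (\<lambda>_. []) (\<lambda>_. [])" for l by (rule sel_const) auto
  have "tr L M N h U (0 + m) (\<lambda>z. z \<in> X \<or> z \<in> Y) (\<lambda>z. z \<in> X' [] \<or> z \<in> Y' [])"
    by (rule tr_disj tr_star[OF X'(1) nil] tr_star[OF Y'(1) nil] sel_intros | simp)+
  then have "star 0 m (\<lambda>_. X \<union> Y) (\<lambda>_. X' [] \<union> Y' [])"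
    using X'(1) Y'(1) by (simp add: star_def)
  moreover have hC: "h b \<in> C'" if "b \<in> C" for b
  proof -
    have "[b] \<in> pow U 1" "[b] \<in> pow C 1" using that C_U by (auto simp: pow_def)
    then show ?thesis using tr_elementary[OF emb _ C_star, of "[b]"] by (simp add: pow_def)
  qed
  moreover have "h c \<noteq> h d"
  proof
    assume eq: "h c = h d"
    have "tr L M N h U 2 (\<lambda>z. take 1 z = drop 1 z) (\<lambda>z. take 1 z = drop 1 z)"
      by (rule tr_eq sel_intros | simp)+
    moreover have "[c, d] \<in> pow U 2" using cd C_U by (auto simp: pow_def)
    ultimately show False using tr_elementary[OF emb order_refl] eq cd(3) by fastforce
  qed
  moreover have "N.D 1 (\<lambda>z. z \<in> pow C' 1)" unfolding N.D_def by (rule tr_mono[OF N.C_def]) simp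
  ultimately show ?thesis
    using N.fib_Un[OF X'(2) Y'(2) C' _ hC[OF cd(1)] hC[OF cd(2)]] unfolding Kf_def by blast
qed

lemma admissible_Ob:
  assumes "C' \<subseteq> univ N" "\<exists>c\<in>C. \<exists>d\<in>C. c \<noteq> d"
  shows "admissible L M Ob"
  unfolding admissible_def
proof (intro conjI allI impI)
  show "Ob \<subseteq> Def_objs L M" using Kf_definable by (auto simp: Ob_def Def_objs_def)
  fix m X Y assume "(m, X) \<in> Ob \<and> (m, Y) \<in> Ob"
  then obtain r where "Kf r 0 m (\<lambda>_. X)" "Kf r 0 m (\<lambda>_. Y)" using Ob_common by blast
  then show "(m, X \<union> Y) \<in> Ob" using Kf_Un assms unfolding Ob_def by blast
next
  fix m X Y assume "(m, X) \<in> Ob \<and> Y \<subseteq> X \<and> definable L M m Y"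
  then show "(m, Y) \<in> Ob" using Kf_subset unfolding Ob_def by blast
next
  fix m n X Y assume "(m, X) \<in> Ob \<and> (n, Y) \<in> Ob"
  then obtain r where "Kf r 0 m (\<lambda>_. X)" "Kf r 0 n (\<lambda>_. Y)" using Ob_common by blast
  then show "(m + n, tprod X Y) \<in> Ob" using Kf_prod unfolding Ob_def by blast
qed

theorem fubini_measure_nu:
  assumes "C' \<subseteq> univ N" "\<exists>c\<in>C. \<exists>d\<in>C. c \<noteq> d"
  shows "fubini_measure L M Ob nu"
  unfolding fubini_measure_def
proof (intro conjI[OF admissible_Ob[OF assms]] conjI allI impI)
  fix m assume "(m, {}) \<in> Ob"
  then obtain r where r: "Kf r 0 m (\<lambda>_. {})" by (auto simp: Ob_def)
  show "nu (m, {}) = 0" using nu_eq[OF r] measured_category.nu_empty[OF nus_measured] by simp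
next
  fix m x assume "(m, {x}) \<in> Ob"
  then obtain r where r: "Kf r 0 m (\<lambda>_. {x})" by (auto simp: Ob_def)
  then have "x \<in> pow U m" using definable_in[OF Kf_definable] by blast
  then show "nu (m, {x}) = 1" using nu_eq[OF r] measured_category.nu_single[OF nus_measured] by simp
next
  fix m X Y assume *: "(m, X) \<in> Ob \<and> (m, Y) \<in> Ob \<and> X \<inter> Y = {}"
  have "(m, X \<union> Y) \<in> Ob"
    by (rule admissible_Ob[OF assms, unfolded admissible_def, THEN conjunct2, THEN conjunct1, rule_format])
      (use * in blast)
  then obtain r where r: "Kf r 0 m (\<lambda>_. X \<union> Y)" by (auto simp: Ob_def)
  have d: "definable L M m X" "definable L M m Y" using * Kf_definable by (auto simp: Ob_def)
  then have "Kf r 0 m (\<lambda>_. X)" "Kf r 0 m (\<lambda>_. Y)" using Kf_subset[OF r] by auto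
  then show "nu (m, X \<union> Y) = nu (m, X) + nu (m, Y)"
    using measured_category.nu_add[OF nus_measured r d] * nu_eq[OF r] by (simp add: nu_eq)
next
  fix m X n Y f
  assume *: "(m, X) \<in> Ob \<and> (n, Y) \<in> Ob \<and> definable_map L M (m, X) (n, Y) f"
  then obtain r where r: "Kf r 0 m (\<lambda>_. X)" "Kf r 0 n (\<lambda>_. Y)" using Ob_common by blast
  interpret R: measured_category L M "Kf r" "nus r" by (rule nus_measured)
  have f: "dmap m X n Y f" using * dmap_iff[OF Kf_definable[OF r(1)] Kf_definable[OF r(2)]] by blast
  have fib: "nu (m, fiber X f y) = nus r m (fiber X f y)" for y
    by (rule nu_eq, rule Kf_subset[OF r(1) definable_fiber[OF f]]) (auto simp: fiber_def)
  have simple: "simple n (\<lambda>y. nus r m (fiber X f y))" by (rule R.nu_simple[OF R.K_fiber[OF r(1) f]])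
  have "finite ((\<lambda>y. nus r m (fiber X f y)) ` Y)" by (rule simple_finite[OF simple Kf_definable[OF r(2)]])
  then show "finite {nu (m, fiber X f y) | y. y \<in> Y}" unfolding fib by (simp add: Setcompr_eq_image)
  show "definable L M n {y \<in> Y. nu (m, fiber X f y) = a}" for a
    unfolding fib by (rule simple_level[OF simple Kf_definable[OF r(2)]])
  show "nu (m, X) = a * nu (n, Y)" if "\<forall>y\<in>Y. nu (m, fiber X f y) = a" for a
    using R.nu_fub[OF r f] that fib nu_eq[OF r(1)] nu_eq[OF r(2)] by simp
qed

lemma Def_sub_Ob:
  assumes "(n, X) \<in> Def_sub L M C"
  shows "(n, X) \<in> Ob" "nu (n, X) = \<mu> (n, X)"
proof -
  have X: "definable L M n X" "X \<subseteq> pow C n" using assms by (auto simp: Def_sub_iff)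
  obtain X' where X': "star 0 n (\<lambda>_. X) X'" using star_exists[OF dfam_const[OF X(1)]] .
  have "definable L N n (X' [])" using N.dfam_inst[OF star_dfamN[OF X'], of "[]"] by simp
  moreover have "X' [] \<subseteq> pow C' n"
  proof -
    have nil: "sel h U l 0 (\<lambda>_. []) (\<lambda>_. [])" for l by (rule sel_const) auto
    have Cn: "tr L M N h U l (\<lambda>z. t z \<in> pow C n) (\<lambda>z. t' z \<in> pow C' n)" if "sel h U l n t t'" for l t t'
      by (rule tr_pow[OF tr_mono[OF C_star] that refl order_refl hU]) simp
    have "tr L M N h U 0 (\<lambda>_. \<forall>x\<in>pow U n. x \<in> X \<longrightarrow> x \<in> pow C n) (\<lambda>_. \<forall>x\<in>pow (univ N) n. x \<in> X' [] \<longrightarrow> x \<in> pow C' n)"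
    proof (rule tr_all, rule tr_imp)
      show "tr L M N h U (0 + n) (\<lambda>w. drop 0 w \<in> X) (\<lambda>w. drop 0 w \<in> X' [])"
        by (rule tr_star[OF X' nil] sel_intros | simp)+
      show "tr L M N h U (0 + n) (\<lambda>w. drop 0 w \<in> pow C n) (\<lambda>w. drop 0 w \<in> pow C' n)"
        by (rule Cn) (use sel_id[of h U n] in simp)
    qed
    from sentence[OF this] have "\<forall>x\<in>pow (univ N) n. x \<in> X' [] \<longrightarrow> x \<in> pow C' n" using X(2) by blast
    then show ?thesis using X' by (auto simp: star_def)
  qed
  ultimately have "fib_sat L N C' 0 n (X' [])" by (rule N.fib_pow)
  then have K: "Kf 0 0 n (\<lambda>_. X)" using X' unfolding Kf_def by auto
  then show "(n, X) \<in> Ob" by (auto simp: Ob_def)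
  show "nu (n, X) = \<mu> (n, X)" using nu_eq[OF K] nu0_mu[OF X] by simp
qed

text \<open>For \<open>r = 0\<close> an embedding into a power of \<open>C\<close> has one-point
  fibers over its image, so (F3) reduces the value to \<open>\<mu>\<close>. In the step, a fibration
  writes both measures as the same finite sum, in which only sets of lower rank occur.\<close>

lemma nu_unique:
  assumes \<rho>: "fubini_measure L M Ob \<rho>" and ext: "\<And>X. X \<in> Def_sub L M C \<Longrightarrow> \<rho> X = \<mu> X"
  shows "Kf r 0 m (\<lambda>_. X) \<Longrightarrow> \<rho> (m, X) = nus r m X"
proof (induction r arbitrary: m X)
  case 0
  obtain n f where f: "embeds m X n f" using nu0_simple_embeds[OF 0] by auto
  note fm = embeds_map[OF f]
  have sub: "(n, f ` X) \<in> Def_sub L M C" using fm by (simp add: Def_sub_iff)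
  have X: "(m, X) \<in> Ob" using 0 by (auto simp: Ob_def)
  have "\<rho> (m, X) = 1 * \<rho> (n, f ` X)"
  proof (rule fubini_measure_map(3)[OF \<rho> X Def_sub_Ob(1)[OF sub] fm(5)])
    fix y assume "y \<in> f ` X"
    then obtain x where x: "x \<in> X" "y = f x" by blast
    then have fib: "fiber X f y = {x}" using fm(4) by (auto simp: fiber_def inj_on_def)
    have "(m, {x}) \<in> Ob"
      by (rule fubini_measureD(2)[OF \<rho> X definable_single]) (use x fm(1) definable_in in auto)
    then show "\<rho> (m, fiber X f y) = 1" unfolding fib by (rule fubini_measureD(4)[OF \<rho>])
  qed
  then show ?case using ext[OF sub] nu0_eq[OF f] by simp
next
  case (Suc r)
  interpret E: measure_extension L M "Kf r" "Kf (Suc r)" "nus r"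
    by (rule measure_extension.intro[OF Kf_extension nus_measured])
  obtain n Y f where fib: "E.fibration m X n Y f" using E.ex_fibration[OF Suc.prems] .
  then have f: "dmap m X n Y f" "Kf r 0 n (\<lambda>_. Y)" "Kf r n m (fiber X f)" by (auto simp: E.fibration_def)
  have X: "(m, X) \<in> Ob" and Y: "(n, Y) \<in> Ob" using Suc.prems f(2) by (auto simp: Ob_def)
  have w: "\<rho> (m, fiber X f y) = nus r m (fiber X f y)" if "y \<in> Y" for y
    by (rule Suc.IH, rule E.K_inst[OF f(3)]) (use that definable_in[OF Kf_definable[OF f(2)]] in auto)
  have "\<rho> (m, X) = (\<Sum>a\<in>(\<lambda>y. \<rho> (m, fiber X f y)) ` Y. a * \<rho> (n, {y \<in> Y. \<rho> (m, fiber X f y) = a}))"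
    by (rule fubini_measure_sum[OF \<rho> X Y f(1)])
  also have "\<dots> = (\<Sum>a\<in>(\<lambda>y. nus r m (fiber X f y)) ` Y. a * nus r n {y \<in> Y. nus r m (fiber X f y) = a})"
  proof (rule sum.cong)
    show "(\<lambda>y. \<rho> (m, fiber X f y)) ` Y = (\<lambda>y. nus r m (fiber X f y)) ` Y" using w by (rule image_cong[OF refl])
    fix a
    have "{y \<in> Y. \<rho> (m, fiber X f y) = a} = {y \<in> Y. nus r m (fiber X f y) = a}" using w by auto
    moreover have "\<rho> (n, {y \<in> Y. nus r m (fiber X f y) = a}) = nus r n {y \<in> Y. nus r m (fiber X f y) = a}"
      by (rule Suc.IH, rule Kf_subset[OF f(2) simple_level[OF E.nu_simple[OF f(3)] Kf_definable[OF f(2)]]]) auto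
    ultimately show "a * \<rho> (n, {y \<in> Y. \<rho> (m, fiber X f y) = a}) = a * nus r n {y \<in> Y. nus r m (fiber X f y) = a}" by simp
  qed
  also have "\<dots> = nus (Suc r) m X"
    by (simp add: E.nu_ext_eq[OF fib] E.fib_int_def E.intg_def)
  finally show ?case .
qed

text \<open>The definition of fiberability allows any saturated extension \<open>N1\<close>, and
  there \<open>C1\<close> may come from any formula defining \<open>C\<close>, even with parameters.
  By \<open>star_unique\<close> it is nevertheless defined by \<open>\<delta>\<close>; then
  \<open>fib_same_type\<close> carries fiberability from \<open>N1\<close> to the fixed
  \<open>N\<close>.\<close>

lemma transfer_Kf:
  fixes N1 :: "('f, 'r, 'k) fo_struct"
  assumes N1: "is_struct L N1" "omega_saturated L N1" "elem_emb L M N1 h1"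
    and X: "transfer L M N1 h1 m X X1" and C1: "transfer L M N1 h1 1 (pow C 1) (pow C1 1)"
    and fib: "fib_sat L N1 C1 r m X1"
  shows "Kf r 0 m (\<lambda>_. X)"
proof -
  obtain \<delta> where \<delta>: "\<delta> \<in> forms L 1" "\<And>z. z \<in> pow U 1 \<Longrightarrow> z \<in> pow C 1 \<longleftrightarrow> sat M (nth z) \<delta>"
    "\<And>z. z \<in> pow (univ N) 1 \<Longrightarrow> z \<in> pow C' 1 \<longleftrightarrow> sat N (nth z) \<delta>"
    by (rule tr_formE[OF C_star]) blast
  have "tr L M N1 h1 U 1 (\<lambda>z. z \<in> pow C 1) (\<lambda>z. z \<in> pow C1 1)"
    by (rule transfer_tr[OF C1])
  moreover have "tr L M N1 h1 U 1 (\<lambda>z. z \<in> pow C 1) (\<lambda>z. sat N1 (nth z) \<delta>)"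
    by (rule tr_mono[OF tr_cong[OF tr_form[OF \<delta>(1)]]]) (use \<delta>(2) in auto)
  ultimately have C1\<delta>: "z \<in> pow C1 1 \<longleftrightarrow> sat N1 (nth z) \<delta>" if "z \<in> pow (univ N1) 1" for z
    using star_unique[OF N1(3)] that by blast
  interpret N1: saturated_structure L N1 C1
  proof
    show "tr L N1 N1 id {} 1 (\<lambda>z. z \<in> pow C1 1) (\<lambda>z. z \<in> pow C1 1)"
      by (rule tr_cong[OF tr_form[OF \<delta>(1)]]) (use C1\<delta> in auto)
  qed (fact N1)+
  have C1C': "tr L N1 N undefined {} 1 (\<lambda>z. z \<in> pow C1 1) (\<lambda>z. z \<in> pow C' 1)"
    by (rule tr_cong[OF tr_form[OF \<delta>(1)]]) (use C1\<delta> \<delta>(3) in auto)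
  obtain \<phi> ps where \<phi>: "set ps \<subseteq> U" "\<phi> \<in> forms L (m + length ps)" "X = solset M m \<phi> ps" "X1 = solset N1 m \<phi> (map h1 ps)"
    using X unfolding transfer_def by blast
  define l where "l = length ps"
  define \<rho> where "\<rho> = ren (\<lambda>i. if i < m then l + i else i - m) \<phi>"
  have \<rho>: "\<rho> \<in> forms L (l + m)" unfolding \<rho>_def by (rule swap_formula(1)) (use \<phi>(2) l_def in simp)
  have sol: "fsol Z m \<rho> qs = solset Z m \<phi> qs" if "length qs = l" for Z :: "('f, 'r, 'z) fo_struct" and qs
    using swap_formula(2)[of \<phi> L m l _ qs Z] \<phi>(2) that unfolding fsol_def solset_def \<rho>_def l_def
    by (auto simp: pow_length)
  have ps: "ps \<in> pow U l" using \<phi>(1) l_def by (simp add: pow_def)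
  have hps: "map h ps \<in> pow (univ N) l" "map h1 ps \<in> pow (univ N1) l"
    using pow_map[OF ps hU] pow_map[OF ps] N1(3) by (auto simp: elem_emb_def)
  \<comment> \<open>Both tuples have the type of \<open>ps\<close> in \<open>M\<close>, as both
    embeddings are elementary.\<close>
  have "same_type L N1 N l (map h1 ps) (map h ps)"
    using hps emb N1(3) \<phi>(1) l_def unfolding same_type_def elem_emb_def by metis
  then have "fib_sat L N C' r m (fsol N m \<rho> (map h ps))"
    by (rule fib_same_type[OF N1.saturated_structure_axioms N.saturated_structure_axioms C1C' _ \<rho>])
      (use fib \<phi>(4) sol[of "map h1 ps" N1] l_def in simp)
  moreover have "star 0 m (\<lambda>_. X) (\<lambda>_. fsol N m \<rho> (map h ps))"
  proof -
    have "transfer L M N h m X (solset N m \<phi> (map h ps))" using \<phi>(1-3) unfolding transfer_def by blast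
    then have "tr L M N h U m (\<lambda>z. z \<in> X) (\<lambda>z. z \<in> solset N m \<phi> (map h ps))"
      by (rule transfer_tr)
    then show ?thesis using sol[of "map h ps" N] l_def transfer_sub[OF X] by (auto simp: star_def solset_def)
  qed
  ultimately show ?thesis unfolding Kf_def by auto
qed

lemma Kf_transfer:
  assumes "Kf r 0 m (\<lambda>_. X)" "C' \<subseteq> univ N"
  obtains X' where "transfer L M N h m X X'" "transfer L M N h 1 (pow C 1) (pow C' 1)" "fib_sat L N C' r m X'"
proof -
  obtain X' where X': "star 0 m (\<lambda>_. X) X'" "fib_sat L N C' r m (X' [])" using assms(1) unfolding Kf_def by auto
  have "transfer L M N h m X (X' [])"
    using X'(1) by (subst transfer_iff) (auto simp: star_def)
  moreover have "transfer L M N h 1 (pow C 1) (pow C' 1)"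
    by (subst transfer_iff[OF pow_mono[OF C_U] pow_mono[OF assms(2)]]) (rule tr_mono[OF C_star], simp)
  ultimately show ?thesis using that X'(2) by blast
qed

end

theorem theorem1p1:
  fixes L :: "('f, 'r) lang"
    and M :: "('f, 'r, 'm) fo_struct"
    and C :: "'m set"
    and \<mu> :: "'m obj \<Rightarrow> 'a::{comm_semiring_0, comm_monoid_mult}"
  assumes "is_struct L M"
    and "C \<subseteq> univ M"
    and "definable0 L M 1 (pow C 1)"
    and "\<exists>a\<in>C. \<exists>b\<in>C. a \<noteq> b"
    and "stably_embedded L M C"
    and "fubini_measure L M (Def_sub L M C) \<mu>"
  shows "\<exists>!\<nu> :: 'm obj \<Rightarrow> 'a. \<nu> \<in> extensional (Def_fib L M C) \<and>
           fubini_measure L M (Def_fib L M C) \<nu> \<and>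
           (\<forall>X\<in>Def_sub L M C. \<nu> X = \<mu> X)"
proof -
  obtain N :: "('f, 'r, ('f, 'r, 'm) ext) fo_struct" and h where
    N: "is_struct L N" "omega_saturated L N" "elem_emb L M N h"
    using saturated_extension_exists[OF assms(1)] by blast
  obtain \<delta> where \<delta>: "\<delta> \<in> forms L 1" "pow C 1 = solset M 1 \<delta> []"
    using assms(3) unfolding definable0_def by blast
  define C' where "C' = {b \<in> univ N. [b] \<in> solset N 1 \<delta> []}"
  have C': "z \<in> pow C' 1 \<longleftrightarrow> sat N (nth z) \<delta>" if "z \<in> pow (univ N) 1" for z
    using that by (auto simp: C'_def solset_def pow_def length_Suc_conv)
  have C: "z \<in> pow C 1 \<longleftrightarrow> sat M (nth z) \<delta>" if "z \<in> pow (univ M) 1" for z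
    using that unfolding \<delta>(2) by (simp add: solset_def)
  interpret base_measure L M N C' h C \<mu>
  proof
    show "tr L N N id {} 1 (\<lambda>z. z \<in> pow C' 1) (\<lambda>z. z \<in> pow C' 1)"
      by (rule tr_cong[OF tr_form[OF \<delta>(1)]]) (use C' in auto)
    show "tr L M N h {} 1 (\<lambda>z. z \<in> pow C 1) (\<lambda>z. z \<in> pow C' 1)"
      by (rule tr_cong[OF tr_form[OF \<delta>(1)]]) (use C C' in auto)
  qed (fact assms N)+
  have C'N: "C' \<subseteq> univ N" by (auto simp: C'_def)
  \<comment> \<open>One inclusion moves fiberability from an arbitrary extension to
    \<open>N\<close>; for the other, \<open>N\<close> itself lies over the prescribed type and
    witnesses fiberability.\<close>
  have Ob: "Def_fib L M C = Ob"
  proof (intro set_eqI iffI)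
    fix Z assume "Z \<in> Def_fib L M C"
    then obtain m X r where Z: "Z = (m, X)" "r_fiberable L M C r m X"
      by (auto simp: Def_fib_def fiberable_def)
    then have "Kf r 0 m (\<lambda>_. X)" unfolding r_fiberable_def using transfer_Kf by blast
    then show "Z \<in> Ob" using Z(1) by (auto simp: Ob_def)
  next
    fix Z assume "Z \<in> Ob"
    then obtain m X r where Z: "Z = (m, X)" "Kf r 0 m (\<lambda>_. X)" by (auto simp: Ob_def)
    obtain X' where "transfer L M N h m X X'" "transfer L M N h 1 (pow C 1) (pow C' 1)" "fib_sat L N C' r m X'"
      using Kf_transfer[OF Z(2) C'N] .
    then have "r_fiberable L M C r m X" using N unfolding r_fiberable_def by blast
    then show "Z \<in> Def_fib L M C" using Kf_definable[OF Z(2)] Z(1) by (auto simp: Def_fib_def fiberable_def)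
  qed
  show ?thesis unfolding Ob
  proof (rule ex1I[of _ nu])
    show "nu \<in> extensional Ob \<and> fubini_measure L M Ob nu \<and> (\<forall>X\<in>Def_sub L M C. nu X = \<mu> X)"
      using nu_extensional fubini_measure_nu[OF C'N assms(4)] Def_sub_Ob(2) by auto
    fix \<rho> :: "'m obj \<Rightarrow> 'a"
    assume \<rho>: "\<rho> \<in> extensional Ob \<and> fubini_measure L M Ob \<rho> \<and> (\<forall>X\<in>Def_sub L M C. \<rho> X = \<mu> X)"
    show "\<rho> = nu"
    proof (rule extensionalityI[of _ Ob])
      show "\<rho> \<in> extensional Ob" "nu \<in> extensional Ob" using \<rho> nu_extensional by auto
      fix Z assume "Z \<in> Ob"
      then obtain m X r where Z: "Z = (m, X)" "Kf r 0 m (\<lambda>_. X)" by (auto simp: Ob_def)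
      then show "\<rho> Z = nu Z" using nu_unique[OF _ _ Z(2), of \<rho>] \<rho> nu_eq[OF Z(2)] by simp
    qed
  qed
qed

end
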